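(* Let $\mathbf{U}=\bigvee_{p\in\mathbb{P}}\mathbf{Ab}(p)*\mathbf{Ab}(p-1)$. Given a finitely generated subgroup $H$ of the free group $F_n$ of finite rank $n$ (given by a finite generating set of reduced words), it is decidable whether or not $H$ is $\mathbf{U}$-closed, i.e. closed in the pro-$\mathbf{U}$ topology on $F_n$.
   Context: A pseudovariety is a class of finite groups closed under taking subgroups, homomorphic images and finitary direct products; $\bigvee$ denotes join (smallest pseudovariety containing all the given ones). $\mathbb{P}$ is the set of all primes. $\mathbf{Ab}(n)$ is the pseudovariety of finite abelian groups of exponent dividing $n$. For pseudovarieties $\mathbf{V},\mathbf{W}$, $\mathbf{V}*\mathbf{W}$ is the pseudovariety of all finite groups $G$ having a normal subgroup $N\in\mathbf{V}$ with $G/N\in\mathbf{W}$. For a pseudovariety $\mathbf{V}$, the pro-$\mathbf{V}$ topology on a group $G$ is the coarsest topology making all homomorphisms from $G$ to (discrete) groups in $\mathbf{V}$ continuous; equivalently, $G$ is a topological group in which the normal subgroups $K$ with $G/K\in\mathbf{V}$ form a basis of neighbourhoods of the identity. *)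

theory Defs
  imports
    "HOL-Algebra.Generated_Groups"
    "HOL-Analysis.Abstract_Topology"
    "HOL-Library.Nat_Bijection"
    "HOL-Computational_Algebra.Primes"
begin

section \<open>Free groups of finite rank\<close>

text \<open>The letter \<open>(i, True)\<close> stands for the free generator \<open>x\<^sub>i\<close> and \<open>(i, False)\<close> for its
  inverse. The elements of the free group of rank \<open>n\<close> are the reduced words in the letters with
  index below \<open>n\<close>.\<close>

type_synonym letter = "nat \<times> bool"

definition inv_letter :: "letter \<Rightarrow> letter" where
  "inv_letter x = (fst x, \<not> snd x)"

definition reduced :: "letter list \<Rightarrow> bool" where
  "reduced w \<longleftrightarrow> successively (\<lambda>x y. y \<noteq> inv_letter x) w"

fun cons_reduce :: "letter \<Rightarrow> letter list \<Rightarrow> letter list" where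
  "cons_reduce x [] = [x]"
| "cons_reduce x (y # w) = (if y = inv_letter x then w else x # y # w)"

definition reduce :: "letter list \<Rightarrow> letter list" where
  "reduce w = foldr cons_reduce w []"

definition free_group :: "nat \<Rightarrow> letter list monoid" where
  "free_group n =
     \<lparr>carrier = {w. reduced w \<and> (\<forall>x\<in>set w. fst x < n)},
      monoid.mult = (\<lambda>u v. reduce (u @ v)),
      one = []\<rparr>"

lemma inv_letter_inv_letter [simp]: "inv_letter (inv_letter x) = x"
  by (simp add: inv_letter_def)

lemma inv_letter_neq [simp]: "inv_letter x \<noteq> x" "x \<noteq> inv_letter x"
  by (auto simp: inv_letter_def prod_eq_iff)

lemma fst_inv_letter [simp]: "fst (inv_letter x) = fst x"
  by (simp add: inv_letter_def)

lemma reduced_Nil [simp]: "reduced []"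
  by (simp add: reduced_def)

lemma reduced_ConsD: "reduced (x # w) \<Longrightarrow> reduced w"
  by (cases w) (auto simp: reduced_def)

lemma reduced_cons_reduce: "reduced w \<Longrightarrow> reduced (cons_reduce x w)"
  by (cases w) (auto simp: reduced_def dest: reduced_ConsD[unfolded reduced_def])

lemma set_cons_reduce: "set (cons_reduce x w) \<subseteq> insert x (set w)"
  by (cases w) auto

lemma cons_reduce_cancel: "reduced w \<Longrightarrow> cons_reduce x (cons_reduce (inv_letter x) w) = w"
  by (cases w; cases "tl w") (auto simp: reduced_def)

lemma cons_reduce_reduced: "reduced (x # w) \<Longrightarrow> cons_reduce x w = x # w"
  by (cases w) (auto simp: reduced_def)

lemma reduced_foldr: "reduced w \<Longrightarrow> reduced (foldr cons_reduce u w)"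
  by (induction u) (auto intro: reduced_cons_reduce)

lemma set_foldr: "set (foldr cons_reduce u w) \<subseteq> set u \<union> set w"
  by (induction u) (use set_cons_reduce in fastforce)+

lemma reduce_reduced: "reduced w \<Longrightarrow> reduce w = w"
  unfolding reduce_def
proof (induction w)
  case (Cons x w)
  then have "foldr cons_reduce w [] = w"
    using reduced_ConsD by blast
  then show ?case
    using cons_reduce_reduced[OF Cons.prems] by simp
qed simp

lemma reduce_append: "reduced v \<Longrightarrow> reduce (u @ v) = foldr cons_reduce u v"
  using reduce_reduced[of v] by (simp add: reduce_def)

lemma foldr_cons_reduce:
  assumes "reduced s" "reduced w"
  shows "foldr cons_reduce (cons_reduce x s) w = cons_reduce x (foldr cons_reduce s w)"
proof (cases s)
  case (Cons y t)
  then show ?thesis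
    using cons_reduce_cancel[OF reduced_foldr[OF assms(2)], of x t] by auto
qed simp

lemma foldr_foldr:
  assumes "reduced v" "reduced w"
  shows "foldr cons_reduce (foldr cons_reduce u v) w = foldr cons_reduce u (foldr cons_reduce v w)"
  by (induction u) (auto simp: foldr_cons_reduce assms reduced_foldr)

lemma foldr_inverse:
  "reduced v \<Longrightarrow> foldr cons_reduce (rev (map inv_letter w)) (foldr cons_reduce w v) = v"
proof (induction w)
  case (Cons x w)
  then show ?case
    using cons_reduce_cancel[OF reduced_foldr[of v w], of "inv_letter x"] by simp
qed simp

lemma group_free_group: "group (free_group n)"
proof (rule groupI)
  fix u v assume "u \<in> carrier (free_group n)" "v \<in> carrier (free_group n)"
  then show "u \<otimes>\<^bsub>free_group n\<^esub> v \<in> carrier (free_group n)"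
    using set_foldr[of u v] by (auto simp: free_group_def reduce_append reduced_foldr)
next
  fix u v w
  assume "u \<in> carrier (free_group n)" "v \<in> carrier (free_group n)" "w \<in> carrier (free_group n)"
  then show "u \<otimes>\<^bsub>free_group n\<^esub> v \<otimes>\<^bsub>free_group n\<^esub> w = u \<otimes>\<^bsub>free_group n\<^esub> (v \<otimes>\<^bsub>free_group n\<^esub> w)"
    by (simp add: free_group_def reduce_append reduced_foldr foldr_foldr)
next
  fix w assume w: "w \<in> carrier (free_group n)"
  let ?v = "foldr cons_reduce (rev (map inv_letter w)) []"
  have "foldr cons_reduce ?v w = foldr cons_reduce (rev (map inv_letter w)) (foldr cons_reduce w [])"
    using w foldr_foldr[of "[]" w] reduce_reduced[of w]
    by (simp add: free_group_def reduce_def)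
  then have "foldr cons_reduce ?v w = []"
    by (simp add: foldr_inverse)
  moreover have "\<forall>x\<in>set ?v. fst x < n"
  proof
    fix x assume "x \<in> set ?v"
    then obtain y where "y \<in> set w" "x = inv_letter y"
      using set_foldr[of "rev (map inv_letter w)" "[]"] by auto
    then show "fst x < n"
      using w by (simp add: free_group_def)
  qed
  then have "?v \<in> carrier (free_group n)"
    by (simp add: free_group_def reduced_foldr)
  ultimately show "\<exists>v\<in>carrier (free_group n). v \<otimes>\<^bsub>free_group n\<^esub> w = \<one>\<^bsub>free_group n\<^esub>"
    using w by (intro bexI[of _ ?v]) (auto simp: free_group_def reduce_append)
qed (auto simp: free_group_def reduce_append reduce_reduced)


section \<open>Pseudovarieties of finite groups\<close>

text \<open>A class of finite groups is represented by the groups in it whose carrier is a set of natural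
  numbers; every finite group is isomorphic to such a group. Closure under homomorphic images
  includes closure under isomorphism, and membership of a group with elements of an arbitrary type
  is membership up to isomorphism.\<close>

type_synonym group_class = "nat monoid set"

definition in_class :: "('a, 'b) monoid_scheme \<Rightarrow> group_class \<Rightarrow> bool" where
  "in_class G V \<longleftrightarrow> (\<exists>K\<in>V. G \<cong> K)"

definition pseudovariety :: "group_class \<Rightarrow> bool" where
  "pseudovariety V \<longleftrightarrow>
     V \<noteq> {} \<and>
     (\<forall>G\<in>V. group G \<and> finite (carrier G)) \<and>
     (\<forall>G\<in>V. \<forall>H. subgroup H G \<longrightarrow> G\<lparr>carrier := H\<rparr> \<in> V) \<and>
     (\<forall>G\<in>V. \<forall>K. group K \<longrightarrow> epi G K \<noteq> {} \<longrightarrow> K \<in> V) \<and>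
     (\<forall>G\<in>V. \<forall>H\<in>V. in_class (G \<times>\<times> H) V)"

definition pv_join :: "group_class set \<Rightarrow> group_class" where
  "pv_join \<F> = \<Inter>{V. pseudovariety V \<and> (\<forall>W\<in>\<F>. W \<subseteq> V)}"

definition pv_prod :: "group_class \<Rightarrow> group_class \<Rightarrow> group_class" where
  "pv_prod V W =
     {G. group G \<and> finite (carrier G) \<and> (\<exists>N. N \<lhd> G \<and> in_class (G\<lparr>carrier := N\<rparr>) V \<and> in_class (G Mod N) W)}"

text \<open>For an abelian group, \<open>x ^ n = 1\<close> for all \<open>x\<close> says that the exponent divides \<open>n\<close>.\<close>

definition Ab :: "nat \<Rightarrow> group_class" where
  "Ab n = {G. comm_group G \<and> finite (carrier G) \<and> (\<forall>x\<in>carrier G. x [^]\<^bsub>G\<^esub> n = \<one>\<^bsub>G\<^esub>)}"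

text \<open>The coarsest topology on \<open>carrier G\<close> for which all homomorphisms into discrete groups of the
  class \<open>V\<close> are continuous.\<close>

definition pro_topology :: "group_class \<Rightarrow> ('a, 'b) monoid_scheme \<Rightarrow> 'a topology" where
  "pro_topology V G =
     topology_generated_by {h -` S \<inter> carrier G | h S K. K \<in> V \<and> h \<in> hom G K \<and> S \<subseteq> carrier K}"

lemma topspace_pro_topology:
  assumes "pseudovariety V" "group G"
  shows "topspace (pro_topology V G) = carrier G"
proof -
  obtain K where K: "K \<in> V" "group K"
    using assms(1) by (auto simp: pseudovariety_def)
  have "(\<lambda>_. \<one>\<^bsub>K\<^esub>) \<in> hom G K"
    using K(2) by (auto simp: hom_def group.is_monoid)
  then have "\<exists>h S L. carrier G = h -` S \<inter> carrier G \<and> L \<in> V \<and> h \<in> hom G L \<and> S \<subseteq> carrier L"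
    using K by (intro exI[of _ "\<lambda>_. \<one>\<^bsub>K\<^esub>"] exI[of _ "carrier K"] exI[of _ K])
      (auto simp: group.is_monoid)
  then show ?thesis
    unfolding pro_topology_def topology_generated_by_topspace by blast
qed


section \<open>Decidability\<close>

text \<open>The total (general) recursive functions, as a class of \<open>k\<close>-ary functions on argument lists of
  length \<open>k\<close>: the closure of the basic functions under composition, primitive recursion and
  minimisation of functions that have a zero for all values of the parameters. Values on argument
  lists of other lengths carry no meaning.\<close>

inductive total_recursive :: "nat \<Rightarrow> (nat list \<Rightarrow> nat) \<Rightarrow> bool" where
  zero: "total_recursive k (\<lambda>xs. 0)"
| succ: "total_recursive 1 (\<lambda>xs. Suc (xs ! 0))"
| proj: "i < k \<Longrightarrow> total_recursive k (\<lambda>xs. xs ! i)"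
| comp: "total_recursive (length gs) f \<Longrightarrow> (\<forall>g\<in>set gs. total_recursive k g) \<Longrightarrow>
    total_recursive k (\<lambda>xs. f (map (\<lambda>g. g xs) gs))"
| prim_rec: "total_recursive k f \<Longrightarrow> total_recursive (Suc (Suc k)) g \<Longrightarrow>
    total_recursive (Suc k) (\<lambda>xs. rec_nat (f (tl xs)) (\<lambda>m r. g (m # r # tl xs)) (hd xs))"
| minimise: "total_recursive (Suc k) f \<Longrightarrow> (\<forall>xs. length xs = k \<longrightarrow> (\<exists>m. f (m # xs) = 0)) \<Longrightarrow>
    total_recursive k (\<lambda>xs. LEAST m. f (m # xs) = 0)"

text \<open>The decision problem with set of instances \<open>D\<close> and question \<open>P\<close>, where instances are given
  to the algorithm through the coding \<open>c\<close>.\<close>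

definition decidable_problem :: "('a \<Rightarrow> nat) \<Rightarrow> 'a set \<Rightarrow> ('a \<Rightarrow> bool) \<Rightarrow> bool" where
  "decidable_problem c D P \<longleftrightarrow>
     (\<exists>f. total_recursive 1 f \<and> (\<forall>x\<in>D. f [c x] = (if P x then 1 else 0)))"

fun letter_code :: "letter \<Rightarrow> nat" where
  "letter_code (i, b) = 2 * i + (if b then 1 else 0)"

definition word_code :: "letter list \<Rightarrow> nat" where
  "word_code w = list_encode (map letter_code w)"

text \<open>Instances consist of the rank of the free group and a list of generating words.\<close>

fun instance_code :: "nat \<times> letter list list \<Rightarrow> nat" where
  "instance_code (n, ws) = prod_encode (n, list_encode (map word_code ws))"

end

theory Submission
  imports Defs "HOL-Algebra.Weak_Morphisms" "HOL-Number_Theory.Number_Theory"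
begin

text \<open>Write \<open>[a, b] = a b a\<inverse> b\<inverse>\<close>, let \<open>F\<close> be the free group of rank \<open>n\<close>
  and \<open>H\<close> the subgroup generated by the words \<open>ws\<close>.

  The laws. A group \<open>G\<close> in \<open>Ab(q) * Ab(q - 1)\<close> has a commutative normal subgroup \<open>N\<close> of exponent
  dividing \<open>q\<close> that contains all commutators and all \<open>(q - 1)\<close>-st powers. So for \<open>p = q\<close> the products
  \<open>[d, e]^p [[a, b] c^(p-1), [a', b'] c'^(p-1)]\<close>, which form \<open>law_set G p\<close>, are trivial in \<open>G\<close>, and
  for other primes \<open>p\<close> they still lie in \<open>N\<close> and have order dividing \<open>q\<close>. To treat all \<open>q\<close> at once,
  fix a bound \<open>B\<close> and raise these products to the power \<open>law_exponent B p\<close>, the product of the numbers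
  up to \<open>B\<close> that \<open>p\<close> does not divide: this kills the primes \<open>q \<le> B\<close>, and what remains has order prime
  to \<open>1, \<dots>, B\<close>. The resulting property \<open>torsion_law\<close> defines a pseudovariety, which therefore
  contains \<open>U\<close>.

  The criterion. Let \<open>B \<ge> 2\<close> exceed the sum of the numbers \<open>length w + 1\<close> over \<open>ws\<close>. Then \<open>H\<close> is closed if
  and only if \<open>x ^ law_exponent B p\<close> lies in \<open>H\<close> for all primes \<open>p \<le> B\<close> and all \<open>x\<close> in
  \<open>law_set F p\<close> (lemmas \<open>closed_imp_laws\<close> and \<open>laws_imp_closed\<close>).

  Necessity. The groups in \<open>U\<close> are metabelian, so a closed \<open>H\<close> contains all \<open>[[a, b], [c, d]]\<close>. In the
  graph of the right cosets of \<open>H\<close> the closed paths labelled by the generators form a finite part, the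
  core, and a reduced word whose path from \<open>H\<close> leaves the core is not in \<open>H\<close>. If the index is
  infinite and \<open>n \<ge> 2\<close>, some conjugate of a fixed double commutator is a word of this kind
  (lemma \<open>infinite_index_double_comm\<close>), so this case is excluded; for \<open>n \<le> 1\<close> the laws are void. If
  the index is finite, all cosets are in the core (lemma \<open>finite_imp_core_closed\<close>), so the index is at
  most \<open>B\<close>, and \<open>y = x ^ law_exponent B p\<close> has a power \<open>y^i\<close> in \<open>H\<close> with \<open>1 \<le> i \<le> B\<close>. The images of
  \<open>y\<close> in groups of \<open>U\<close> have order prime to \<open>i\<close>, so \<open>y\<close> is a limit of powers of
  \<open>y^i\<close>, and \<open>y\<close> is in \<open>H\<close>.

  Sufficiency. For \<open>n \<le> 1\<close> all subgroups are closed. For \<open>n \<ge> 2\<close> the laws put the double commutators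
  into \<open>H\<close>, so the index is finite. Let \<open>C\<close> be the largest normal subgroup of \<open>F\<close> inside \<open>H\<close>, \<open>J p\<close> the set
  of elements of \<open>F'\<close> whose order modulo \<open>C\<close> divides \<open>law_exponent B p\<close>, and \<open>X p\<close> the set of
  \<open>p\<close>-th powers, modulo \<open>J p\<close>, of elements of the kernel of \<open>F \<rightarrow> (\<int>/(p-1))^n\<close>. The laws give that \<open>X p\<close> is
  normal with \<open>F / X p\<close> in \<open>Ab(p) * Ab(p - 1)\<close>, and for suitable \<open>D\<close> the intersection of all \<open>X p\<close>
  with the kernel of \<open>F \<rightarrow> (\<int>/D)^n\<close> lies in \<open>C\<close> (lemma \<open>X_inter_subset\<close>). Since each prime power divides
  \<open>q - 1\<close> for some prime \<open>q\<close>, that kernel contains an intersection of finitely many kernels of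
  \<open>F \<rightarrow> (\<int>/(q-1))^n\<close>. So finitely many quotients in \<open>U\<close> separate \<open>H\<close> from any element outside.

  The decision. If \<open>H\<close> is not closed, then an element that the laws put into \<open>H\<close> is outside, and the
  finite part of the coset graph formed by the core and the path of this element extends, by an
  argument of M. Hall, to an action of \<open>F\<close> on a set of \<open>m\<close> points, where \<open>m\<close> is known in advance. So \<open>H\<close> is
  closed if and only if, in each action on \<open>{0, \<dots>, m - 1}\<close> in which \<open>ws\<close> fix the point \<open>0\<close>, the laws
  hold at \<open>0\<close> (lemma \<open>decide_correct\<close>). Elements of \<open>F\<close> act on \<open>m\<close> points as words of
  length below \<open>m^m\<close> do, so all quantifiers in this condition are bounded, and it is recursive
  (lemma \<open>computable_decide\<close>).\<close>

section \<open>Words acting letter by letter\<close>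

lemma free_group_mult: "u \<otimes>\<^bsub>free_group n\<^esub> v = reduce (u @ v)"
  and free_group_one: "\<one>\<^bsub>free_group n\<^esub> = []"
  and free_group_carrier: "w \<in> carrier (free_group n) \<longleftrightarrow> reduced w \<and> (\<forall>x\<in>set w. fst x < n)"
  by (auto simp: free_group_def)

lemma reduced_reduce: "reduced (reduce w)"
  by (simp add: reduce_def reduced_foldr)

lemma set_reduce: "set (reduce w) \<subseteq> set w"
  using set_foldr[of w "[]"] by (simp add: reduce_def)

lemma reduce_in_free_group: "\<forall>x\<in>set w. fst x < n \<Longrightarrow> reduce w \<in> carrier (free_group n)"
  using set_reduce[of w] by (auto simp: free_group_carrier reduced_reduce)

lemma reduce_mult: "reduce u \<otimes>\<^bsub>free_group n\<^esub> reduce v = reduce (u @ v)"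
proof -
  have "reduce (reduce u @ reduce v) = foldr cons_reduce (foldr cons_reduce u []) (reduce v)"
    unfolding reduce_append[OF reduced_reduce] by (simp add: reduce_def)
  also have "\<dots> = foldr cons_reduce u (foldr cons_reduce v [])"
    by (subst foldr_foldr) (auto simp: reduced_reduce reduce_def reduced_foldr)
  finally show ?thesis
    by (simp add: reduce_def free_group_mult)
qed

definition inv_word :: "letter list \<Rightarrow> letter list" where
  "inv_word w = rev (map inv_letter w)"

lemma inv_word_simps [simp]: "inv_word [] = []" "inv_word (u @ v) = inv_word v @ inv_word u"
  "inv_word (x # w) = inv_word w @ [inv_letter x]" "length (inv_word w) = length w"
  by (simp_all add: inv_word_def)

lemma inv_word_inv_word [simp]: "inv_word (inv_word w) = w"
  by (induction w) auto

lemma set_inv_word: "set (inv_word w) = inv_letter ` set w"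
  by (simp add: inv_word_def)

lemma inv_letter_inject [simp]: "inv_letter x = inv_letter y \<longleftrightarrow> x = y"
  by (metis inv_letter_inv_letter)

lemma reduced_inv_word: "reduced w \<Longrightarrow> reduced (inv_word w)"
  unfolding reduced_def inv_word_def
  by (simp add: successively_map) (erule successively_mono, auto)

lemma reduced_glue: "reduced (u @ [x]) \<Longrightarrow> reduced (x # v) \<Longrightarrow> reduced (u @ x # v)"
  by (auto simp: reduced_def successively_append_iff)

lemma reduced_appendD: "reduced (u @ v) \<Longrightarrow> reduced u" "reduced (u @ v) \<Longrightarrow> reduced v"
  by (auto simp: reduced_def successively_append_iff)

lemma inv_word_in_free_group:
  "w \<in> carrier (free_group n) \<Longrightarrow> inv_word w \<in> carrier (free_group n)"
  by (auto simp: free_group_carrier reduced_inv_word set_inv_word)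

lemma free_group_inv:
  assumes "w \<in> carrier (free_group n)"
  shows "inv\<^bsub>free_group n\<^esub> w = inv_word w"
proof -
  have "inv_word w \<otimes>\<^bsub>free_group n\<^esub> w = foldr cons_reduce (rev (map inv_letter w)) (foldr cons_reduce w [])"
    using assms by (simp add: free_group_mult inv_word_def reduce_def)
  then have "inv_word w \<otimes>\<^bsub>free_group n\<^esub> w = \<one>\<^bsub>free_group n\<^esub>"
    by (simp add: foldr_inverse free_group_one)
  then show ?thesis
    using group.inv_equality[OF group_free_group] assms inv_word_in_free_group by blast
qed

text \<open>The vertices on the path labelled by \<open>w\<close> from \<open>t\<close> in the graph of an action, both ends included.\<close>

fun visits :: "(letter \<Rightarrow> 'a \<Rightarrow> 'a) \<Rightarrow> 'a \<Rightarrow> letter list \<Rightarrow> 'a set" where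
  "visits act t [] = {t}"
| "visits act t (x # w) = insert t (visits act (act x t) w)"

lemma finite_visits: "finite (visits act t w)"
  by (induction w arbitrary: t) auto

lemma card_visits: "card (visits act t w) \<le> Suc (length w)"
  by (induction w arbitrary: t) (auto intro!: card_insert_le_m1)

lemma start_in_visits: "t \<in> visits act t w"
  by (cases w) auto

lemma visits_append: "visits act t (u @ v) = visits act t u \<union> visits act (fold act u t) v"
  by (induction u arbitrary: t) (use start_in_visits in fastforce)+

lemma visits_prefix:
  "s \<in> visits act t w \<Longrightarrow> \<exists>u v. w = u @ v \<and> s = fold act u t"
proof (induction w arbitrary: t)
  case (Cons x w)
  show ?case
  proof (cases "s = t")
    case False
    then have "s \<in> visits act (act x t) w"
      using Cons.prems by auto
    from Cons.IH[OF this] obtain u v where "w = u @ v" "s = fold act u (act x t)"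
      by blast
    then show ?thesis
      by (intro exI[of _ "x # u"] exI[of _ v]) auto
  qed (use Cons in \<open>auto intro: exI[of _ "[]"]\<close>)
qed auto

text \<open>Letters act invertibly on \<open>A\<close>. Words act by \<open>fold\<close>, the first letter first, which makes this a
  right action of the free group, as on right cosets.\<close>

locale letter_action =
  fixes n :: nat and act :: "letter \<Rightarrow> 'a \<Rightarrow> 'a" and A :: "'a set"
  assumes act_closed: "fst x < n \<Longrightarrow> t \<in> A \<Longrightarrow> act x t \<in> A"
    and act_inv: "fst x < n \<Longrightarrow> t \<in> A \<Longrightarrow> act (inv_letter x) (act x t) = t"
begin

lemma act_inv': "fst x < n \<Longrightarrow> t \<in> A \<Longrightarrow> act x (act (inv_letter x) t) = t"
  using act_inv[of "inv_letter x" t] by simp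

lemma fold_closed: "\<forall>x\<in>set w. fst x < n \<Longrightarrow> t \<in> A \<Longrightarrow> fold act w t \<in> A"
  by (induction w arbitrary: t) (auto simp: act_closed)

lemma fold_cons_reduce:
  "\<forall>y\<in>set (x # w). fst y < n \<Longrightarrow> t \<in> A \<Longrightarrow> fold act (cons_reduce x w) t = fold act w (act x t)"
  by (cases w) (auto simp: act_inv)

lemma fold_reduce: "\<forall>x\<in>set w. fst x < n \<Longrightarrow> t \<in> A \<Longrightarrow> fold act (reduce w) t = fold act w t"
proof (induction w arbitrary: t)
  case (Cons x w)
  have "fold act (reduce (x # w)) t = fold act (reduce w) (act x t)"
    using Cons.prems fold_cons_reduce[of x "reduce w" t] set_reduce[of w] by (auto simp: reduce_def)
  then show ?case
    using Cons by (simp add: act_closed)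
qed (simp add: reduce_def)

lemma fold_mult:
  "u \<in> carrier (free_group n) \<Longrightarrow> v \<in> carrier (free_group n) \<Longrightarrow> t \<in> A \<Longrightarrow>
    fold act (u \<otimes>\<^bsub>free_group n\<^esub> v) t = fold act v (fold act u t)"
  by (subst free_group_mult, subst fold_reduce) (auto simp: free_group_carrier)

lemma fold_inv_word:
  "\<forall>x\<in>set w. fst x < n \<Longrightarrow> t \<in> A \<Longrightarrow> fold act (inv_word w) (fold act w t) = t"
  by (induction w arbitrary: t) (auto simp: act_closed act_inv)

lemma visits_closed: "\<forall>x\<in>set w. fst x < n \<Longrightarrow> t \<in> A \<Longrightarrow> visits act t w \<subseteq> A"
  by (induction w arbitrary: t) (auto simp: act_closed)

text \<open>A factor \<open>x x\<inverse>\<close> is a detour from a vertex and back, so that cancelling it adds no vertex to the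
  path.\<close>

lemma visits_reduce:
  "\<forall>x\<in>set w. fst x < n \<Longrightarrow> t \<in> A \<Longrightarrow> visits act t (reduce w) \<subseteq> visits act t w"
proof (induction w arbitrary: t)
  case (Cons x w)
  have IH: "visits act (act x t) (reduce w) \<subseteq> visits act (act x t) w"
    using Cons by (simp add: act_closed)
  have "visits act t (cons_reduce x (reduce w)) \<subseteq> insert t (visits act (act x t) (reduce w))"
  proof (cases "reduce w")
    case (Cons y v)
    then show ?thesis
      using Cons.prems by (auto simp: act_inv)
  qed simp
  then show ?case
    using IH by (auto simp: reduce_def)
qed (simp add: reduce_def)

lemma visits_inv_word:
  "\<forall>x\<in>set w. fst x < n \<Longrightarrow> t \<in> A \<Longrightarrow> visits act (fold act w t) (inv_word w) = visits act t w"
proof (induction w arbitrary: t)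
  case (Cons x w)
  then show ?case
    using start_in_visits[of "act x t" act w]
    by (auto simp: visits_append fold_inv_word act_closed act_inv)
qed simp

end

section \<open>The core of a coset graph\<close>

text \<open>The model is the graph of the right cosets of the subgroup generated by \<open>ws\<close>, with the subgroup
  itself as base point.\<close>

locale stabilizer_core = letter_action +
  fixes base :: 'a and ws :: "letter list list"
  assumes base: "base \<in> A"
    and ws: "set ws \<subseteq> carrier (free_group n)"
    and stabilizer: "\<And>w. w \<in> carrier (free_group n) \<Longrightarrow>
      w \<in> generate (free_group n) (set ws) \<longleftrightarrow> fold act w base = base"
begin

abbreviation "F \<equiv> free_group n"
abbreviation "H \<equiv> generate F (set ws)"

text \<open>The vertices of the Stallings graph of the subgroup: those on the closed paths at the base
  point that the generators label.\<close>

definition core :: "'a set" where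
  "core = insert base (\<Union>w\<in>set ws. visits act base w)"

lemma H_subset: "H \<subseteq> carrier F"
  using group.generate_incl[OF group_free_group ws] .

lemma finite_core: "finite core"
  by (auto simp: core_def finite_visits)

lemma card_core: "card core \<le> Suc (\<Sum>w\<leftarrow>ws. Suc (length w))"
proof -
  have "card (\<Union>w\<in>set ws. visits act base w) \<le> (\<Sum>w\<leftarrow>ws. Suc (length w))"
  proof (induction ws)
    case (Cons w ws)
    have "card (visits act base w \<union> (\<Union>w\<in>set ws. visits act base w)) \<le>
        card (visits act base w) + card (\<Union>w\<in>set ws. visits act base w)"
      by (rule card_Un_le)
    then show ?case
      using Cons card_visits[of act base w] by simp
  qed simp
  then show ?thesis
    unfolding core_def by (intro order_trans[OF card_insert_le_m1]) auto
qed

lemma core_subset: "core \<subseteq> A"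
  using visits_closed[OF _ base] ws base by (auto simp: core_def free_group_carrier subset_iff)

text \<open>Products traverse closed paths in the core one after the other, inverses traverse them backwards,
  and reduction leaves out detours.\<close>

lemma visits_subset_core: "w \<in> H \<Longrightarrow> visits act base w \<subseteq> core"
proof (induction w rule: generate.induct)
  case one
  then show ?case by (auto simp: free_group_one core_def)
next
  case (incl w)
  then show ?case by (auto simp: core_def)
next
  case (inv w)
  then have w: "w \<in> carrier F" "fold act w base = base"
    using ws stabilizer[of w] generate.incl[of w "set ws" F] by auto
  then have "visits act base (inv_word w) = visits act base w"
    using visits_inv_word[of w base] base by (auto simp: free_group_carrier)
  then show ?case
    using inv w(1) by (auto simp: core_def free_group_inv)
next
  case (eng u v)
  then have uv: "u \<in> carrier F" "v \<in> carrier F" "fold act u base = base"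
    using H_subset stabilizer by auto
  then have "visits act base (reduce (u @ v)) \<subseteq> visits act base (u @ v)"
    using base by (intro visits_reduce) (auto simp: free_group_carrier)
  then show ?case
    using eng uv by (auto simp: free_group_mult visits_append)
qed

text \<open>The word \<open>u\<close> is a prefix of a generator. It cannot end in the inverse of \<open>x\<close>, because the path of
  such a word passes through \<open>act x t\<close> just before it ends.\<close>

lemma core_boundary:
  assumes t: "t \<in> core" and x: "fst x < n" and out: "act x t \<notin> core"
  obtains u where "u \<in> carrier F" "fold act u base = t" "reduced (u @ [x])"
    "visits act base u \<subseteq> core" "length u \<le> (\<Sum>w\<leftarrow>ws. Suc (length w))"
proof -
  have "\<exists>u. u \<in> carrier F \<and> fold act u base = t \<and> visits act base u \<subseteq> core \<and>
     length u \<le> (\<Sum>w\<leftarrow>ws. Suc (length w))"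
  proof (cases "t = base")
    case True
    then show ?thesis
      by (intro exI[of _ "[]"]) (auto simp: free_group_carrier core_def)
  next
    case False
    then obtain w where w: "w \<in> set ws" "t \<in> visits act base w"
      using t by (auto simp: core_def)
    then obtain u v where uv: "w = u @ v" "t = fold act u base"
      using visits_prefix by metis
    have "Suc (length w) \<le> (\<Sum>w\<leftarrow>ws. Suc (length w))"
      by (rule member_le_sum_list) (use w(1) in auto)
    then have "length u \<le> (\<Sum>w\<leftarrow>ws. Suc (length w))"
      using uv(1) by simp
    moreover have "u \<in> carrier F"
      using subsetD[OF ws w(1)] uv(1) reduced_appendD(1)[of u v] by (auto simp: free_group_carrier)
    moreover have "visits act base u \<subseteq> core"
      using w(1) uv(1) by (auto simp: core_def visits_append)
    ultimately show ?thesis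
      using uv by blast
  qed
  then obtain u where u: "u \<in> carrier F" "fold act u base = t" "visits act base u \<subseteq> core"
    "length u \<le> (\<Sum>w\<leftarrow>ws. Suc (length w))"
    by blast
  have "reduced (u @ [x])"
  proof (rule ccontr)
    assume "\<not> reduced (u @ [x])"
    then have "u \<noteq> []" "x = inv_letter (last u)"
      using u(1) by (auto simp: free_group_carrier reduced_def successively_append_iff)
    then obtain u' where u': "u = u' @ [inv_letter x]"
      by (metis append_butlast_last_id inv_letter_inv_letter)
    have "fold act u' base \<in> A" 
      using u(1) u' base by (intro fold_closed) (auto simp: free_group_carrier)
    then have "act x t = fold act u' base"
      using u(2) u' x by (auto simp: act_inv')
    moreover have "fold act u' base \<in> visits act base u"
      unfolding u' by (simp add: visits_append)
    ultimately show False
      using u(3) out by auto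
  qed
  then show thesis
    using that u by blast
qed

lemma leaving_word_not_in_H:
  assumes "fold act (u @ [x]) base \<notin> core"
  shows "u @ [x] @ v \<notin> H"
proof
  assume "u @ [x] @ v \<in> H"
  then have "visits act base (u @ [x] @ v) \<subseteq> core"
    by (rule visits_subset_core)
  then show False
    using assms start_in_visits[of "act x (fold act u base)" act v] by (auto simp: visits_append)
qed

text \<open>Suppose that an edge labelled \<open>x\<close> leaves the core at \<open>t\<close>. By finiteness the letter \<open>x\<close> acts on \<open>t\<close> with a
  finite orbit, so repeated steps along \<open>x\<close> lead back to the core. The word that goes to \<open>t\<close>, follows
  these edges up to the first return, and goes back to the base point inside the core is reduced and
  fixes the base point, although its path leaves the core.\<close>

lemma finite_imp_core_closed:
  assumes "finite A" and t: "t \<in> core" and x: "fst x < n"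
  shows "act x t \<in> core"
proof (rule ccontr)
  assume out: "act x t \<notin> core"
  have tA: "t \<in> A" using t core_subset by auto
  have A: "(act x ^^ j) t \<in> A" for j
    by (induction j) (auto simp: tA act_closed x)
  have "\<not> inj (\<lambda>j. (act x ^^ j) t)"
    using assms(1) A by (metis (no_types, lifting) finite_imageD finite_subset image_subsetI infinite_UNIV_nat)
  then obtain i j where ij: "i < j" "(act x ^^ i) t = (act x ^^ j) t"
    unfolding inj_def by (metis linorder_neqE_nat)
  have cancel: "(act (inv_letter x) ^^ i) ((act x ^^ (i + l)) t) = (act x ^^ l) t" for i l
  proof (induction i)
    case (Suc i)
    have "(act x ^^ (Suc i + l)) t = act x ((act x ^^ (i + l)) t)" by simp
    then show ?case
      using Suc act_inv[OF x A[of "i + l"]] by (simp only: funpow_Suc_right o_apply)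
  qed simp
  have "(act x ^^ (j - i)) t \<in> core" "0 < j - i"
    using cancel[of i "j - i"] cancel[of i 0] ij t by auto
  \<comment> \<open>the first return to the core\<close>
  define k where "k = (LEAST k. 0 < k \<and> (act x ^^ k) t \<in> core)"
  have k: "0 < k" "(act x ^^ k) t \<in> core"
    using LeastI[of "\<lambda>k. 0 < k \<and> (act x ^^ k) t \<in> core" "j - i"] \<open>0 < j - i\<close> \<open>(act x ^^ (j - i)) t \<in> core\<close>
    by (auto simp: k_def)
  have "k \<noteq> 1" using out k(2) by auto
  then obtain l where l: "k = Suc l" "0 < l"
    using k(1) by (cases k) auto
  then have outl: "(act x ^^ l) t \<notin> core"
    using not_less_Least[of l "\<lambda>k. 0 < k \<and> (act x ^^ k) t \<in> core"] by (auto simp: k_def)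
  have "act (inv_letter x) ((act x ^^ k) t) \<notin> core"
    using outl l act_inv[OF x A] by simp
  then obtain u' where u': "u' \<in> carrier F" "fold act u' base = (act x ^^ k) t" "reduced (u' @ [inv_letter x])"
    using core_boundary[OF k(2), of "inv_letter x"] x by auto
  obtain u where u: "u \<in> carrier F" "fold act u base = t" "reduced (u @ [x])"
    using core_boundary[OF t x out] by blast
  have fr: "fold act (replicate i x) s = (act x ^^ i) s" for i s
    by (induction i arbitrary: s) (simp_all add: funpow_Suc_right del: funpow.simps(2))
  \<comment> \<open>no cancellation between \<open>u\<close>, the power of \<open>x\<close> and the way back, by the choice of \<open>u\<close> and \<open>u'\<close>\<close>
  have red: "reduced (u @ replicate i x @ [x])" for i
  proof (induction i)
    case (Suc i)
    then have "reduced ((u @ replicate i x) @ [x])"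
      by simp
    from reduced_glue[OF this, of "[x]"] have "reduced ((u @ replicate i x) @ x # [x])"
      by (simp add: reduced_def)
    moreover have "replicate (Suc i) x = replicate i x @ [x]"
      by (simp add: replicate_append_same)
    ultimately show ?case
      by (simp only: append.assoc append_Cons append_Nil)
  qed (simp add: u)
  have "reduced (x # inv_word u')"
    using reduced_inv_word[OF u'(3)] by simp
  then have R: "reduced ((u @ replicate l x) @ x # inv_word u')"
    using red[of l] reduced_glue[of "u @ replicate l x" x "inv_word u'"] by simp
  have "(u @ replicate l x) @ x # inv_word u' = u @ replicate k x @ inv_word u'"
    by (simp add: l(1) replicate_app_Cons_same)
  with R have "reduced (u @ replicate k x @ inv_word u')"
    by (simp only:)
  moreover have "\<forall>y\<in>set (u @ replicate k x @ inv_word u'). fst y < n"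
    using u(1) u'(1) x by (auto simp: free_group_carrier set_inv_word)
  ultimately have "u @ replicate k x @ inv_word u' \<in> carrier F"
    by (simp add: free_group_carrier)
  moreover have "fold act (u @ replicate k x @ inv_word u') base = base"
    using fold_inv_word[of u' base] u'(1) base by (simp add: u(2) fr u'(2)[symmetric] free_group_carrier)
  ultimately have "u @ [x] @ replicate l x @ inv_word u' \<in> H"
    using stabilizer l(1) by simp
  then show False
    using leaving_word_not_in_H[of u x] out u(2) by simp
qed

end

section \<open>Finite quotients as groups of natural numbers\<close>

text \<open>Membership in a class of groups refers to groups of natural numbers. Numbering the cosets of \<open>N\<close>
  turns the quotient map into a map \<open>f\<close> whose image is such a group.\<close>

lemma (in group) nat_quotient:
  assumes N: "N \<lhd> G" and fin: "finite (rcosets N)"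
  obtains f :: "'a \<Rightarrow> nat" where "weak_group_morphism f N G"
proof -
  interpret N: normal N G by (rule N)
  obtain e :: "'a set \<Rightarrow> nat" where e: "inj_on e (rcosets N)"
    using finite_imp_inj_to_nat_seg[OF fin] by blast
  have "weak_group_morphism (\<lambda>x. e (N #> x)) N G"
  proof (rule weak_group_morphismsI[OF N])
    fix a b assume ab: "a \<in> carrier G" "b \<in> carrier G"
    then have "e (N #> a) = e (N #> b) \<longleftrightarrow> N #> a = N #> b"
      using inj_on_eq_iff[OF e] rcosetsI N.subset by auto
    also have "\<dots> \<longleftrightarrow> a \<in> N #> b"
      using repr_independence repr_independenceD rcos_self ab N.subgroup_axioms by metis
    also have "\<dots> \<longleftrightarrow> a \<otimes> inv b \<in> N"
      using N.rcos_module[OF is_group ab(2,1)] by simp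
    finally show "e (N #> a) = e (N #> b) \<longleftrightarrow> a \<otimes> inv b \<in> N" .
  qed
  then show thesis by (rule that)
qed

lemma (in group) nat_copy:
  assumes "finite (carrier G)"
  obtains K :: "nat monoid" where "group K" "G \<cong> K" "finite (carrier K)"
proof -
  obtain f :: "'a \<Rightarrow> nat" where f: "inj_on f (carrier G)"
    using finite_imp_inj_to_nat_seg[OF assms] by blast
  interpret f: weak_group_morphism f "{\<one>}" G
    by (rule weak_group_morphismsI[OF one_is_normal])
      (use inj_on_eq_iff[OF f] inv_solve_right'[of \<one>] in auto)
  have w: "weak_group_morphism f {\<one>} G" by unfold_locales
  have "f \<in> iso G (image_group f G)"
    using f weak_group_morphism_is_hom[OF w] by (auto simp: iso_def bij_betw_def image_group_carrier)
  then show thesis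
    using that[of "image_group f G"] image_group_is_group[OF w] assms
    by (auto simp: is_iso_def image_group_carrier)
qed

lemma (in normal) rcos_eq_iff:
  "x \<in> carrier G \<Longrightarrow> y \<in> carrier G \<Longrightarrow> H #> x = H #> y \<longleftrightarrow> x \<otimes> inv y \<in> H"
  using repr_independence repr_independenceD rcos_self rcos_module[OF is_group]
    subgroup_axioms by metis

lemma group_in_class_Ab:
  assumes "group G"
  shows "in_class G (Ab m) \<longleftrightarrow> finite (carrier G) \<and>
    (\<forall>x\<in>carrier G. \<forall>y\<in>carrier G. x \<otimes>\<^bsub>G\<^esub> y = y \<otimes>\<^bsub>G\<^esub> x) \<and> (\<forall>x\<in>carrier G. x [^]\<^bsub>G\<^esub> m = \<one>\<^bsub>G\<^esub>)"
proof -
  interpret G: group G by fact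
  have *: "finite (carrier G) \<and> (\<forall>x\<in>carrier G. \<forall>y\<in>carrier G. x \<otimes>\<^bsub>G\<^esub> y = y \<otimes>\<^bsub>G\<^esub> x)
        \<and> (\<forall>x\<in>carrier G. x [^]\<^bsub>G\<^esub> m = \<one>\<^bsub>G\<^esub>) \<longleftrightarrow> K \<in> Ab m"
    if K: "group K" and iso: "G \<cong> K" for K :: "nat monoid"
  proof -
    interpret K: group K by fact
    obtain h where h: "h \<in> hom G K" "bij_betw h (carrier G) (carrier K)"
      using iso by (auto simp: is_iso_def iso_def)
    have fin: "finite (carrier G) \<longleftrightarrow> finite (carrier K)"
      using h(2) bij_betw_finite by blast
    have car: "carrier K = h ` carrier G" and inj: "inj_on h (carrier G)"
      using h(2) by (auto simp: bij_betw_def)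
    have comm: "h x \<otimes>\<^bsub>K\<^esub> h y = h y \<otimes>\<^bsub>K\<^esub> h x \<longleftrightarrow> x \<otimes>\<^bsub>G\<^esub> y = y \<otimes>\<^bsub>G\<^esub> x"
      if "x \<in> carrier G" "y \<in> carrier G" for x y
      using inj_on_eq_iff[OF inj, of "x \<otimes>\<^bsub>G\<^esub> y" "y \<otimes>\<^bsub>G\<^esub> x"] that h(1) by (simp add: hom_mult)
    have pow: "h x [^]\<^bsub>K\<^esub> m = \<one>\<^bsub>K\<^esub> \<longleftrightarrow> x [^]\<^bsub>G\<^esub> m = \<one>\<^bsub>G\<^esub>" if "x \<in> carrier G" for x
      using inj_on_eq_iff[OF inj, of "x [^]\<^bsub>G\<^esub> m" "\<one>\<^bsub>G\<^esub>"] that h(1) hom_nat_pow[OF h(1) that assms K]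
        hom_one[OF h(1) assms K] by simp
    have "comm_group K \<longleftrightarrow> (\<forall>x\<in>carrier K. \<forall>y\<in>carrier K. x \<otimes>\<^bsub>K\<^esub> y = y \<otimes>\<^bsub>K\<^esub> x)"
      by (intro iffI ballI K.group_comm_groupI) (auto intro: comm_monoid.m_comm[OF comm_group.axioms(1)])
    then have "comm_group K \<longleftrightarrow> (\<forall>x\<in>carrier G. \<forall>y\<in>carrier G. x \<otimes>\<^bsub>G\<^esub> y = y \<otimes>\<^bsub>G\<^esub> x)"
      using comm by (simp add: car)
    moreover have "(\<forall>x\<in>carrier K. x [^]\<^bsub>K\<^esub> m = \<one>\<^bsub>K\<^esub>) \<longleftrightarrow> (\<forall>x\<in>carrier G. x [^]\<^bsub>G\<^esub> m = \<one>\<^bsub>G\<^esub>)"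
      using pow by (simp add: car)
    ultimately show ?thesis
      using fin by (simp add: Ab_def) blast
  qed
  show ?thesis
  proof
    assume "in_class G (Ab m)"
    then obtain K where "K \<in> Ab m" "G \<cong> K" by (auto simp: in_class_def)
    then show "finite (carrier G) \<and>
    (\<forall>x\<in>carrier G. \<forall>y\<in>carrier G. x \<otimes>\<^bsub>G\<^esub> y = y \<otimes>\<^bsub>G\<^esub> x) \<and> (\<forall>x\<in>carrier G. x [^]\<^bsub>G\<^esub> m = \<one>\<^bsub>G\<^esub>)"
      using *[of K] by (auto simp: Ab_def comm_group_def)
  next
    assume r: "finite (carrier G) \<and>
    (\<forall>x\<in>carrier G. \<forall>y\<in>carrier G. x \<otimes>\<^bsub>G\<^esub> y = y \<otimes>\<^bsub>G\<^esub> x) \<and> (\<forall>x\<in>carrier G. x [^]\<^bsub>G\<^esub> m = \<one>\<^bsub>G\<^esub>)"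
    then have "finite (carrier G)" by simp
    then obtain K :: "nat monoid" where K: "group K" "G \<cong> K" by (rule G.nat_copy)
    have "K \<in> Ab m"
      using *[OF K] r by simp
    then show "in_class G (Ab m)"
      using K(2) by (auto simp: in_class_def)
  qed
qed

section \<open>Commutator laws\<close>

definition group_comm :: "('a, 'b) monoid_scheme \<Rightarrow> 'a \<Rightarrow> 'a \<Rightarrow> 'a" where
  "group_comm G a b = a \<otimes>\<^bsub>G\<^esub> b \<otimes>\<^bsub>G\<^esub> inv\<^bsub>G\<^esub> a \<otimes>\<^bsub>G\<^esub> inv\<^bsub>G\<^esub> b"

text \<open>The two factors are words that are trivial in every group of \<open>Ab(p) * Ab(p - 1)\<close>. As a product
  they need only one family of words, from which either factor is recovered by putting the variables
  of the other one equal to \<open>\<one>\<close>.\<close>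

definition law_value where
  "law_value G p a b c a' b' c' d e =
     group_comm G d e [^]\<^bsub>G\<^esub> (p::nat) \<otimes>\<^bsub>G\<^esub>
     group_comm G (group_comm G a b \<otimes>\<^bsub>G\<^esub> c [^]\<^bsub>G\<^esub> (p - 1)) (group_comm G a' b' \<otimes>\<^bsub>G\<^esub> c' [^]\<^bsub>G\<^esub> (p - 1))"

definition law_set :: "('a, 'b) monoid_scheme \<Rightarrow> nat \<Rightarrow> 'a set" where
  "law_set G p = {law_value G p a b c a' b' c' d e | a b c a' b' c' d e.
     {a, b, c, a', b', c', d, e} \<subseteq> carrier G}"

text \<open>The product of the numbers from \<open>1\<close> to the first argument that \<open>p\<close> does not divide.\<close>

fun law_exponent :: "nat \<Rightarrow> nat \<Rightarrow> nat" where
  "law_exponent 0 p = 1"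
| "law_exponent (Suc b) p = law_exponent b p * (if p dvd Suc b then 1 else Suc b)"

lemma law_exponent_not_dvd: "prime p \<Longrightarrow> \<not> p dvd law_exponent b p"
  by (induction b) (auto simp: prime_dvd_mult_iff dest: prime_gt_1_nat)

lemma dvd_law_exponent: "1 \<le> q \<Longrightarrow> q \<le> b \<Longrightarrow> \<not> p dvd q \<Longrightarrow> q dvd law_exponent b p"
  by (induction b) (auto simp: le_Suc_eq simp del: mult_Suc_right)

lemma law_setI:
  "{a, b, c, a', b', c', d, e} \<subseteq> carrier G \<Longrightarrow> law_value G p a b c a' b' c' d e \<in> law_set G p"
  unfolding law_set_def mem_Collect_eq
  by (rule exI[of _ a], rule exI[of _ b], rule exI[of _ c], rule exI[of _ a'], rule exI[of _ b'],
      rule exI[of _ c'], rule exI[of _ d], rule exI[of _ e]) simp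

lemma (in group) group_comm_closed [simp]:
  "a \<in> carrier G \<Longrightarrow> b \<in> carrier G \<Longrightarrow> group_comm G a b \<in> carrier G"
  by (simp add: group_comm_def)

lemma (in group) law_set_closed: "x \<in> law_set G p \<Longrightarrow> x \<in> carrier G"
  by (auto simp: law_set_def law_value_def)

lemma (in group) group_comm_eq_one_iff:
  "a \<in> carrier G \<Longrightarrow> b \<in> carrier G \<Longrightarrow> group_comm G a b = \<one> \<longleftrightarrow> a \<otimes> b = b \<otimes> a"
  unfolding group_comm_def using inv_solve_right[of \<one> "a \<otimes> b" "b \<otimes> a"]
  by (auto simp: inv_mult_group m_assoc)

lemma (in group_hom) hom_group_comm:
  "a \<in> carrier G \<Longrightarrow> b \<in> carrier G \<Longrightarrow> h (group_comm G a b) = group_comm H (h a) (h b)"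
  by (simp add: group_comm_def)

lemma (in group_hom) hom_law_value:
  assumes "{a, b, c, a', b', c', d, e} \<subseteq> carrier G"
  shows "h (law_value G p a b c a' b' c' d e) = law_value H p (h a) (h b) (h c) (h a') (h b') (h c') (h d) (h e)"
  using assms by (simp add: law_value_def hom_group_comm hom_nat_pow)

lemma (in group_hom) hom_law_set:
  assumes "x \<in> law_set G p" shows "h x \<in> law_set H p"
proof -
  obtain a b c a' b' c' d e where x: "x = law_value G p a b c a' b' c' d e"
    "{a, b, c, a', b', c', d, e} \<subseteq> carrier G"
    using assms by (auto simp: law_set_def)
  have "{h a, h b, h c, h a', h b', h c', h d, h e} \<subseteq> carrier H"
    using x(2) by auto
  then show ?thesis
    unfolding x(1) hom_law_value[OF x(2)] by (rule law_setI)
qed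

lemma (in group_hom) surj_law_set:
  assumes "h ` carrier G = carrier H" "y \<in> law_set H p" shows "\<exists>x\<in>law_set G p. y = h x"
proof -
  obtain a b c a' b' c' d e where y: "y = law_value H p a b c a' b' c' d e"
    "{a, b, c, a', b', c', d, e} \<subseteq> h ` carrier G"
    using assms by (auto simp: law_set_def)
  then obtain a1 b1 c1 a2 b2 c2 d1 e1 where e: "a = h a1" "b = h b1" "c = h c1" "a' = h a2" "b' = h b2" "c' = h c2"
     "d = h d1" "e = h e1" "{a1, b1, c1, a2, b2, c2, d1, e1} \<subseteq> carrier G"
    by auto
  then have "y = h (law_value G p a1 b1 c1 a2 b2 c2 d1 e1)"
    using y(1) hom_law_value[OF e(9)] by simp
  then show ?thesis
    using law_setI[OF e(9)] by blast
qed

text \<open>In a group of \<open>Ab(q) * Ab(q - 1)\<close> a product from \<open>law_set G p\<close> is trivial for \<open>q = p\<close> and has order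
  \<open>1\<close> or \<open>q\<close> otherwise. The exponent \<open>law_exponent B p\<close> takes care of the primes \<open>q \<le> B\<close>, the
  exponent \<open>r\<close> of the larger ones. Several of these occur in a direct product, which is why \<open>r\<close> is
  not required to be a prime.\<close>

definition torsion_law :: "('a, 'b) monoid_scheme \<Rightarrow> bool" where
  "torsion_law G \<longleftrightarrow> (\<forall>B p. prime p \<longrightarrow> p \<le> B \<longrightarrow> (\<forall>x\<in>law_set G p.
     \<exists>r. (\<forall>i\<in>{1..B}. coprime r i) \<and> (x [^]\<^bsub>G\<^esub> law_exponent B p) [^]\<^bsub>G\<^esub> r = \<one>\<^bsub>G\<^esub>))"

lemma torsion_law_image:
  assumes "group G" "group K" "h \<in> hom G K" "h ` carrier G = carrier K" "torsion_law G"
  shows "torsion_law K"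
  unfolding torsion_law_def
proof (intro allI impI ballI)
  interpret group_hom G K h
    using assms by (simp add: group_hom_def group_hom_axioms_def)
  fix B p y assume p: "prime p" "p \<le> B" "y \<in> law_set K p"
  then obtain x where x: "x \<in> law_set G p" "y = h x"
    using surj_law_set[OF assms(4)] by blast
  then obtain r where "\<forall>i\<in>{1..B}. coprime r i" "(x [^]\<^bsub>G\<^esub> law_exponent B p) [^]\<^bsub>G\<^esub> r = \<one>\<^bsub>G\<^esub>"
    using assms(5) p unfolding torsion_law_def by blast
  moreover have "(y [^]\<^bsub>K\<^esub> law_exponent B p) [^]\<^bsub>K\<^esub> r = h ((x [^]\<^bsub>G\<^esub> law_exponent B p) [^]\<^bsub>G\<^esub> r)"
    using x G.law_set_closed[OF x(1)] by (simp add: hom_nat_pow)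
  ultimately show "\<exists>r. (\<forall>i\<in>{1..B}. coprime r i) \<and> (y [^]\<^bsub>K\<^esub> law_exponent B p) [^]\<^bsub>K\<^esub> r = \<one>\<^bsub>K\<^esub>"
    by (intro exI[of _ r]) simp
qed

lemma torsion_law_inj:
  assumes "group G" "group K" "h \<in> hom G K" "inj_on h (carrier G)" "torsion_law K"
  shows "torsion_law G"
  unfolding torsion_law_def
proof (intro allI impI ballI)
  interpret group_hom G K h
    using assms by (simp add: group_hom_def group_hom_axioms_def)
  fix B p x assume p: "prime p" "p \<le> B" "x \<in> law_set G p"
  then obtain r where r: "\<forall>i\<in>{1..B}. coprime r i" "(h x [^]\<^bsub>K\<^esub> law_exponent B p) [^]\<^bsub>K\<^esub> r = \<one>\<^bsub>K\<^esub>"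
    using assms(5) hom_law_set[OF p(3)] unfolding torsion_law_def by blast
  have x: "x \<in> carrier G" using G.law_set_closed[OF p(3)] .
  then have "h ((x [^]\<^bsub>G\<^esub> law_exponent B p) [^]\<^bsub>G\<^esub> r) = h \<one>\<^bsub>G\<^esub>"
    using r(2) by (simp add: hom_nat_pow)
  then have "(x [^]\<^bsub>G\<^esub> law_exponent B p) [^]\<^bsub>G\<^esub> r = \<one>\<^bsub>G\<^esub>"
    using inj_onD[OF assms(4)] x by simp
  then show "\<exists>r. (\<forall>i\<in>{1..B}. coprime r i) \<and> (x [^]\<^bsub>G\<^esub> law_exponent B p) [^]\<^bsub>G\<^esub> r = \<one>\<^bsub>G\<^esub>"
    using r(1) by blast
qed

text \<open>The exponents \<open>r\<close> of the two components are multiplied.\<close>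

lemma torsion_law_DirProd:
  assumes "group G" "group K" "torsion_law G" "torsion_law K"
  shows "torsion_law (G \<times>\<times> K)"
  unfolding torsion_law_def
proof (intro allI impI ballI)
  interpret G: group G by fact
  interpret K: group K by fact
  interpret GK: group "G \<times>\<times> K" using assms DirProd_group by blast
  interpret f: group_hom "G \<times>\<times> K" G fst
    by unfold_locales (auto simp: hom_def)
  interpret s: group_hom "G \<times>\<times> K" K snd
    by unfold_locales (auto simp: hom_def)
  fix B p x assume p: "prime p" "p \<le> B" "x \<in> law_set (G \<times>\<times> K) p"
  let ?k = "law_exponent B p"
  obtain r1 where r1: "\<forall>i\<in>{1..B}. coprime r1 i" "(fst x [^]\<^bsub>G\<^esub> ?k) [^]\<^bsub>G\<^esub> r1 = \<one>\<^bsub>G\<^esub>"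
    using assms(3) f.hom_law_set[OF p(3)] p unfolding torsion_law_def by blast
  obtain r2 where r2: "\<forall>i\<in>{1..B}. coprime r2 i" "(snd x [^]\<^bsub>K\<^esub> ?k) [^]\<^bsub>K\<^esub> r2 = \<one>\<^bsub>K\<^esub>"
    using assms(4) s.hom_law_set[OF p(3)] p unfolding torsion_law_def by blast
  let ?y = "(x [^]\<^bsub>G \<times>\<times> K\<^esub> ?k) [^]\<^bsub>G \<times>\<times> K\<^esub> (r1 * r2)"
  have x: "x \<in> carrier (G \<times>\<times> K)" using GK.law_set_closed[OF p(3)] .
  have "fst ?y = (fst x [^]\<^bsub>G\<^esub> ?k) [^]\<^bsub>G\<^esub> (r1 * r2)" "snd ?y = (snd x [^]\<^bsub>K\<^esub> ?k) [^]\<^bsub>K\<^esub> (r2 * r1)"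
    using x by (simp_all add: f.hom_nat_pow s.hom_nat_pow mult.commute del: carrier_DirProd)
  moreover have "fst x \<in> carrier G" "snd x \<in> carrier K" using x by auto
  ultimately have "?y = \<one>\<^bsub>G \<times>\<times> K\<^esub>"
    using r1(2) r2(2) by (simp add: prod_eq_iff flip: G.nat_pow_pow K.nat_pow_pow)
  moreover have "\<forall>i\<in>{1..B}. coprime (r1 * r2) i"
    using r1(1) r2(1) by simp
  ultimately show "\<exists>r. (\<forall>i\<in>{1..B}. coprime r i) \<and> (x [^]\<^bsub>G \<times>\<times> K\<^esub> ?k) [^]\<^bsub>G \<times>\<times> K\<^esub> r = \<one>\<^bsub>G \<times>\<times> K\<^esub>"
    by blast
qed

lemma pseudovariety_torsion_law: "pseudovariety {G. group G \<and> finite (carrier G) \<and> torsion_law G}"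
    (is "pseudovariety ?V")
  unfolding pseudovariety_def
proof (intro conjI ballI allI impI)
  let ?K = "\<lparr>carrier = {0::nat}, monoid.mult = \<lambda>x y. 0, one = 0\<rparr>"
  interpret K: group ?K
    by (rule groupI) auto
  have "x = \<one>\<^bsub>?K\<^esub>" if "x \<in> carrier ?K" for x using that by simp
  then have "torsion_law ?K"
    unfolding torsion_law_def using K.law_set_closed K.nat_pow_closed by (metis coprime_1_left)
  then have "?K \<in> ?V"
    using K.group_axioms by simp
  then show "?V \<noteq> {}" by blast
next
  fix G H assume G: "G \<in> ?V" and H: "subgroup H G"
  interpret G: group G using G by simp
  have "id \<in> hom (G\<lparr>carrier := H\<rparr>) G"
    using group_hom.homh[OF G.canonical_inj_is_hom[OF H]] .
  then show "G\<lparr>carrier := H\<rparr> \<in> ?V"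
    using torsion_law_inj[of "G\<lparr>carrier := H\<rparr>" G id] G G.subgroup_imp_group[OF H]
      finite_subset[OF subgroup.subset[OF H]] by auto
next
  fix G K :: "nat monoid" assume G: "G \<in> ?V" "group K" "epi G K \<noteq> {}"
  then obtain h where "h \<in> hom G K" "h ` carrier G = carrier K"
    by (auto simp: epi_def)
  then show "K \<in> ?V"
    using torsion_law_image[of G K h] G finite_imageI[of "carrier G" h] by auto
next
  fix G K assume GK: "G \<in> ?V" "K \<in> ?V"
  then interpret GK: group "G \<times>\<times> K" using DirProd_group by blast
  have "finite (carrier (G \<times>\<times> K))" using GK by simp
  then obtain L :: "nat monoid" where L: "group L" "G \<times>\<times> K \<cong> L" "finite (carrier L)"
    by (rule GK.nat_copy)
  then obtain h where "h \<in> hom (G \<times>\<times> K) L" "h ` carrier (G \<times>\<times> K) = carrier L"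
    unfolding is_iso_def iso_def bij_betw_def by blast
  then have "torsion_law L"
    using torsion_law_image[OF GK.group_axioms L(1)] torsion_law_DirProd[of G K] GK by blast
  then show "in_class (G \<times>\<times> K) ?V"
    using L unfolding in_class_def by blast
qed auto

text \<open>Membership in products of the classes \<open>Ab\<close> is made explicit inside the group, so that neither
  quotients nor isomorphic copies have to be considered later.\<close>

lemma in_class_FactGroup_Ab:
  assumes "N \<lhd> G" "finite (carrier G)"
  shows "in_class (G Mod N) (Ab q) \<longleftrightarrow>
    (\<forall>x\<in>carrier G. \<forall>y\<in>carrier G. group_comm G x y \<in> N) \<and> (\<forall>x\<in>carrier G. x [^]\<^bsub>G\<^esub> q \<in> N)"
proof -
  interpret N: normal N G by fact
  have "N #>\<^bsub>G\<^esub> (x \<otimes>\<^bsub>G\<^esub> y) = N #>\<^bsub>G\<^esub> (y \<otimes>\<^bsub>G\<^esub> x) \<longleftrightarrow> group_comm G x y \<in> N"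
    if "x \<in> carrier G" "y \<in> carrier G" for x y
    using that by (subst N.rcos_eq_iff) (auto simp: group_comm_def N.inv_mult_group N.m_assoc)
  moreover have "N #>\<^bsub>G\<^esub> x = N \<longleftrightarrow> x \<in> N" if "x \<in> carrier G" for x
    using that N.coset_join1 N.coset_join2 N.subgroup_axioms N.subset by metis
  ultimately show ?thesis
    using assms(2)
    by (subst group_in_class_Ab[OF N.factorgroup_is_group])
      (simp add: carrier_FactGroup N.rcos_sum N.FactGroup_pow)
qed

lemma in_pv_prod_Ab_iff:
  fixes K :: "nat monoid"
  shows "K \<in> pv_prod (Ab p) (Ab q) \<longleftrightarrow> group K \<and> finite (carrier K) \<and> (\<exists>N. N \<lhd> K \<and>
    (\<forall>x\<in>N. \<forall>y\<in>N. x \<otimes>\<^bsub>K\<^esub> y = y \<otimes>\<^bsub>K\<^esub> x) \<and> (\<forall>x\<in>N. x [^]\<^bsub>K\<^esub> p = \<one>\<^bsub>K\<^esub>) \<and>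
    (\<forall>x\<in>carrier K. \<forall>y\<in>carrier K. group_comm K x y \<in> N) \<and> (\<forall>x\<in>carrier K. x [^]\<^bsub>K\<^esub> q \<in> N))"
proof -
  have sub: "in_class (K\<lparr>carrier := N\<rparr>) (Ab p) \<longleftrightarrow>
     (\<forall>x\<in>N. \<forall>y\<in>N. x \<otimes>\<^bsub>K\<^esub> y = y \<otimes>\<^bsub>K\<^esub> x) \<and> (\<forall>x\<in>N. x [^]\<^bsub>K\<^esub> p = \<one>\<^bsub>K\<^esub>)"
    if "N \<lhd> K" "finite (carrier K)" for N
  proof -
    interpret N: normal N K by fact
    have "x [^]\<^bsub>K\<lparr>carrier := N\<rparr>\<^esub> p = x [^]\<^bsub>K\<^esub> p" for x
      by (simp add: nat_pow_def)
    then show ?thesis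
      using finite_subset[OF N.subset that(2)]
      by (subst group_in_class_Ab[OF N.subgroup_is_group[OF N.is_group]]) simp
  qed
  have "N \<lhd> K \<and> in_class (K\<lparr>carrier := N\<rparr>) (Ab p) \<and> in_class (K Mod N) (Ab q) \<longleftrightarrow> N \<lhd> K \<and>
    (\<forall>x\<in>N. \<forall>y\<in>N. x \<otimes>\<^bsub>K\<^esub> y = y \<otimes>\<^bsub>K\<^esub> x) \<and> (\<forall>x\<in>N. x [^]\<^bsub>K\<^esub> p = \<one>\<^bsub>K\<^esub>) \<and>
    (\<forall>x\<in>carrier K. \<forall>y\<in>carrier K. group_comm K x y \<in> N) \<and> (\<forall>x\<in>carrier K. x [^]\<^bsub>K\<^esub> q \<in> N)"
    if "finite (carrier K)" for N
    by (cases "N \<lhd> K") (simp_all only: sub[OF _ that] in_class_FactGroup_Ab[OF _ that] simp_thms conj_assoc)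
  then show ?thesis
    by (cases "finite (carrier K)") (simp_all only: pv_prod_def mem_Collect_eq simp_thms)
qed

text \<open>Let \<open>N\<close> be the normal subgroup of exponent \<open>q\<close>. For \<open>p = q\<close> both factors of the law vanish. For
  \<open>p \<noteq> q\<close> the product lies in \<open>N\<close>, so its order divides \<open>q\<close>; either \<open>q \<le> B\<close>, and \<open>q\<close> divides the
  exponent, or \<open>q > B\<close>, and \<open>r = q\<close> will do.\<close>

lemma torsion_law_pv_prod:
  assumes q: "prime q" and G: "G \<in> pv_prod (Ab q) (Ab (q - 1))"
  shows "torsion_law G"
  unfolding torsion_law_def
proof (intro allI impI ballI)
  obtain N where "group G" and N: "N \<lhd> G" and comm: "\<And>x y. x \<in> N \<Longrightarrow> y \<in> N \<Longrightarrow> x \<otimes>\<^bsub>G\<^esub> y = y \<otimes>\<^bsub>G\<^esub> x"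
    and exp: "\<And>x. x \<in> N \<Longrightarrow> x [^]\<^bsub>G\<^esub> q = \<one>\<^bsub>G\<^esub>"
    and commN: "\<And>x y. x \<in> carrier G \<Longrightarrow> y \<in> carrier G \<Longrightarrow> group_comm G x y \<in> N"
    and powN: "\<And>x. x \<in> carrier G \<Longrightarrow> x [^]\<^bsub>G\<^esub> (q - 1) \<in> N"
    using G unfolding in_pv_prod_Ab_iff by blast
  interpret N: normal N G by (rule N)
  fix B p x assume p: "prime p" "p \<le> B" "x \<in> law_set G p"
  then obtain a b c a' b' c' d e where x: "x = law_value G p a b c a' b' c' d e"
    "{a, b, c, a', b', c', d, e} \<subseteq> carrier G"
    by (auto simp: law_set_def)
  have xc: "x \<in> carrier G" using N.law_set_closed[OF p(3)] .
  show "\<exists>r. (\<forall>i\<in>{1..B}. coprime r i) \<and> (x [^]\<^bsub>G\<^esub> law_exponent B p) [^]\<^bsub>G\<^esub> r = \<one>\<^bsub>G\<^esub>"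
  proof (cases "q = p")
    case True
    let ?y = "group_comm G a b \<otimes>\<^bsub>G\<^esub> c [^]\<^bsub>G\<^esub> (p - 1)" and ?y' = "group_comm G a' b' \<otimes>\<^bsub>G\<^esub> c' [^]\<^bsub>G\<^esub> (p - 1)"
    have "?y \<in> N" "?y' \<in> N"
      using x(2) commN powN True by auto
    then have "group_comm G ?y ?y' = \<one>\<^bsub>G\<^esub>"
      using comm N.group_comm_eq_one_iff N.mem_carrier by blast
    moreover have "group_comm G d e [^]\<^bsub>G\<^esub> p = \<one>\<^bsub>G\<^esub>"
      using exp commN x(2) True by auto
    ultimately have "x = \<one>\<^bsub>G\<^esub>"
      by (simp add: x(1) law_value_def)
    then show ?thesis by (intro exI[of _ 1]) simp
  next
    case False
    have pow_in_N: "z [^]\<^bsub>G\<^esub> (k::nat) \<in> N" if "z \<in> N" for z k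
      using that by (induction k) auto
    have "group_comm G d e [^]\<^bsub>G\<^esub> p \<in> N"
      using commN x(2) pow_in_N by auto
    then have "x \<in> N"
      unfolding x(1) law_value_def using commN x(2) by auto
    then have xq: "x [^]\<^bsub>G\<^esub> q = \<one>\<^bsub>G\<^esub>" by (rule exp)
    show ?thesis
    proof (cases "q \<le> B")
      case True
      have "\<not> p dvd q" using False q p(1) primes_dvd_imp_eq by blast
      then obtain k where "law_exponent B p = q * k"
        using dvd_law_exponent[of q B p] True prime_ge_1_nat[OF q] by (auto elim: dvdE)
      then have "x [^]\<^bsub>G\<^esub> law_exponent B p = \<one>\<^bsub>G\<^esub>"
        using xq xc by (simp flip: N.nat_pow_pow)
      then show ?thesis by (intro exI[of _ 1]) simp
    next
      case q_large: False
      have "coprime q i" if "i \<in> {1..B}" for i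
        using that q_large q by (intro prime_imp_coprime) (auto dest: dvd_imp_le)
      moreover have "(x [^]\<^bsub>G\<^esub> law_exponent B p) [^]\<^bsub>G\<^esub> q = \<one>\<^bsub>G\<^esub>"
        using xq xc N.nat_pow_pow[of x q "law_exponent B p"] by (simp add: N.nat_pow_pow mult.commute)
      ultimately show ?thesis by blast
    qed
  qed
qed

lemma torsion_law_join:
  assumes "G \<in> pv_join {pv_prod (Ab p) (Ab (p - 1)) | p. prime p}"
  shows "group G" "finite (carrier G)" "torsion_law G"
proof -
  have "G \<in> {G. group G \<and> finite (carrier G) \<and> torsion_law G}"
    using assms pseudovariety_torsion_law torsion_law_pv_prod unfolding pv_join_def
    by (auto simp: in_pv_prod_Ab_iff)
  then show "group G" "finite (carrier G)" "torsion_law G" by auto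
qed

section \<open>Exponent sums\<close>

definition esum :: "nat \<Rightarrow> letter list \<Rightarrow> int" where
  "esum i w = (\<Sum>x\<leftarrow>w. if fst x = i then (if snd x then 1 else -1) else 0)"

lemma esum_simps [simp]: "esum i [] = 0"
  "esum i (x # w) = (if fst x = i then (if snd x then 1 else -1) else 0) + esum i w"
  "esum i (u @ v) = esum i u + esum i v"
  by (simp_all add: esum_def)

lemma esum_reduce [simp]: "esum i (reduce w) = esum i w"
proof (induction w)
  case (Cons x w)
  have "esum i (cons_reduce x v) = esum i (x # v)" for v
    by (cases v) (auto simp: inv_letter_def)
  then show ?case
    using Cons by (simp add: reduce_def)
qed (simp add: reduce_def)

lemma esum_inv_word [simp]: "esum i (inv_word w) = - esum i w"
  by (induction w) (auto simp: inv_letter_def)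

lemma esum_mult [simp]: "esum i (u \<otimes>\<^bsub>free_group n\<^esub> v) = esum i u + esum i v"
  by (simp add: free_group_mult)

lemma esum_inv [simp]: "w \<in> carrier (free_group n) \<Longrightarrow> esum i (inv\<^bsub>free_group n\<^esub> w) = - esum i w"
  by (simp add: free_group_inv)

lemma esum_pow [simp]: "esum i (w [^]\<^bsub>free_group n\<^esub> (k::nat)) = int k * esum i w"
  by (induction k) (simp_all add: free_group_one algebra_simps)

lemma esum_comm [simp]:
  "a \<in> carrier (free_group n) \<Longrightarrow> b \<in> carrier (free_group n) \<Longrightarrow> esum i (group_comm (free_group n) a b) = 0"
  by (simp add: group_comm_def)

text \<open>A reduced word in one generator is a power of a single letter.\<close>

lemma rank_one_esum_zero:
  assumes "n \<le> 1" "w \<in> carrier (free_group n)" "esum 0 w = 0"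
  shows "w = []"
proof (cases w)
  case (Cons x v)
  have "esum 0 (x # v) = (if snd x then 1 else -1) * int (Suc (length v))"
    if "reduced (x # v)" "\<forall>y\<in>set (x # v). fst y = 0" for x v
    using that
  proof (induction v arbitrary: x)
    case (Cons y v)
    then have "y \<noteq> inv_letter x" "fst y = fst x"
      by (simp_all add: reduced_def)
    then have "snd y = snd x"
      by (cases x; cases y) (simp add: inv_letter_def)
    moreover have "esum 0 (y # v) = (if snd y then 1 else -1) * int (Suc (length v))"
      using Cons.prems reduced_ConsD[OF Cons.prems(1)] by (intro Cons.IH) auto
    moreover have "esum 0 (x # y # v) = (if snd x then 1 else -1) + esum 0 (y # v)"
      using Cons.prems by (simp only: esum_simps) simp
    ultimately show ?case
      by (simp only: list.size(4)) (simp add: algebra_simps)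
  qed simp
  moreover have "reduced (x # v)" "\<forall>y\<in>set (x # v). fst y = 0"
    using assms(1,2) unfolding Cons free_group_carrier by fastforce+
  ultimately have "esum 0 w \<noteq> 0"
    unfolding Cons by (simp only:) (simp split: if_splits)
  then show ?thesis
    using assms(3) by simp
qed simp

lemma rank_one_commutative:
  assumes "n \<le> 1" "a \<in> carrier (free_group n)" "b \<in> carrier (free_group n)"
  shows "group_comm (free_group n) a b = \<one>\<^bsub>free_group n\<^esub>"
  using rank_one_esum_zero[OF assms(1), of "group_comm (free_group n) a b"] assms
    group.group_comm_closed[OF group_free_group] by (simp add: free_group_one)

text \<open>Modulo \<open>N\<close> the generators \<open>x i\<close> commute, so \<open>w\<close> becomes the product of the powers
  \<open>x i ^ esum i w\<close>, which vanish as the exponents are multiples of \<open>D\<close>.\<close>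

lemma esum_dvd_imp_mem:
  fixes D :: nat
  assumes N: "N \<lhd> free_group n"
    and comm: "\<And>a b. a \<in> carrier (free_group n) \<Longrightarrow> b \<in> carrier (free_group n) \<Longrightarrow> group_comm (free_group n) a b \<in> N"
    and pow: "\<And>a. a \<in> carrier (free_group n) \<Longrightarrow> a [^]\<^bsub>free_group n\<^esub> D \<in> N"
    and w: "w \<in> carrier (free_group n)" "\<And>i. i < n \<Longrightarrow> int D dvd esum i w"
  shows "w \<in> N"
proof -
  let ?F = "free_group n"
  interpret N: normal N ?F by (rule N)
  let ?Q = "?F Mod N" and ?\<pi> = "\<lambda>w. N #>\<^bsub>?F\<^esub> w"
  interpret Q: comm_group ?Q
  proof (rule group.group_comm_groupI[OF N.factorgroup_is_group])
    fix s t assume "s \<in> carrier ?Q" "t \<in> carrier ?Q"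
    then obtain a b where ab: "a \<in> carrier ?F" "b \<in> carrier ?F" "s = ?\<pi> a" "t = ?\<pi> b"
      by (auto simp: carrier_FactGroup)
    then have "?\<pi> (a \<otimes>\<^bsub>?F\<^esub> b) = ?\<pi> (b \<otimes>\<^bsub>?F\<^esub> a)"
      using comm[of a b] by (subst N.rcos_eq_iff) (auto simp: group_comm_def N.inv_mult_group N.m_assoc)
    then show "s \<otimes>\<^bsub>?Q\<^esub> t = t \<otimes>\<^bsub>?Q\<^esub> s"
      using ab by (simp add: N.rcos_sum)
  qed
  interpret p: group_hom ?F ?Q ?\<pi>
    by unfold_locales (rule N.r_coset_hom_Mod)
  define x where "x i = ?\<pi> [(i, True)]" for i
  have gen: "[l] \<in> carrier ?F" if "fst l < n" for l
    using that by (simp add: free_group_carrier reduced_def)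
  have x: "x i \<in> carrier ?Q" if "i < n" for i
    using gen[of "(i, True)"] that unfolding x_def by (intro p.hom_closed) auto
  have "?\<pi> (reduce v) = finprod ?Q (\<lambda>i. x i [^]\<^bsub>?Q\<^esub> esum i v) {..<n}" if "\<forall>l\<in>set v. fst l < n" for v
    using that
  proof (induction v)
    case Nil
    have "finprod ?Q (\<lambda>i. x i [^]\<^bsub>?Q\<^esub> esum i []) {..<n} = \<one>\<^bsub>?Q\<^esub>"
      by (intro Q.finprod_one_eqI) simp
    moreover have "?\<pi> (reduce []) = \<one>\<^bsub>?Q\<^esub>"
      using p.hom_one by (simp add: free_group_one reduce_def)
    ultimately show ?case by simp
  next
    case (Cons l v)
    let ?e = "\<lambda>i. if fst l = i then (if snd l then 1 else -1) else (0::int)"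
    have l: "fst l < n" using Cons.prems by simp
    have IH: "?\<pi> (reduce v) = finprod ?Q (\<lambda>i. x i [^]\<^bsub>?Q\<^esub> esum i v) {..<n}"
      using Cons by simp
    have "inv\<^bsub>?F\<^esub> [(fst l, True)] = [(fst l, False)]"
      using gen[of "(fst l, True)"] l by (simp add: free_group_inv inv_letter_def)
    then have "?\<pi> [l] = x (fst l) [^]\<^bsub>?Q\<^esub> (if snd l then 1 else -1 :: int)"
      using p.hom_inv[OF gen[of "(fst l, True)"]] l x[OF l] Q.int_pow_neg[OF x[OF l], of 1]
      by (cases l) (auto simp: x_def)
    also have "\<dots> = finprod ?Q (\<lambda>i. if fst l = i then x i [^]\<^bsub>?Q\<^esub> (if snd l then 1 else -1 :: int) else \<one>\<^bsub>?Q\<^esub>) {..<n}"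
      by (rule Q.finprod_singleton[symmetric]) (use l x in auto)
    also have "\<dots> = finprod ?Q (\<lambda>i. x i [^]\<^bsub>?Q\<^esub> ?e i) {..<n}"
      by (rule Q.finprod_cong) (use x Q.one_closed in \<open>auto simp: simp_implies_def\<close>)
    finally have l_eq: "?\<pi> [l] = finprod ?Q (\<lambda>i. x i [^]\<^bsub>?Q\<^esub> ?e i) {..<n}" .
    have "reduce (l # v) = [l] \<otimes>\<^bsub>?F\<^esub> reduce v"
      using reduce_mult[of n "[l]" v] by (simp add: reduce_def)
    then have "?\<pi> (reduce (l # v)) = ?\<pi> [l] \<otimes>\<^bsub>?Q\<^esub> ?\<pi> (reduce v)"
      using gen[OF l] reduce_in_free_group[of v n] Cons.prems by simp
    also have "\<dots> = finprod ?Q (\<lambda>i. x i [^]\<^bsub>?Q\<^esub> ?e i \<otimes>\<^bsub>?Q\<^esub> x i [^]\<^bsub>?Q\<^esub> esum i v) {..<n}"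
      unfolding l_eq IH by (rule Q.finprod_multf[symmetric]) (use x in auto)
    also have "\<dots> = finprod ?Q (\<lambda>i. x i [^]\<^bsub>?Q\<^esub> esum i (l # v)) {..<n}"
      by (rule Q.finprod_cong)
        (use x in \<open>auto simp: simp_implies_def Q.int_pow_mult[symmetric] simp del: mult_FactGroup\<close>)
    finally show ?case .
  qed
  from this[of w] have "?\<pi> w = finprod ?Q (\<lambda>i. x i [^]\<^bsub>?Q\<^esub> esum i w) {..<n}"
    using w(1) by (simp add: free_group_carrier reduce_reduced)
  also have "\<dots> = \<one>\<^bsub>?Q\<^esub>"
  proof (intro Q.finprod_one_eqI)
    fix i assume "i \<in> {..<n}"
    then have i: "i < n" by simp
    obtain k where k: "esum i w = int D * k" using w(2)[OF i] by blast
    have "[(i, True)] [^]\<^bsub>?F\<^esub> D \<in> N"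
      using pow gen[of "(i, True)"] i by simp
    then have "?\<pi> ([(i, True)] [^]\<^bsub>?F\<^esub> D) = N"
      using N.coset_join2 N.subgroup_axioms by (simp add: N.mem_carrier)
    then have "x i [^]\<^bsub>?Q\<^esub> D = \<one>\<^bsub>?Q\<^esub>"
      using p.hom_nat_pow[of "[(i, True)]" D] gen[of "(i, True)"] i by (simp add: x_def)
    then show "x i [^]\<^bsub>?Q\<^esub> esum i w = \<one>\<^bsub>?Q\<^esub>"
      using Q.int_pow_pow[OF x[OF i], of "int D" k] Q.int_pow_one k
      by (simp add: int_pow_int del: one_FactGroup)
  qed
  finally show ?thesis
    using N.coset_join1[of N w] w(1) N.subgroup_axioms N.subset by simp
qed

section \<open>Powers and subgroups\<close>

lemma (in group) pow_gcd_mem: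
  fixes i j :: nat
  assumes K: "subgroup K G" and x: "x \<in> carrier G" and "x [^] i \<in> K" "x [^] j \<in> K"
  shows "x [^] gcd i j \<in> K"
proof -
  interpret K: subgroup K G by fact
  obtain u v :: int where "u * int i + v * int j = gcd (int i) (int j)"
    using bezout_int by blast
  then have "x [^] int (gcd i j) = x [^] (int i * u + int j * v)"
    by (simp add: mult.commute flip: gcd_int_int_eq)
  also have "\<dots> = (x [^] int i) [^] u \<otimes> (x [^] int j) [^] v"
    using x by (simp add: int_pow_mult int_pow_pow)
  also have "\<dots> \<in> K"
    using assms subgroup_int_pow_closed[OF K] by (simp add: int_pow_int)
  finally show ?thesis
    by (simp add: int_pow_int)
qed

lemma prime_dvd_law_exponent: "prime q \<Longrightarrow> q dvd law_exponent b p \<Longrightarrow> q \<le> b"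
  by (induction b) (auto simp: prime_dvd_mult_iff split: if_splits dest: prime_gt_1_nat dvd_imp_le simp del: mult_Suc_right)

text \<open>The exponents \<open>k\<close> with \<open>x ^ k\<close> in \<open>K\<close> are the multiples of the least positive one, \<open>d\<close>. A prime factor
  \<open>q\<close> of \<open>d\<close> would divide the exponents for all \<open>p\<close>; the exponent for \<open>p = 2\<close> shows \<open>q \<le> B\<close>, and then the one for
  \<open>p = q\<close> gives a contradiction.\<close>

lemma (in group) law_exponent_pow_mem:
  assumes K: "subgroup K G" and x: "x \<in> carrier G" and B: "2 \<le> B"
    and pow: "\<And>p. prime p \<Longrightarrow> p \<le> B \<Longrightarrow> x [^] law_exponent B p \<in> K"
  shows "x \<in> K"
proof -
  define d where "d = (LEAST d::nat. 0 < d \<and> x [^] d \<in> K)"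
  have pos: "0 < law_exponent B p" for p by (induction B) auto
  have d: "0 < d" "x [^] d \<in> K"
    using LeastI[of "\<lambda>d::nat. 0 < d \<and> x [^] d \<in> K" "law_exponent B 2"] pow[of 2] B pos[of 2]
    unfolding d_def by auto
  have dvd: "d dvd k" if "x [^] k \<in> K" for k :: nat
  proof -
    have "0 < gcd d k \<and> x [^] gcd d k \<in> K"
      using pow_gcd_mem[OF K x d(2) that] d(1) by simp
    then have "d \<le> gcd d k"
      unfolding d_def by (rule Least_le)
    then show ?thesis
      using d(1) gcd_le1_nat[of d k] by (metis gcd_dvd2 le_antisym not_gr_zero)
  qed
  have "d = 1"
  proof (rule ccontr)
    assume "d \<noteq> 1"
    then obtain q where q: "prime q" "q dvd d"
      using prime_factor_nat by blast
    have "q \<le> B"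
      using q dvd[OF pow[of 2]] B by (auto intro: prime_dvd_law_exponent dvd_trans)
    then have "q dvd law_exponent B q"
      using q dvd[OF pow[of q]] dvd_trans by blast
    then show False
      using law_exponent_not_dvd q(1) by blast
  qed
  then show ?thesis
    using d(2) x by simp
qed

lemma (in group) double_comm_in_law_set:
  assumes "a \<in> carrier G" "b \<in> carrier G" "c \<in> carrier G" "d \<in> carrier G"
  shows "group_comm G (group_comm G a b) (group_comm G c d) \<in> law_set G p"
proof -
  have "law_value G p a b \<one> c d \<one> \<one> \<one> = group_comm G (group_comm G a b) (group_comm G c d)"
    using assms by (simp add: law_value_def group_comm_def)
  then show ?thesis
    using law_setI[of a b \<one> c d \<one> \<one> \<one> G p] assms by simp
qed

section \<open>The coset graph of a finitely generated subgroup\<close>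

abbreviation coset_act :: "nat \<Rightarrow> letter \<Rightarrow> letter list set \<Rightarrow> letter list set" where
  "coset_act n x t \<equiv> t #>\<^bsub>free_group n\<^esub> [x]"

lemma letter_in_free_group: "fst x < n \<Longrightarrow> [x] \<in> carrier (free_group n)"
  by (simp add: free_group_carrier reduced_def)

lemma coset_act_r_coset:
  assumes "H \<subseteq> carrier (free_group n)" "g \<in> carrier (free_group n)" "fst x < n"
  shows "coset_act n x (H #>\<^bsub>free_group n\<^esub> g) = H #>\<^bsub>free_group n\<^esub> (g \<otimes>\<^bsub>free_group n\<^esub> [x])"
  using group.coset_mult_assoc[OF group_free_group assms(1,2) letter_in_free_group[OF assms(3)]] .

lemma fold_coset_act:
  assumes "H \<subseteq> carrier (free_group n)" "g \<in> carrier (free_group n)" "\<forall>x\<in>set w. fst x < n"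
  shows "fold (coset_act n) w (H #>\<^bsub>free_group n\<^esub> g) = H #>\<^bsub>free_group n\<^esub> (g \<otimes>\<^bsub>free_group n\<^esub> reduce w)"
  using assms(2,3)
proof (induction w arbitrary: g)
  case Nil
  interpret F: group "free_group n" by (rule group_free_group)
  show ?case using Nil F.r_one by (simp add: reduce_def free_group_one)
next
  case (Cons x w)
  interpret F: group "free_group n" by (rule group_free_group)
  have x: "[x] \<in> carrier (free_group n)" "reduce w \<in> carrier (free_group n)"
    using Cons.prems by (auto intro: letter_in_free_group reduce_in_free_group)
  have "reduce (x # w) = [x] \<otimes>\<^bsub>free_group n\<^esub> reduce w"
    using reduce_mult[of n "[x]" w] by (simp add: reduce_def)
  then show ?case
    using Cons x by (simp add: coset_act_r_coset[OF assms(1)] F.m_assoc)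
qed

lemma fold_coset_act_base:
  assumes "subgroup H (free_group n)" "w \<in> carrier (free_group n)"
  shows "fold (coset_act n) w H = H #>\<^bsub>free_group n\<^esub> w"
proof -
  interpret F: group "free_group n" by (rule group_free_group)
  have H: "H \<subseteq> carrier (free_group n)" using assms(1) subgroup.subset by blast
  show ?thesis
    using fold_coset_act[OF H F.one_closed, of w] assms(2) F.coset_mult_one[OF H]
    by (simp add: free_group_carrier reduce_reduced)
qed

lemma coset_core:
  assumes ws: "set ws \<subseteq> carrier (free_group n)"
  defines "H \<equiv> generate (free_group n) (set ws)"
  shows "stabilizer_core n (coset_act n) (rcosets\<^bsub>free_group n\<^esub> H) H ws"
proof -
  interpret F: group "free_group n" by (rule group_free_group)
  have sub: "subgroup H (free_group n)"
    unfolding H_def by (rule F.generate_is_subgroup[OF ws])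
  then have H: "H \<subseteq> carrier (free_group n)" using subgroup.subset by blast
  show ?thesis
  proof
    fix x :: letter and t assume x: "fst x < n" and t: "t \<in> rcosets\<^bsub>free_group n\<^esub> H"
    then obtain g where g: "g \<in> carrier (free_group n)" "t = H #>\<^bsub>free_group n\<^esub> g"
      by (auto simp: RCOSETS_def)
    have xc: "[x] \<in> carrier (free_group n)" using x letter_in_free_group by blast
    show "coset_act n x t \<in> rcosets\<^bsub>free_group n\<^esub> H"
      using F.rcosetsI[OF H] g xc by (simp add: coset_act_r_coset[OF H _ x])
    have "coset_act n (inv_letter x) (coset_act n x t) =
        H #>\<^bsub>free_group n\<^esub> (g \<otimes>\<^bsub>free_group n\<^esub> [x] \<otimes>\<^bsub>free_group n\<^esub> [inv_letter x])"
      using g x xc by (simp add: coset_act_r_coset[OF H])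
    moreover have "[inv_letter x] = inv\<^bsub>free_group n\<^esub> [x]"
      using xc by (simp add: free_group_inv)
    ultimately show "coset_act n (inv_letter x) (coset_act n x t) = t"
      using g xc by (simp add: F.m_assoc)
  next
    show "H \<in> rcosets\<^bsub>free_group n\<^esub> H"
      using subgroup.subgroup_in_rcosets[OF sub group_free_group] .
  next
    fix w assume w: "w \<in> carrier (free_group n)"
    have "w \<in> H \<longleftrightarrow> H #>\<^bsub>free_group n\<^esub> w = H"
      using F.coset_join1[OF _ w sub] F.coset_join2[OF w sub] by blast
    then show "w \<in> generate (free_group n) (set ws) \<longleftrightarrow> fold (coset_act n) w H = H"
      using fold_coset_act_base[OF sub w] by (simp add: H_def)
  qed (rule ws)
qed

text \<open>The core contains \<open>H\<close>, from which every coset is reached by letters.\<close>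

lemma rcosets_subset_core:
  assumes "set ws \<subseteq> carrier (free_group n)"
    and closed: "\<And>t x. t \<in> stabilizer_core.core (coset_act n) (generate (free_group n) (set ws)) ws \<Longrightarrow>
      fst x < n \<Longrightarrow> coset_act n x t \<in> stabilizer_core.core (coset_act n) (generate (free_group n) (set ws)) ws"
  shows "rcosets\<^bsub>free_group n\<^esub> (generate (free_group n) (set ws)) \<subseteq>
    stabilizer_core.core (coset_act n) (generate (free_group n) (set ws)) ws"
proof
  let ?H = "generate (free_group n) (set ws)"
  interpret stabilizer_core n "coset_act n" "rcosets\<^bsub>free_group n\<^esub> ?H" ?H ws
    by (rule coset_core[OF assms(1)])
  have sub: "subgroup ?H (free_group n)"
    by (rule group.generate_is_subgroup[OF group_free_group ws])
  have fold: "fold (coset_act n) w t \<in> core" if "t \<in> core" "\<forall>x\<in>set w. fst x < n" for w t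
    using that by (induction w arbitrary: t) (auto simp: closed)
  fix t assume "t \<in> rcosets\<^bsub>free_group n\<^esub> ?H"
  then obtain g where g: "g \<in> carrier (free_group n)" "t = ?H #>\<^bsub>free_group n\<^esub> g"
    by (auto simp: RCOSETS_def)
  show "t \<in> core"
    using fold[of ?H g] fold_coset_act_base[OF sub g(1)] g by (simp add: core_def free_group_carrier)
qed

lemma finite_index_bound:
  assumes ws: "set ws \<subseteq> carrier (free_group n)"
    and fin: "finite (rcosets\<^bsub>free_group n\<^esub> (generate (free_group n) (set ws)))"
  shows "card (rcosets\<^bsub>free_group n\<^esub> (generate (free_group n) (set ws))) \<le> Suc (\<Sum>w\<leftarrow>ws. Suc (length w))"
proof -
  let ?H = "generate (free_group n) (set ws)"
  interpret stabilizer_core n "coset_act n" "rcosets\<^bsub>free_group n\<^esub> ?H" ?H ws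
    by (rule coset_core[OF ws])
  have "rcosets\<^bsub>free_group n\<^esub> ?H \<subseteq> core"
    by (rule rcosets_subset_core[OF ws finite_imp_core_closed[OF fin]])
  then show ?thesis
    using card_mono[OF finite_core] card_core order_trans by blast
qed

lemma (in group) finite_index_pow_mem:
  assumes H: "subgroup H G" and fin: "finite (rcosets H)" and g: "g \<in> carrier G"
  obtains i where "1 \<le> i" "i \<le> card (rcosets H)" "g [^] i \<in> H"
proof -
  have HG: "H \<subseteq> carrier G" using H subgroup.subset by blast
  let ?f = "\<lambda>i::nat. H #> g [^] i"
  have "?f ` {0..card (rcosets H)} \<subseteq> rcosets H"
    using rcosetsI[OF HG] g by auto
  then have "card (?f ` {0..card (rcosets H)}) < card {0..card (rcosets H)}"
    using card_mono[OF fin] by (metis card_atLeastAtMost diff_zero less_Suc_eq_le)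
  then have "\<not> inj_on ?f {0..card (rcosets H)}"
    using card_image by fastforce
  then obtain i j where ij: "i < j" "j \<le> card (rcosets H)" "?f i = ?f j"
    unfolding inj_on_def by (metis atLeastAtMost_iff linorder_neqE_nat)
  have "g [^] j \<in> H #> g [^] i"
    using rcos_self[OF _ H, of "g [^] j"] ij(3) g by simp
  then have "g [^] j \<otimes> inv (g [^] i) \<in> H"
    using subgroup.rcos_module_imp[OF H is_group, of "g [^] i"] g by simp
  moreover have "g [^] j = g [^] (j - i) \<otimes> g [^] i"
    using ij(1) g by (simp add: nat_pow_mult)
  ultimately have "g [^] (j - i) \<in> H"
    using g by (simp add: m_assoc)
  then show thesis
    using that[of "j - i"] ij by simp
qed

text \<open>Let an edge labelled \<open>x\<close> leave the core at the end of the path of \<open>u\<close>, and let \<open>y\<close> be a generator other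
  than the one of \<open>x\<close>. As a reduced word, \<open>[[y, x], [y\<inverse>, x]]\<close> has 14 letters and begins and ends with \<open>y\<close>, so its
  conjugate by \<open>u x\<close> is reduced as it stands and starts with \<open>u x\<close>, whose path leaves the core.\<close>

lemma infinite_index_double_comm:
  assumes ws: "set ws \<subseteq> carrier (free_group n)" and n: "2 \<le> n"
    and inf: "infinite (rcosets\<^bsub>free_group n\<^esub> (generate (free_group n) (set ws)))"
  obtains a b c d where "{a, b, c, d} \<subseteq> carrier (free_group n)"
    "group_comm (free_group n) (group_comm (free_group n) a b) (group_comm (free_group n) c d)
       \<notin> generate (free_group n) (set ws)"
    "length (group_comm (free_group n) (group_comm (free_group n) a b) (group_comm (free_group n) c d))
       \<le> 2 * (\<Sum>w\<leftarrow>ws. Suc (length w)) + 16"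
proof -
  let ?F = "free_group n" and ?H = "generate (free_group n) (set ws)"
  interpret F: group ?F by (rule group_free_group)
  interpret stabilizer_core n "coset_act n" "rcosets\<^bsub>?F\<^esub> ?H" ?H ws
    by (rule coset_core[OF ws])
  have "\<not> rcosets\<^bsub>?F\<^esub> ?H \<subseteq> core"
    using inf finite_core finite_subset by blast
  then obtain t x where t: "t \<in> core" "fst x < n" "coset_act n x t \<notin> core"
    using rcosets_subset_core[OF ws] by blast
  obtain u where u: "u \<in> carrier ?F" "fold (coset_act n) u ?H = t" "reduced (u @ [x])"
    "length u \<le> (\<Sum>w\<leftarrow>ws. Suc (length w))"
    using core_boundary[OF t] by blast
  define y where "y = (if fst x = 0 then (1::nat, True) else (0, True))"
  have y: "fst y < n" "fst y \<noteq> fst x"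
    using n by (auto simp: y_def)
  define X where "X = inv_letter x"
  define Y where "Y = inv_letter y"
  have X: "fst X = fst x" "inv_letter X = x" and Y: "fst Y = fst y" "inv_letter Y = y"
    by (auto simp: X_def Y_def)
  have ne: "x \<noteq> X" "y \<noteq> Y" "X \<noteq> x" "Y \<noteq> y" "x \<noteq> y" "x \<noteq> Y" "X \<noteq> y" "X \<noteq> Y" "y \<noteq> x" "Y \<noteq> x" "y \<noteq> X" "Y \<noteq> X"
    using y(2) X Y by (auto simp: X_def Y_def)
  note letters = X Y X_def[symmetric] Y_def[symmetric] ne
  let ?g = "u @ [x]" and ?v = "[y, x, Y, X, Y, x, y, y, X, Y, x, Y, X, y]"
  have g: "?g \<in> carrier ?F"
    using u t(2) by (simp add: free_group_carrier)
  have l: "[x] \<in> carrier ?F" "[y] \<in> carrier ?F" "[Y] \<in> carrier ?F"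
    using t(2) y(1) Y(1) by (auto intro: letter_in_free_group)
  have "group_comm ?F [y] [x] = [y, x, Y, X]" "group_comm ?F [Y] [x] = [Y, x, y, X]"
    using l by (simp_all add: group_comm_def free_group_inv free_group_mult reduce_def letters)
  moreover have "[y, x, Y, X] \<in> carrier ?F" "[Y, x, y, X] \<in> carrier ?F"
    using y(1) t(2) X Y by (auto simp: free_group_carrier reduced_def letters)
  ultimately have v: "group_comm ?F (group_comm ?F [y] [x]) (group_comm ?F [Y] [x]) = ?v"
    by (simp add: group_comm_def[of _ "[y, x, Y, X]"] free_group_inv free_group_mult reduce_def letters)
  have vc: "?v \<in> carrier ?F"
    using l y(1) t(2) X Y by (simp add: free_group_carrier reduced_def letters)
  have "reduced ((u @ [x]) @ y # [x, Y, X, Y, x, y, y, X, Y, x, Y, X, y])"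
    using u(3) vc ne by (auto simp: free_group_carrier reduced_def successively_append_iff letters)
  then have "reduced (u @ x # ?v)"
    by simp
  moreover have "reduced (inv_word ?g)"
    using u(3) reduced_inv_word by blast
  ultimately have W: "reduced (?g @ ?v @ inv_word ?g)"
    by (auto simp: reduced_def successively_append_iff letters)
  have "?g \<otimes>\<^bsub>?F\<^esub> ?v \<otimes>\<^bsub>?F\<^esub> inv\<^bsub>?F\<^esub> ?g = reduce ((?g @ ?v) @ inv_word ?g)"
    using g vc reduce_mult[of n ?g ?v] reduce_mult[of n "?g @ ?v" "inv_word ?g"] reduced_inv_word[OF u(3)] u(3)
    by (simp add: free_group_inv free_group_carrier reduce_reduced)
  then have conj: "?g \<otimes>\<^bsub>?F\<^esub> ?v \<otimes>\<^bsub>?F\<^esub> inv\<^bsub>?F\<^esub> ?g = ?g @ ?v @ inv_word ?g"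
    using W by (simp only: append.assoc reduce_reduced)
  interpret c: group_hom ?F ?F "\<lambda>w. ?g \<otimes>\<^bsub>?F\<^esub> w \<otimes>\<^bsub>?F\<^esub> inv\<^bsub>?F\<^esub> ?g"
  proof (unfold_locales, rule homI)
    fix a b assume "a \<in> carrier ?F" "b \<in> carrier ?F"
    then show "?g \<otimes>\<^bsub>?F\<^esub> (a \<otimes>\<^bsub>?F\<^esub> b) \<otimes>\<^bsub>?F\<^esub> inv\<^bsub>?F\<^esub> ?g =
       ?g \<otimes>\<^bsub>?F\<^esub> a \<otimes>\<^bsub>?F\<^esub> inv\<^bsub>?F\<^esub> ?g \<otimes>\<^bsub>?F\<^esub> (?g \<otimes>\<^bsub>?F\<^esub> b \<otimes>\<^bsub>?F\<^esub> inv\<^bsub>?F\<^esub> ?g)"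
      using g by (simp add: F.m_assoc F.inv_solve_left)
  qed (use g in auto)
  let ?c = "\<lambda>w. ?g \<otimes>\<^bsub>?F\<^esub> w \<otimes>\<^bsub>?F\<^esub> inv\<^bsub>?F\<^esub> ?g"
  have eq: "group_comm ?F (group_comm ?F (?c [y]) (?c [x])) (group_comm ?F (?c [Y]) (?c [x])) = ?g @ ?v @ inv_word ?g"
    using l v conj by (simp add: c.hom_group_comm[symmetric])
  have "?g @ ?v @ inv_word ?g \<notin> ?H"
    using leaving_word_not_in_H[of u x "?v @ inv_word ?g"] t(3) u(2) by simp
  then show thesis
    using that[of "?c [y]" "?c [x]" "?c [Y]" "?c [x]"] l g u(4) unfolding eq by auto
qed

section \<open>Closed subgroups satisfy the laws\<close>

text \<open>Finite intersections of subbasic sets are determined by finitely many homomorphisms.\<close>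

lemma open_pro_topology_separation:
  assumes "openin (pro_topology V G) W" "g \<in> W"
  shows "\<exists>\<H>. finite \<H> \<and> (\<forall>h\<in>\<H>. \<exists>K\<in>V. h \<in> hom G K) \<and> (\<forall>g'\<in>carrier G. (\<forall>h\<in>\<H>. h g' = h g) \<longrightarrow> g' \<in> W)"
proof -
  have "generate_topology_on {h -` S \<inter> carrier G | h S K. K \<in> V \<and> h \<in> hom G K \<and> S \<subseteq> carrier K} W"
    using assms(1) unfolding pro_topology_def by (rule openin_topology_generated_by)
  then show ?thesis
    using assms(2)
  proof (induction rule: generate_topology_on.induct)
    case (Int a b)
    then have "g \<in> a" "g \<in> b" by auto
    from Int.IH(1)[OF this(1)] obtain A where A: "finite A" "\<forall>h\<in>A. \<exists>K\<in>V. h \<in> hom G K"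
      "\<forall>g'\<in>carrier G. (\<forall>h\<in>A. h g' = h g) \<longrightarrow> g' \<in> a" by (elim exE conjE)
    from Int.IH(2)[OF \<open>g \<in> b\<close>] obtain B where B: "finite B" "\<forall>h\<in>B. \<exists>K\<in>V. h \<in> hom G K"
      "\<forall>g'\<in>carrier G. (\<forall>h\<in>B. h g' = h g) \<longrightarrow> g' \<in> b" by (elim exE conjE)
    have "\<forall>g'\<in>carrier G. (\<forall>h\<in>A \<union> B. h g' = h g) \<longrightarrow> g' \<in> a \<inter> b"
      using A(3) B(3) by (simp add: ball_Un)
    then show ?case
      using A(1,2) B(1,2) by (intro exI[of _ "A \<union> B"] conjI) (simp_all add: ball_Un)
  next
    case (UN K)
    then obtain k where "k \<in> K" "g \<in> k" by blast
    from UN.IH[OF this] obtain A where A: "finite A" "\<forall>h\<in>A. \<exists>K\<in>V. h \<in> hom G K"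
      "\<forall>g'\<in>carrier G. (\<forall>h\<in>A. h g' = h g) \<longrightarrow> g' \<in> k" by (elim exE conjE)
    then show ?case
      using \<open>k \<in> K\<close> by (intro exI[of _ A]) auto
  next
    case (Basis s)
    then obtain h S K where "s = h -` S \<inter> carrier G" "K \<in> V" "h \<in> hom G K"
      by blast
    then show ?case
      using Basis.prems by (intro exI[of _ "{h}"]) auto
  qed simp
qed

lemma closedin_pro_topology_iff:
  assumes G: "group G" and V: "V \<noteq> {}" "\<And>K. K \<in> V \<Longrightarrow> group K" and H: "H \<subseteq> carrier G"
  shows "closedin (pro_topology V G) H \<longleftrightarrow> (\<forall>g\<in>carrier G - H. \<exists>\<H>. finite \<H> \<and>
    (\<forall>h\<in>\<H>. \<exists>K\<in>V. h \<in> hom G K) \<and> (\<forall>g'\<in>H. \<exists>h\<in>\<H>. h g' \<noteq> h g))"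
proof -
  let ?T = "pro_topology V G"
  have basis: "openin ?T (h -` S \<inter> carrier G)" if "K \<in> V" "h \<in> hom G K" "S \<subseteq> carrier K" for h S K
    unfolding pro_topology_def by (rule topology_generated_by_Basis) (use that in blast)
  obtain K where K: "K \<in> V" using V(1) by blast
  then interpret K: group K using V(2) by blast
  have "(\<lambda>_. \<one>\<^bsub>K\<^esub>) \<in> hom G K" by (simp add: hom_def)
  from basis[OF K this, of "carrier K"] have "openin ?T (carrier G)"
    by (simp add: vimage_def)
  moreover have "topspace ?T \<subseteq> carrier G"
    unfolding pro_topology_def topology_generated_by_topspace by blast
  ultimately have top: "topspace ?T = carrier G"
    using openin_subset by blast
  show ?thesis
  proof
    assume "closedin ?T H"
    then have op: "openin ?T (carrier G - H)"
      unfolding closedin_def top by blast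
    show "\<forall>g\<in>carrier G - H. \<exists>\<H>. finite \<H> \<and> (\<forall>h\<in>\<H>. \<exists>K\<in>V. h \<in> hom G K) \<and> (\<forall>g'\<in>H. \<exists>h\<in>\<H>. h g' \<noteq> h g)"
    proof
      fix g assume "g \<in> carrier G - H"
      from open_pro_topology_separation[OF op this] obtain \<H> where "finite \<H>" "\<forall>h\<in>\<H>. \<exists>K\<in>V. h \<in> hom G K"
        "\<forall>g'\<in>carrier G. (\<forall>h\<in>\<H>. h g' = h g) \<longrightarrow> g' \<in> carrier G - H" by blast
      then show "\<exists>\<H>. finite \<H> \<and> (\<forall>h\<in>\<H>. \<exists>K\<in>V. h \<in> hom G K) \<and> (\<forall>g'\<in>H. \<exists>h\<in>\<H>. h g' \<noteq> h g)"
        using H by (intro exI[of _ \<H>]) blast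
    qed
  next
    assume sep: "\<forall>g\<in>carrier G - H. \<exists>\<H>. finite \<H> \<and> (\<forall>h\<in>\<H>. \<exists>K\<in>V. h \<in> hom G K) \<and> (\<forall>g'\<in>H. \<exists>h\<in>\<H>. h g' \<noteq> h g)"
    have "openin ?T (carrier G - H)"
    proof (subst openin_subopen, intro ballI)
      fix g assume g: "g \<in> carrier G - H"
      from bspec[OF sep this] obtain \<H> where \<H>: "finite \<H>" "\<forall>h\<in>\<H>. \<exists>K\<in>V. h \<in> hom G K"
          "\<forall>g'\<in>H. \<exists>h\<in>\<H>. h g' \<noteq> h g" by (elim exE conjE)
      let ?W = "carrier G \<inter> \<Inter>((\<lambda>h. h -` {h g} \<inter> carrier G) ` \<H>)"
      have "openin ?T ?W"
      proof (rule openin_Int_Inter)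
        fix Y assume "Y \<in> (\<lambda>h. h -` {h g} \<inter> carrier G) ` \<H>"
        then obtain h where h: "h \<in> \<H>" "Y = h -` {h g} \<inter> carrier G" by blast
        obtain L where L: "L \<in> V" "h \<in> hom G L" using \<H>(2) h(1) by blast
        then show "openin ?T Y"
          using basis[OF L, of "{h g}"] g hom_in_carrier[OF L(2)] h(2) by auto
      qed (use \<H>(1) \<open>openin ?T (carrier G)\<close> in auto)
      moreover have "?W \<subseteq> carrier G - H"
      proof
        fix w assume w: "w \<in> ?W"
        have "w \<notin> H"
        proof
          assume "w \<in> H"
          from bspec[OF \<H>(3) this] obtain h where "h \<in> \<H>" "h w \<noteq> h g" ..
          moreover from this(1) have "w \<in> h -` {h g} \<inter> carrier G"
            using w by blast
          ultimately show False by simp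
        qed
        then show "w \<in> carrier G - H" using w by simp
      qed
      moreover have "g \<in> ?W" using g by blast
      ultimately show "\<exists>W. openin ?T W \<and> g \<in> W \<and> W \<subseteq> carrier G - H"
        by (intro exI[of _ ?W] conjI)
    qed
    then show "closedin ?T H"
      using H by (simp add: closedin_def top)
  qed
qed

lemma torsion_lawD:
  assumes "torsion_law G" "prime p" "p \<le> B" "x \<in> law_set G p"
  obtains r where "\<forall>i\<in>{1..B}. coprime r i" "(x [^]\<^bsub>G\<^esub> law_exponent B p) [^]\<^bsub>G\<^esub> r = \<one>\<^bsub>G\<^esub>"
  using assms unfolding torsion_law_def by blast

text \<open>A double commutator belongs to \<open>law_set K p\<close> for every \<open>p\<close>. If \<open>B\<close> exceeds the order of \<open>K\<close>, then the exponents
  \<open>r\<close> are prime to the orders of elements, hence superfluous.\<close>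

lemma torsion_law_double_comm:
  assumes "group K" "finite (carrier K)" "torsion_law K"
    and abcd: "a \<in> carrier K" "b \<in> carrier K" "c \<in> carrier K" "d \<in> carrier K"
  shows "group_comm K (group_comm K a b) (group_comm K c d) = \<one>\<^bsub>K\<^esub>"
proof -
  interpret K: group K by fact
  let ?x = "group_comm K (group_comm K a b) (group_comm K c d)"
  have x: "?x \<in> carrier K" using abcd by simp
  have triv: "subgroup {\<one>\<^bsub>K\<^esub>} K" by (rule K.triv_subgroup)
  have fin: "finite (rcosets\<^bsub>K\<^esub> {\<one>\<^bsub>K\<^esub>})"
    using assms(2) by (simp add: RCOSETS_def)
  \<comment> \<open>the cosets of the trivial subgroup count the elements of \<open>K\<close>\<close>
  define B where "B = card (rcosets\<^bsub>K\<^esub> {\<one>\<^bsub>K\<^esub>}) + 2"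
  have "?x \<in> {\<one>\<^bsub>K\<^esub>}"
  proof (rule K.law_exponent_pow_mem[OF triv x])
    show "2 \<le> B" by (simp add: B_def)
    fix p assume p: "prime p" "p \<le> B"
    let ?y = "?x [^]\<^bsub>K\<^esub> law_exponent B p"
    have "?x \<in> law_set K p"
      using abcd by (rule K.double_comm_in_law_set)
    with assms(3) p obtain r where r: "\<forall>i\<in>{1..B}. coprime r i" "?y [^]\<^bsub>K\<^esub> r = \<one>\<^bsub>K\<^esub>"
      by (rule torsion_lawD)
    have y: "?y \<in> carrier K" using x by simp
    obtain i where i: "1 \<le> i" "i \<le> card (rcosets\<^bsub>K\<^esub> {\<one>\<^bsub>K\<^esub>})" "?y [^]\<^bsub>K\<^esub> i \<in> {\<one>\<^bsub>K\<^esub>}"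
      by (rule K.finite_index_pow_mem[OF triv fin y])
    have "coprime r i" using r(1) i by (simp add: B_def)
    then show "?y \<in> {\<one>\<^bsub>K\<^esub>}"
      using K.pow_gcd_mem[OF triv y, of r i] r(2) i(3) y by simp
  qed
  then show ?thesis by simp
qed

text \<open>Let \<open>y\<close> be the power that should lie in \<open>H\<close>. When the index is finite, \<open>y^i\<close> is in \<open>H\<close> for some
  \<open>i \<le> B\<close>. If \<open>y\<close> were not in \<open>H\<close>, finitely many homomorphisms into groups of \<open>V\<close> would separate it from \<open>H\<close>. Each of them
  annihilates some power \<open>y^r\<close> with \<open>r\<close> prime to \<open>i\<close>, so all of them identify \<open>y\<close> with a suitable power
  of \<open>y^i\<close>, which is in \<open>H\<close>.\<close>

theorem closed_imp_laws:
  assumes V: "V \<noteq> {}" "\<And>K. K \<in> V \<Longrightarrow> group K \<and> finite (carrier K) \<and> torsion_law K"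
    and ws: "set ws \<subseteq> carrier (free_group n)"
    and closed: "closedin (pro_topology V (free_group n)) (generate (free_group n) (set ws))"
    and B: "Suc (\<Sum>w\<leftarrow>ws. Suc (length w)) \<le> B"
    and p: "prime p" "p \<le> B" and x: "x \<in> law_set (free_group n) p"
  shows "x [^]\<^bsub>free_group n\<^esub> law_exponent B p \<in> generate (free_group n) (set ws)"
proof (rule ccontr)
  let ?F = "free_group n" and ?H = "generate (free_group n) (set ws)"
  interpret F: group ?F by (rule group_free_group)
  let ?y = "x [^]\<^bsub>?F\<^esub> law_exponent B p"
  assume notin: "?y \<notin> ?H"
  have sub: "subgroup ?H ?F" by (rule F.generate_is_subgroup[OF ws])
  then interpret H: subgroup ?H ?F .
  have grp: "\<And>K. K \<in> V \<Longrightarrow> group K" using V(2) by blast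
  have "\<forall>g\<in>carrier ?F - ?H. \<exists>\<H>. finite \<H> \<and> (\<forall>h\<in>\<H>. \<exists>K\<in>V. h \<in> hom ?F K) \<and> (\<forall>g'\<in>?H. \<exists>h\<in>\<H>. h g' \<noteq> h g)"
    by (rule iffD1[OF closedin_pro_topology_iff[OF F.group_axioms V(1) _ H.subset] closed]) (rule grp)
  note sep = bspec[OF this]
  have xc: "x \<in> carrier ?F" using F.law_set_closed[OF x] .
  \<comment> \<open>double commutators have the same image as \<open>\<one>\<close> under all homomorphisms into groups of \<open>V\<close>\<close>
  have dc: "group_comm ?F (group_comm ?F a b) (group_comm ?F c d) \<in> ?H" (is "?z \<in> ?H")
    if abcd: "{a, b, c, d} \<subseteq> carrier ?F" for a b c d
  proof (rule ccontr)
    assume "?z \<notin> ?H"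
    then have "?z \<in> carrier ?F - ?H" using abcd by simp
    from sep[OF this] obtain \<H> where \<H>: "\<forall>h\<in>\<H>. \<exists>K\<in>V. h \<in> hom ?F K"
        "\<forall>g'\<in>?H. \<exists>h\<in>\<H>. h g' \<noteq> h ?z" by (elim exE conjE)
    then obtain h where h: "h \<in> \<H>" "h \<one>\<^bsub>?F\<^esub> \<noteq> h ?z" using H.one_closed by blast
    from bspec[OF \<H>(1) this(1)] obtain K where K: "K \<in> V" "h \<in> hom ?F K" ..
    interpret h: group_hom ?F K h
      using V(2)[OF K(1)] K(2) by (simp add: group_hom_def group_hom_axioms_def)
    have "h ?z = \<one>\<^bsub>K\<^esub>"
      using abcd V(2)[OF K(1)] by (simp add: h.hom_group_comm torsion_law_double_comm)
    then show False using h(2) by simp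
  qed
  show False
  proof (cases "finite (rcosets\<^bsub>?F\<^esub> ?H)")
    case True
    have yc: "?y \<in> carrier ?F" using xc by simp
    obtain i where i: "1 \<le> i" "i \<le> card (rcosets\<^bsub>?F\<^esub> ?H)" "?y [^]\<^bsub>?F\<^esub> i \<in> ?H"
      by (rule F.finite_index_pow_mem[OF sub True yc])
    have iB: "i \<le> B" using i(2) finite_index_bound[OF ws True] B by simp
    have "?y \<in> carrier ?F - ?H" using yc notin by simp
    from sep[OF this] obtain \<H> where \<H>: "finite \<H>" "\<forall>h\<in>\<H>. \<exists>K\<in>V. h \<in> hom ?F K"
        "\<forall>g'\<in>?H. \<exists>h\<in>\<H>. h g' \<noteq> h ?y" by (elim exE conjE)
    have "\<exists>r. coprime r i \<and> (\<exists>K. K \<in> V \<and> h \<in> hom ?F K \<and> h ?y [^]\<^bsub>K\<^esub> r = \<one>\<^bsub>K\<^esub>)" if "h \<in> \<H>" for h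
    proof -
      from bspec[OF \<H>(2) that] obtain K where K: "K \<in> V" "h \<in> hom ?F K" ..
      interpret h: group_hom ?F K h
        using V(2)[OF K(1)] K(2) by (simp add: group_hom_def group_hom_axioms_def)
      have "torsion_law K" using V(2)[OF K(1)] by simp
      from this p h.hom_law_set[OF x] obtain r where r: "\<forall>i\<in>{1..B}. coprime r i"
          "(h x [^]\<^bsub>K\<^esub> law_exponent B p) [^]\<^bsub>K\<^esub> r = \<one>\<^bsub>K\<^esub>"
        by (rule torsion_lawD)
      show ?thesis
      proof (intro exI conjI)
        show "coprime r i" using r(1) i(1) iB by simp
        show "h ?y [^]\<^bsub>K\<^esub> r = \<one>\<^bsub>K\<^esub>" using r(2) xc by (simp only: h.hom_nat_pow)
      qed (rule K)+
    qed
    then have "\<forall>h\<in>\<H>. \<exists>r. coprime r i \<and> (\<exists>K. K \<in> V \<and> h \<in> hom ?F K \<and> h ?y [^]\<^bsub>K\<^esub> r = \<one>\<^bsub>K\<^esub>)"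
      by (rule ballI)
    from bchoice[OF this] obtain r where "\<forall>h\<in>\<H>. coprime (r h) i \<and>
        (\<exists>K. K \<in> V \<and> h \<in> hom ?F K \<and> h ?y [^]\<^bsub>K\<^esub> r h = \<one>\<^bsub>K\<^esub>)" ..
    then have r: "\<And>h. h \<in> \<H> \<Longrightarrow> coprime (r h) i"
      "\<And>h. h \<in> \<H> \<Longrightarrow> \<exists>K. K \<in> V \<and> h \<in> hom ?F K \<and> h ?y [^]\<^bsub>K\<^esub> r h = \<one>\<^bsub>K\<^esub>"
      by (simp_all only: Ball_def)
    have "coprime (\<Prod>h\<in>\<H>. r h) i"
      using r(1) by (intro prod_coprime_left)
    then have "gcd i (\<Prod>h\<in>\<H>. r h) = 1"
      by (metis coprime_imp_gcd_eq_1 gcd.commute)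
    moreover have "i \<noteq> 0" using i(1) by simp
    \<comment> \<open>so the images of \<open>y^(i a)\<close> and \<open>y\<close> agree\<close>
    ultimately obtain a b :: nat where ab: "i * a = Suc ((\<Prod>h\<in>\<H>. r h) * b)"
      using bezout_nat[of i "\<Prod>h\<in>\<H>. r h"] by (metis Suc_eq_plus1)
    have "?y [^]\<^bsub>?F\<^esub> (i * a) = (?y [^]\<^bsub>?F\<^esub> i) [^]\<^bsub>?F\<^esub> a"
      using yc by (simp add: F.nat_pow_pow)
    moreover have "(?y [^]\<^bsub>?F\<^esub> i) [^]\<^bsub>?F\<^esub> a \<in> ?H"
      using i(3) by (induction a) (auto simp del: F.nat_pow_pow)
    ultimately obtain h where h: "h \<in> \<H>" "h (?y [^]\<^bsub>?F\<^esub> (i * a)) \<noteq> h ?y"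
      using \<H>(3) by auto
    obtain K where K: "K \<in> V" "h \<in> hom ?F K" "h ?y [^]\<^bsub>K\<^esub> r h = \<one>\<^bsub>K\<^esub>"
      using r(2)[OF h(1)] by (elim exE conjE)
    interpret h: group_hom ?F K h
      using V(2)[OF K(1)] K(2) by (simp add: group_hom_def group_hom_axioms_def)
    obtain k where k: "(\<Prod>h\<in>\<H>. r h) = r h * k"
      using dvd_prodI[OF \<H>(1) h(1), of r] by blast
    have hy: "h ?y \<in> carrier K" using yc by (rule h.hom_closed)
    have "h (?y [^]\<^bsub>?F\<^esub> (i * a)) = h ?y [^]\<^bsub>K\<^esub> Suc (r h * (k * b))"
      using h.hom_nat_pow[OF yc] by (simp only: ab k mult.assoc)
    also have "\<dots> = (h ?y [^]\<^bsub>K\<^esub> r h) [^]\<^bsub>K\<^esub> (k * b) \<otimes>\<^bsub>K\<^esub> h ?y"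
      using h.H.nat_pow_pow[OF hy] by simp
    also have "\<dots> = h ?y"
      using K(3) hy by simp
    finally show False using h(2) by simp
  next
    case inf: False
    show False
    proof (cases "2 \<le> n")
      case True
      show False
        by (rule infinite_index_double_comm[OF ws True inf]) (use dc in blast)
    next
      case False
      then have "n \<le> 1" by simp
      then have comm: "group_comm ?F a b = \<one>\<^bsub>?F\<^esub>" if "a \<in> carrier ?F" "b \<in> carrier ?F" for a b
        using that rank_one_commutative by blast
      obtain a b c a' b' c' d e where x_eq: "x = law_value ?F p a b c a' b' c' d e"
        "{a, b, c, a', b', c', d, e} \<subseteq> carrier ?F"
        using x unfolding law_set_def mem_Collect_eq by (elim exE conjE)
      then have "x = \<one>\<^bsub>?F\<^esub>"
        by (simp add: law_value_def comm)
      then show False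
        using notin H.one_closed by simp
    qed
  qed
qed

section \<open>Primes in residue classes\<close>

text \<open>For \<open>e = k + 1\<close> put \<open>x = r^(r^k)\<close> and let \<open>q\<close> be a prime factor of
  \<open>(x^r - 1) / (x - 1) = 1 + x + \<dots> + x^(r-1)\<close>. Then \<open>r^(r^e) = 1\<close> modulo \<open>q\<close>, so the order of \<open>r\<close> modulo \<open>q\<close> divides
  \<open>r^e\<close>. A smaller order would give \<open>x = 1\<close> modulo \<open>q\<close>, and \<open>q\<close> would divide the sum \<open>1 + \<dots> + 1 = r\<close>. So the
  order is \<open>r^e\<close>, which divides \<open>q - 1\<close>.\<close>

lemma prime_power_dvd_prime_minus_one:
  fixes r :: nat
  assumes r: "prime r"
  obtains q where "prime q" "r ^ e dvd q - 1"
proof (cases e)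
  case 0
  then show thesis using that[of 2] by simp
next
  case (Suc k)
  define x where "x = r ^ (r ^ k)"
  define s where "s = (\<Sum>i<r. x ^ i)"
  have r2: "2 \<le> r" using prime_ge_2_nat[OF r] .
  have x: "2 \<le> x"
    using r2 self_le_power[of r "r ^ k"] by (simp add: x_def)
  have "x ^ 1 \<le> s"
    unfolding s_def by (rule member_le_sum) (use r2 in auto)
  then have "s \<noteq> 1" using x by simp
  then obtain q where q: "prime q" "q dvd s" using prime_factor_nat by blast
  have "(x - 1) * s = x ^ r - 1"
  proof -
    have "int ((x - 1) * s) = (int x - 1) * (\<Sum>i<r. int x ^ i)"
      using x by (simp add: s_def of_nat_diff)
    also have "\<dots> = int x ^ r - 1" by (simp add: power_diff_1_eq)
    also have "\<dots> = int (x ^ r - 1)" using x by (simp add: of_nat_diff)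
    finally show ?thesis by presburger
  qed
  then have "q dvd x ^ r - 1"
    using q(2) by (metis dvd_mult)
  moreover have xr: "x ^ r = r ^ (r ^ e)"
    by (simp add: x_def Suc power_mult mult.commute flip: power_mult)
  ultimately have qd: "q dvd r ^ (r ^ e) - 1" by simp
  then have cong: "[r ^ (r ^ e) = 1] (mod q)"
    using r2 by (subst cong_altdef_nat) auto
  have "\<not> q dvd r"
  proof
    assume "q dvd r"
    moreover have "r dvd r ^ (r ^ e)"
      by (rule dvd_power) (use r2 in simp)
    ultimately have "q dvd r ^ (r ^ e)" by (rule dvd_trans)
    then have "q dvd r ^ (r ^ e) - (r ^ (r ^ e) - 1)"
      using qd by (rule dvd_diff_nat)
    then show False
      using q(1) r2 by (simp add: prime_nat_iff)
  qed
  then have cop: "coprime q r" using q(1) prime_imp_coprime by blast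
  have "ord q r dvd r ^ e"
    using ord_divides[of r "r ^ e" q] cong by blast
  then obtain j where j: "j \<le> e" "ord q r = r ^ j"
    using divides_primepow_nat[OF r] by blast
  have "j = e"
  proof (rule ccontr)
    assume "j \<noteq> e"
    then have "ord q r dvd r ^ k"
      using j Suc by (simp add: le_imp_power_dvd)
    then have "[x = 1] (mod q)"
      unfolding x_def using ord_divides[of r "r ^ k" q] by blast
    then have "[s = (\<Sum>i<r. 1 ^ i)] (mod q)"
      unfolding s_def by (intro cong_sum cong_pow)
    then have "[s = r] (mod q)" by simp
    then have "q dvd r" using q(2) cong_dvd_iff by blast
    then show False using \<open>\<not> q dvd r\<close> by blast
  qed
  then have "r ^ e dvd totient q"
    using j order_divides_totient[OF cop] by simp
  then show thesis
    using that[OF q(1)] q(1) by (simp add: totient_prime)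
qed

lemma prime_powers_dvd_imp_dvd:
  fixes D :: nat and x :: int
  assumes "D > 0" "\<And>r. prime r \<Longrightarrow> r dvd D \<Longrightarrow> int (r ^ multiplicity r D) dvd x"
  shows "int D dvd x"
proof (cases "x = 0")
  case False
  have "D dvd nat \<bar>x\<bar>"
  proof (rule multiplicity_le_imp_dvd)
    fix r :: nat assume r: "prime r"
    show "multiplicity r D \<le> multiplicity r (nat \<bar>x\<bar>)"
    proof (cases "r dvd D")
      case True
      then have "r ^ multiplicity r D dvd nat \<bar>x\<bar>"
        using assms(2)[OF r] by (simp add: dvd_nat_abs_iff)
      then show ?thesis
        using False r by (intro multiplicity_geI) (auto simp: prime_nat_iff)
    qed (simp add: not_dvd_imp_multiplicity_0)
  qed (use assms in auto)
  then show ?thesis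
    by (simp add: dvd_nat_abs_iff)
qed simp

section \<open>Normal subgroups from homomorphisms\<close>

lemma (in normal) quotient_hom:
  obtains Q :: "'a set monoid" and h where "group_hom G Q h" "\<And>x. x \<in> carrier G \<Longrightarrow> h x = \<one>\<^bsub>Q\<^esub> \<longleftrightarrow> x \<in> H"
proof -
  have "group_hom G (G Mod H) (\<lambda>x. H #> x)"
    unfolding group_hom_def group_hom_axioms_def using is_group factorgroup_is_group r_coset_hom_Mod by blast
  moreover have "H #> x = \<one>\<^bsub>G Mod H\<^esub> \<longleftrightarrow> x \<in> H" if "x \<in> carrier G" for x
    using coset_join1[OF _ that is_subgroup] coset_join2[OF that is_subgroup] by (auto simp: one_FactGroup)
  ultimately show thesis by (rule that)
qed

lemma (in group_hom) eq_iff: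
  "x \<in> carrier G \<Longrightarrow> y \<in> carrier G \<Longrightarrow> h x = h y \<longleftrightarrow> h (x \<otimes> inv y) = \<one>\<^bsub>H\<^esub>"
  using H.inv_solve_right'[of "\<one>\<^bsub>H\<^esub>" "h x" "h y"] by simp

lemma (in group_hom) commute_iff:
  "x \<in> carrier G \<Longrightarrow> y \<in> carrier G \<Longrightarrow> h x \<otimes>\<^bsub>H\<^esub> h y = h y \<otimes>\<^bsub>H\<^esub> h x \<longleftrightarrow> h (group_comm G x y) = \<one>\<^bsub>H\<^esub>"
  by (simp add: hom_group_comm H.group_comm_eq_one_iff)

lemma (in group) conj_hom: "g \<in> carrier G \<Longrightarrow> group_hom G G (\<lambda>x. g \<otimes> x \<otimes> inv g)"
proof (unfold_locales, rule homI)
  fix a b assume "g \<in> carrier G" "a \<in> carrier G" "b \<in> carrier G"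
  then show "g \<otimes> (a \<otimes> b) \<otimes> inv g = g \<otimes> a \<otimes> inv g \<otimes> (g \<otimes> b \<otimes> inv g)"
    by (simp add: m_assoc inv_solve_left)
qed auto

lemma (in group) inv_commute:
  assumes "x \<in> carrier G" "y \<in> carrier G" "x \<otimes> y = y \<otimes> x"
  shows "inv x \<otimes> y = y \<otimes> inv x"
proof -
  have "inv x \<otimes> y = inv x \<otimes> (y \<otimes> x) \<otimes> inv x"
    using assms(1,2) by (simp add: m_assoc)
  also have "\<dots> = inv x \<otimes> (x \<otimes> y) \<otimes> inv x"
    using assms(3) by simp
  also have "\<dots> = y \<otimes> inv x"
    using assms(1,2) by (simp flip: m_assoc)
  finally show ?thesis .
qed

text \<open>The preimage of the centralizer of \<open>h ` S\<close>. As it is a normal subgroup, it contains the whole normal closure of any of its subsets.\<close>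

lemma (in group_hom) centralizer_normal:
  assumes S: "S \<subseteq> carrier G" and conj: "\<And>g s. g \<in> carrier G \<Longrightarrow> s \<in> S \<Longrightarrow> g \<otimes> s \<otimes> inv g \<in> S"
  shows "{g \<in> carrier G. \<forall>s\<in>S. h g \<otimes>\<^bsub>H\<^esub> h s = h s \<otimes>\<^bsub>H\<^esub> h g} \<lhd> G" (is "?Z \<lhd> G")
proof (rule G.normal_invI[OF G.subgroupI])
  show "?Z \<subseteq> carrier G" "?Z \<noteq> {}" using S by (auto intro!: exI[of _ "\<one>"])
  fix a assume a: "a \<in> ?Z"
  show "inv a \<in> ?Z"
  proof (intro CollectI conjI ballI)
    fix s assume s: "s \<in> S"
    then have c: "h a \<in> carrier H" "h s \<in> carrier H" "h a \<otimes>\<^bsub>H\<^esub> h s = h s \<otimes>\<^bsub>H\<^esub> h a"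
      using a S by auto
    then show "h (inv a) \<otimes>\<^bsub>H\<^esub> h s = h s \<otimes>\<^bsub>H\<^esub> h (inv a)"
      using a by (simp add: H.inv_commute)
  qed (use a in auto)
  fix b assume b: "b \<in> ?Z"
  show "a \<otimes> b \<in> ?Z"
  proof (intro CollectI conjI ballI)
    fix s assume s: "s \<in> S"
    then have c: "h a \<in> carrier H" "h b \<in> carrier H" "h s \<in> carrier H"
      "h a \<otimes>\<^bsub>H\<^esub> h s = h s \<otimes>\<^bsub>H\<^esub> h a" "h b \<otimes>\<^bsub>H\<^esub> h s = h s \<otimes>\<^bsub>H\<^esub> h b"
      using a b S by auto
    have "h a \<otimes>\<^bsub>H\<^esub> h b \<otimes>\<^bsub>H\<^esub> h s = h a \<otimes>\<^bsub>H\<^esub> (h b \<otimes>\<^bsub>H\<^esub> h s)"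
      using c(1-3) by (simp add: H.m_assoc)
    also have "\<dots> = h a \<otimes>\<^bsub>H\<^esub> h s \<otimes>\<^bsub>H\<^esub> h b"
      using c(1-3) by (simp add: c(5) H.m_assoc)
    also have "\<dots> = h s \<otimes>\<^bsub>H\<^esub> h a \<otimes>\<^bsub>H\<^esub> h b"
      by (simp only: c(4))
    also have "\<dots> = h s \<otimes>\<^bsub>H\<^esub> (h a \<otimes>\<^bsub>H\<^esub> h b)"
      using c(1-3) by (simp add: H.m_assoc)
    finally show "h (a \<otimes> b) \<otimes>\<^bsub>H\<^esub> h s = h s \<otimes>\<^bsub>H\<^esub> h (a \<otimes> b)"
      using a b by simp
  qed (use a b in auto)
next
  fix g a assume g: "g \<in> carrier G" and a: "a \<in> ?Z"
  interpret c: group_hom G G "\<lambda>x. g \<otimes> x \<otimes> inv g" by (rule G.conj_hom[OF g])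
  show "g \<otimes> a \<otimes> inv g \<in> ?Z"
  proof (intro CollectI conjI ballI)
    fix s assume s: "s \<in> S"
    let ?t = "inv g \<otimes> s \<otimes> inv (inv g)"
    have sc: "s \<in> carrier G" using s S by blast
    have t: "?t \<in> S" using conj s g by blast
    then have tc: "?t \<in> carrier G" using S by blast
    have st: "s = g \<otimes> ?t \<otimes> inv g"
      using g sc by (simp add: G.m_assoc) (simp flip: G.m_assoc)
    have "h (group_comm G a ?t) = \<one>\<^bsub>H\<^esub>"
      using a t tc commute_iff[of a ?t] by auto
    then have "h (group_comm G (g \<otimes> a \<otimes> inv g) (g \<otimes> ?t \<otimes> inv g)) = \<one>\<^bsub>H\<^esub>"
      using a tc g by (subst c.hom_group_comm[symmetric]) auto
    then show "h (g \<otimes> a \<otimes> inv g) \<otimes>\<^bsub>H\<^esub> h s = h s \<otimes>\<^bsub>H\<^esub> h (g \<otimes> a \<otimes> inv g)"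
      using commute_iff[of "g \<otimes> a \<otimes> inv g" s] st a g sc by simp
  qed (use a g in auto)
qed

text \<open>Since \<open>h ` N\<close> is commutative, \<open>p\<close>-th powers define a homomorphism on it. The two sets are
  preimages under \<open>h\<close> of the preimage of \<open>h ` M\<close> and of the image of this homomorphism, the first one
  within \<open>N\<close>.\<close>

lemma (in group_hom) power_in_normal:
  assumes N: "N \<lhd> G" and M: "M \<lhd> G"
    and comm: "\<And>y z. y \<in> N \<Longrightarrow> z \<in> N \<Longrightarrow> h y \<otimes>\<^bsub>H\<^esub> h z = h z \<otimes>\<^bsub>H\<^esub> h y"
  shows "{y \<in> N. \<exists>c\<in>M. h y [^]\<^bsub>H\<^esub> (p::nat) = h c} \<lhd> G" (is "?Y \<lhd> G")
    and "{x \<in> carrier G. \<exists>w\<in>N. h x = h w [^]\<^bsub>H\<^esub> p} \<lhd> G" (is "?X \<lhd> G")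
proof -
  interpret N: normal N G by (rule N)
  interpret M: normal M G by (rule M)
  have mult: "h (y \<otimes> z) [^]\<^bsub>H\<^esub> p = h y [^]\<^bsub>H\<^esub> p \<otimes>\<^bsub>H\<^esub> h z [^]\<^bsub>H\<^esub> p" if "y \<in> N" "z \<in> N" for y z
    using that comm by (simp add: H.pow_mult_distrib N.mem_carrier)
  have inv: "h (inv y) [^]\<^bsub>H\<^esub> p = inv\<^bsub>H\<^esub> (h y [^]\<^bsub>H\<^esub> p)" if "y \<in> N" for y
    using that by (simp add: H.nat_pow_inv N.mem_carrier)
  have conj: "h (g \<otimes> y \<otimes> inv g) [^]\<^bsub>H\<^esub> p = h g \<otimes>\<^bsub>H\<^esub> h y [^]\<^bsub>H\<^esub> p \<otimes>\<^bsub>H\<^esub> inv\<^bsub>H\<^esub> h g"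
    if "y \<in> N" "g \<in> carrier G" for g y
  proof -
    interpret c: group_hom H H "\<lambda>x. h g \<otimes>\<^bsub>H\<^esub> x \<otimes>\<^bsub>H\<^esub> inv\<^bsub>H\<^esub> h g"
      using that by (intro H.conj_hom) simp
    show ?thesis
      using that c.hom_nat_pow[of "h y" p] by (simp add: N.mem_carrier)
  qed
  show "?Y \<lhd> G"
  proof (rule G.normal_invI[OF G.subgroupI])
    show "?Y \<subseteq> carrier G" using N.subset by blast
    have "\<one> \<in> ?Y" using N.one_closed M.one_closed by (auto intro!: bexI[of _ \<one>])
    then show "?Y \<noteq> {}" by blast
    fix a assume a: "a \<in> ?Y"
    then obtain c where c: "c \<in> M" "h a [^]\<^bsub>H\<^esub> p = h c" by blast
    then have "h (inv a) [^]\<^bsub>H\<^esub> p = h (inv c)"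
      using a inv[of a] by (simp add: M.mem_carrier)
    moreover have "inv a \<in> N" "inv c \<in> M" using a c(1) by simp_all
    ultimately show "inv a \<in> ?Y" by (intro CollectI conjI bexI[of _ "inv c"])
    fix b assume b: "b \<in> ?Y"
    then obtain d where d: "d \<in> M" "h b [^]\<^bsub>H\<^esub> p = h d" by blast
    have "h (a \<otimes> b) [^]\<^bsub>H\<^esub> p = h (c \<otimes> d)"
      using a b c d mult[of a b] by (simp add: M.mem_carrier)
    moreover have "a \<otimes> b \<in> N" "c \<otimes> d \<in> M" using a b c(1) d(1) by simp_all
    ultimately show "a \<otimes> b \<in> ?Y" by (intro CollectI conjI bexI[of _ "c \<otimes> d"])
  next
    fix g a assume g: "g \<in> carrier G" and a: "a \<in> ?Y"
    then obtain c where c: "c \<in> M" "h a [^]\<^bsub>H\<^esub> p = h c" by blast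
    then have "h (g \<otimes> a \<otimes> inv g) [^]\<^bsub>H\<^esub> p = h (g \<otimes> c \<otimes> inv g)"
      using a g conj[of a g] by (simp add: M.mem_carrier)
    moreover have "g \<otimes> a \<otimes> inv g \<in> N" "g \<otimes> c \<otimes> inv g \<in> M"
      using a g c(1) N.inv_op_closed2 M.inv_op_closed2 by simp_all
    ultimately show "g \<otimes> a \<otimes> inv g \<in> ?Y"
      by (intro CollectI conjI bexI[of _ "g \<otimes> c \<otimes> inv g"])
  qed
  show "?X \<lhd> G"
  proof (rule G.normal_invI[OF G.subgroupI])
    show "?X \<subseteq> carrier G" by blast
    have "\<one> \<in> ?X" by (auto intro!: bexI[of _ \<one>])
    then show "?X \<noteq> {}" by blast
    fix a assume a: "a \<in> ?X"
    then obtain w where w: "w \<in> N" "h a = h w [^]\<^bsub>H\<^esub> p" by blast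
    then have "h (inv a) = h (inv w) [^]\<^bsub>H\<^esub> p"
      using a inv[of w] by simp
    moreover have "inv a \<in> carrier G" "inv w \<in> N" using a w(1) by simp_all
    ultimately show "inv a \<in> ?X" by (intro CollectI conjI bexI[of _ "inv w"])
    fix b assume b: "b \<in> ?X"
    then obtain v where v: "v \<in> N" "h b = h v [^]\<^bsub>H\<^esub> p" by blast
    have "h (a \<otimes> b) = h (w \<otimes> v) [^]\<^bsub>H\<^esub> p"
      using a b w v mult[of w v] by simp
    moreover have "a \<otimes> b \<in> carrier G" "w \<otimes> v \<in> N" using a b w(1) v(1) by simp_all
    ultimately show "a \<otimes> b \<in> ?X" by (intro CollectI conjI bexI[of _ "w \<otimes> v"])
  next
    fix g a assume g: "g \<in> carrier G" and a: "a \<in> ?X"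
    then obtain w where w: "w \<in> N" "h a = h w [^]\<^bsub>H\<^esub> p" by blast
    then have "h (g \<otimes> a \<otimes> inv g) = h (g \<otimes> w \<otimes> inv g) [^]\<^bsub>H\<^esub> p"
      using a g conj[of w g] by simp
    moreover have "g \<otimes> a \<otimes> inv g \<in> carrier G" "g \<otimes> w \<otimes> inv g \<in> N"
      using a g w(1) N.inv_op_closed2 by simp_all
    ultimately show "g \<otimes> a \<otimes> inv g \<in> ?X"
      by (intro CollectI conjI bexI[of _ "g \<otimes> w \<otimes> inv g"])
  qed
qed

lemma (in group) finite_rcosets:
  assumes X: "subgroup X G" and S: "finite S" "\<And>x. x \<in> carrier G \<Longrightarrow> f x \<in> S"
    and f: "\<And>x y. x \<in> carrier G \<Longrightarrow> y \<in> carrier G \<Longrightarrow> f x = f y \<Longrightarrow> x \<otimes> inv y \<in> X"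
  shows "finite (rcosets X)"
proof -
  let ?r = "\<lambda>s. X #> inv_into (carrier G) f s"
  have "X #> x = ?r (f x)" if x: "x \<in> carrier G" for x
  proof -
    let ?y = "inv_into (carrier G) f (f x)"
    have y: "?y \<in> carrier G" "f ?y = f x"
      using x by (auto intro: inv_into_into f_inv_into_f)
    then have "x \<in> X #> ?y"
      using f[of x ?y] x subgroup.rcos_module_rev[OF X is_group, of ?y x] by simp
    then show ?thesis
      using repr_independence[OF _ y(1) X] by blast
  qed
  then have "rcosets X \<subseteq> ?r ` S"
    using S(2) by (auto simp: RCOSETS_def)
  then show ?thesis
    using finite_surj[OF S(1)] by blast
qed

text \<open>The hypotheses express that \<open>Y/X\<close> belongs to \<open>Ab p\<close> and \<open>G/Y\<close> to \<open>Ab q\<close>; \<open>K\<close> is a copy of \<open>G/X\<close>.\<close>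

lemma (in group) quotient_in_pv_prod:
  assumes X: "X \<lhd> G" "finite (rcosets X)" and Y: "Y \<lhd> G"
    and "\<And>y z. y \<in> Y \<Longrightarrow> z \<in> Y \<Longrightarrow> group_comm G y z \<in> X" "\<And>y. y \<in> Y \<Longrightarrow> y [^] p \<in> X"
    and "\<And>x y. x \<in> carrier G \<Longrightarrow> y \<in> carrier G \<Longrightarrow> group_comm G x y \<in> Y" "\<And>x. x \<in> carrier G \<Longrightarrow> x [^] q \<in> Y"
  obtains K h where "K \<in> pv_prod (Ab p) (Ab q)" "h \<in> hom G K"
    "\<And>x y. x \<in> carrier G \<Longrightarrow> y \<in> carrier G \<Longrightarrow> h x = h y \<longleftrightarrow> x \<otimes> inv y \<in> X"
proof -
  interpret X: normal X G by (rule X)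
  interpret Y: normal Y G by (rule Y)
  obtain f :: "'a \<Rightarrow> nat" where w: "weak_group_morphism f X G"
    using X by (rule nat_quotient)
  let ?K = "image_group f G"
  have K: "group ?K" by (rule image_group_is_group[OF w])
  have f: "f \<in> hom G ?K" by (rule weak_group_morphism_is_hom[OF w])
  have car: "carrier ?K = f ` carrier G" by (rule image_group_carrier)
  interpret f: group_hom G ?K f
    using K f by (simp add: group_hom_def group_hom_axioms_def)
  have feq: "f x = f y \<longleftrightarrow> x \<otimes> inv y \<in> X" if "x \<in> carrier G" "y \<in> carrier G" for x y
    using weak_group_morphism.inj_mod_subgroup[OF w that] .
  have one: "f x = \<one>\<^bsub>?K\<^esub> \<longleftrightarrow> x \<in> X" if "x \<in> carrier G" for x
    using feq[OF that one_closed] that by simp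
  have fin: "finite (carrier ?K)"
  proof -
    have "f x = (\<lambda>t. f (SOME x. x \<in> t)) (X #> x)" if x: "x \<in> carrier G" for x
    proof -
      have "(SOME y. y \<in> X #> x) \<in> X #> x"
        by (rule someI[of _ x]) (use rcos_self[OF x X.is_subgroup] in simp)
      then obtain y where y: "y = (SOME y. y \<in> X #> x)" "y \<in> X #> x" by simp
      then have "y \<in> carrier G" using X.subset x r_coset_subset_G by blast
      moreover have "y \<otimes> inv x \<in> X" using X.rcos_module_imp[OF is_group x y(2)] .
      ultimately show ?thesis using feq[of y x] x y(1) by simp
    qed
    then have "f ` carrier G \<subseteq> (\<lambda>t. f (SOME x. x \<in> t)) ` (rcosets X)"
      by (auto simp: RCOSETS_def)
    then show ?thesis
      unfolding car by (rule finite_surj[OF X(2)])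
  qed
  have "?K \<in> pv_prod (Ab p) (Ab q)"
    unfolding in_pv_prod_Ab_iff
  proof (intro conjI exI[of _ "f ` Y"] K fin ballI)
    show "f ` Y \<lhd> ?K"
      using normal.surj_hom_normal_subgroup[OF Y] f.group_hom_axioms car by auto
  next
    fix x y assume "x \<in> f ` Y" "y \<in> f ` Y"
    then obtain a b where "a \<in> Y" "b \<in> Y" "x = f a" "y = f b" by blast
    then show "x \<otimes>\<^bsub>?K\<^esub> y = y \<otimes>\<^bsub>?K\<^esub> x"
      using assms(4)[of a b] one[of "group_comm G a b"] f.commute_iff[of a b] by simp
  next
    fix x assume "x \<in> f ` Y"
    then obtain a where "a \<in> Y" "x = f a" by blast
    then show "x [^]\<^bsub>?K\<^esub> p = \<one>\<^bsub>?K\<^esub>"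
      using assms(5)[of a] one[of "a [^] p"] f.hom_nat_pow[of a p] by simp
  next
    fix x y assume "x \<in> carrier ?K" "y \<in> carrier ?K"
    then obtain a b where "a \<in> carrier G" "b \<in> carrier G" "x = f a" "y = f b"
      using car by auto
    then show "group_comm ?K x y \<in> f ` Y"
      using assms(6) f.hom_group_comm by (metis image_eqI)
  next
    fix x assume "x \<in> carrier ?K"
    then obtain a where "a \<in> carrier G" "x = f a" using car by auto
    then show "x [^]\<^bsub>?K\<^esub> q \<in> f ` Y"
      using assms(7) f.hom_nat_pow by (metis image_eqI)
  qed
  then show thesis using f feq by (rule that)
qed

section \<open>Kernels of maps to products of cyclic groups\<close>

text \<open>The kernel of \<open>F \<rightarrow> (\<int>/D)^n\<close>; for \<open>D = 0\<close> this is the derived subgroup.\<close>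

definition esum_kernel :: "nat \<Rightarrow> nat \<Rightarrow> letter list set" where
  "esum_kernel n D = {w \<in> carrier (free_group n). \<forall>i<n. int D dvd esum i w}"

lemma esum_kernel_normal: "esum_kernel n D \<lhd> free_group n"
proof -
  interpret F: group "free_group n" by (rule group_free_group)
  show ?thesis
  proof (rule F.normal_invI[OF F.subgroupI])
    have "\<one>\<^bsub>free_group n\<^esub> \<in> esum_kernel n D"
      using F.one_closed by (simp add: esum_kernel_def free_group_one)
    then show "esum_kernel n D \<noteq> {}" by blast
  qed (auto simp: esum_kernel_def)
qed

text \<open>An induction principle for elements of the kernel: it suffices that the elements with the desired
  property form a normal subgroup that contains the commutators and the \<open>D\<close>-th powers.\<close>

lemma esum_kernel_subset:
  fixes D :: nat
  assumes "N \<lhd> free_group n"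
    and "\<And>a b. a \<in> carrier (free_group n) \<Longrightarrow> b \<in> carrier (free_group n) \<Longrightarrow> group_comm (free_group n) a b \<in> N"
    and "\<And>a. a \<in> carrier (free_group n) \<Longrightarrow> a [^]\<^bsub>free_group n\<^esub> D \<in> N"
  shows "esum_kernel n D \<subseteq> N"
  using esum_dvd_imp_mem[OF assms] by (auto simp: esum_kernel_def)

lemma group_comm_in_esum_kernel:
  "a \<in> carrier (free_group n) \<Longrightarrow> b \<in> carrier (free_group n) \<Longrightarrow> group_comm (free_group n) a b \<in> esum_kernel n D"
  using group.group_comm_closed[OF group_free_group] by (simp add: esum_kernel_def)

lemma pow_in_esum_kernel:
  "a \<in> carrier (free_group n) \<Longrightarrow> D dvd k \<Longrightarrow> a [^]\<^bsub>free_group n\<^esub> k \<in> esum_kernel n D"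
  using monoid.nat_pow_closed[OF group.is_monoid[OF group_free_group]] by (simp add: esum_kernel_def)

lemma esum_kernelI:
  "w \<in> carrier (free_group n) \<Longrightarrow> (\<And>i. i < n \<Longrightarrow> int D dvd esum i w) \<Longrightarrow> w \<in> esum_kernel n D"
  by (simp add: esum_kernel_def)

lemma esum_kernelD:
  "w \<in> esum_kernel n D \<Longrightarrow> w \<in> carrier (free_group n)"
  "w \<in> esum_kernel n D \<Longrightarrow> i < n \<Longrightarrow> int D dvd esum i w"
  by (simp_all add: esum_kernel_def)

lemma esum_kernel_mono:
  assumes "D dvd E" shows "esum_kernel n E \<subseteq> esum_kernel n D"
proof (intro subsetI esum_kernelI)
  fix w i assume "w \<in> esum_kernel n E" "i < n"
  then have "int E dvd esum i w" by (rule esum_kernelD)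
  then show "int D dvd esum i w"
    using assms int_dvd_int_iff dvd_trans by blast
qed (rule esum_kernelD)

text \<open>\<open>X\<close> is the kernel of a homomorphism into a group of \<open>V\<close>.\<close>

definition separable :: "group_class \<Rightarrow> ('a, 'b) monoid_scheme \<Rightarrow> 'a set \<Rightarrow> bool" where
  "separable V G X \<longleftrightarrow> (\<exists>K h. K \<in> V \<and> h \<in> hom G K \<and>
     (\<forall>x\<in>carrier G. \<forall>y\<in>carrier G. h x = h y \<longleftrightarrow> x \<otimes>\<^bsub>G\<^esub> inv\<^bsub>G\<^esub> y \<in> X))"

lemma closedin_if_separable:
  assumes G: "group G" and V: "V \<noteq> {}" "\<And>K. K \<in> V \<Longrightarrow> group K" and H: "H \<subseteq> carrier G"
    and sep: "\<And>g. g \<in> carrier G \<Longrightarrow> g \<notin> H \<Longrightarrow>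
      \<exists>\<X>. finite \<X> \<and> (\<forall>X\<in>\<X>. separable V G X) \<and> (\<forall>h\<in>H. \<exists>X\<in>\<X>. h \<otimes>\<^bsub>G\<^esub> inv\<^bsub>G\<^esub> g \<notin> X)"
  shows "closedin (pro_topology V G) H"
proof (rule iffD2[OF closedin_pro_topology_iff[OF G V(1) _ H]], rule V(2), assumption, intro ballI)
  fix g assume g: "g \<in> carrier G - H"
  then have "g \<in> carrier G" "g \<notin> H" by auto
  from sep[OF this] obtain \<X> where \<X>: "finite \<X>" "\<forall>X\<in>\<X>. separable V G X"
      "\<forall>h\<in>H. \<exists>X\<in>\<X>. h \<otimes>\<^bsub>G\<^esub> inv\<^bsub>G\<^esub> g \<notin> X" by (elim exE conjE)
  have "\<forall>X\<in>\<X>. \<exists>h. (\<exists>K\<in>V. h \<in> hom G K) \<and>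
     (\<forall>x\<in>carrier G. \<forall>y\<in>carrier G. h x = h y \<longleftrightarrow> x \<otimes>\<^bsub>G\<^esub> inv\<^bsub>G\<^esub> y \<in> X)"
    using \<X>(2) unfolding separable_def by blast
  from bchoice[OF this] obtain f where f: "\<forall>X\<in>\<X>. (\<exists>K\<in>V. f X \<in> hom G K) \<and>
     (\<forall>x\<in>carrier G. \<forall>y\<in>carrier G. f X x = f X y \<longleftrightarrow> x \<otimes>\<^bsub>G\<^esub> inv\<^bsub>G\<^esub> y \<in> X)" ..
  show "\<exists>\<H>. finite \<H> \<and> (\<forall>h\<in>\<H>. \<exists>K\<in>V. h \<in> hom G K) \<and> (\<forall>g'\<in>H. \<exists>h\<in>\<H>. h g' \<noteq> h g)"
  proof (intro exI[of _ "f ` \<X>"] conjI ballI)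
    show "finite (f ` \<X>)" using \<X>(1) by simp
    show "\<exists>K\<in>V. h \<in> hom G K" if "h \<in> f ` \<X>" for h using that f by auto
    fix g' assume g': "g' \<in> H"
    from bspec[OF \<X>(3) this] obtain X where X: "X \<in> \<X>" "g' \<otimes>\<^bsub>G\<^esub> inv\<^bsub>G\<^esub> g \<notin> X" ..
    have "\<forall>x\<in>carrier G. \<forall>y\<in>carrier G. f X x = f X y \<longleftrightarrow> x \<otimes>\<^bsub>G\<^esub> inv\<^bsub>G\<^esub> y \<in> X"
      using bspec[OF f X(1)] by (rule conjunct2)
    then have "f X g' = f X g \<longleftrightarrow> g' \<otimes>\<^bsub>G\<^esub> inv\<^bsub>G\<^esub> g \<in> X"
      using g subsetD[OF H g'] by simp
    then have "f X g' \<noteq> f X g" using X(2) by simp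
    then show "\<exists>h\<in>f ` \<X>. h g' \<noteq> h g" using X(1) by blast
  qed
qed

lemma esum_kernel_separable:
  assumes V: "pv_prod (Ab q) (Ab (q - 1)) \<subseteq> V" and q: "prime q"
  shows "separable V (free_group n) (esum_kernel n (q - 1))"
proof -
  let ?F = "free_group n" and ?N = "esum_kernel n (q - 1)"
  interpret N: normal ?N ?F by (rule esum_kernel_normal)
  have q1: "0 < q - 1" using prime_gt_1_nat[OF q] by simp
  have fin: "finite (rcosets\<^bsub>?F\<^esub> ?N)"
  proof (rule N.finite_rcosets[OF N.is_subgroup])
    let ?f = "\<lambda>w. restrict (\<lambda>i. esum i w mod int (q - 1)) {..<n}"
    show "finite ({..<n} \<rightarrow>\<^sub>E {0..<int (q - 1)})" by (intro finite_PiE) auto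
    show "?f w \<in> {..<n} \<rightarrow>\<^sub>E {0..<int (q - 1)}" for w
      using q1 by (intro restrict_PiE_iff[THEN iffD2]) auto
    fix x y assume xy: "x \<in> carrier ?F" "y \<in> carrier ?F" "?f x = ?f y"
    have "int (q - 1) dvd esum i x - esum i y" if "i < n" for i
      using fun_cong[OF xy(3), of i] that by (simp add: mod_eq_dvd_iff)
    then show "x \<otimes>\<^bsub>?F\<^esub> inv\<^bsub>?F\<^esub> y \<in> ?N"
      using xy(1,2) by (intro esum_kernelI) simp_all
  qed
  obtain K h where "K \<in> pv_prod (Ab q) (Ab (q - 1))" "h \<in> hom ?F K"
    "\<And>x y. x \<in> carrier ?F \<Longrightarrow> y \<in> carrier ?F \<Longrightarrow> h x = h y \<longleftrightarrow> x \<otimes>\<^bsub>?F\<^esub> inv\<^bsub>?F\<^esub> y \<in> ?N"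
  proof (rule N.quotient_in_pv_prod[OF N.normal_axioms fin N.normal_axioms])
    show "y [^]\<^bsub>?F\<^esub> q \<in> ?N" if "y \<in> ?N" for y
      using esum_kernelD[OF that] by (intro esum_kernelI) simp_all
    show "x [^]\<^bsub>?F\<^esub> (q - 1) \<in> ?N" if "x \<in> carrier ?F" for x
      using that by (intro pow_in_esum_kernel) auto
  qed (auto intro: group_comm_in_esum_kernel)
  then show ?thesis
    using V unfolding separable_def by blast
qed

text \<open>For each prime power \<open>r^k\<close> that divides \<open>D\<close> exactly there is a prime \<open>q\<close> such that \<open>q - 1\<close> is a multiple of
  \<open>r^k\<close>.\<close>

lemma esum_kernel_from_primes:
  fixes D :: nat
  assumes D: "D > 0"
  obtains Q where "finite Q" "\<forall>q\<in>Q. prime q"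
    "\<forall>w\<in>carrier (free_group n). (\<forall>q\<in>Q. w \<in> esum_kernel n (q - 1)) \<longrightarrow> w \<in> esum_kernel n D"
proof -
  let ?P = "{r. prime r \<and> r dvd D}"
  have fin: "finite ?P" using D by (intro finite_subset[OF _ finite_divisors_nat[of D]]) auto
  have "\<forall>r\<in>?P. \<exists>q. prime q \<and> r ^ multiplicity r D dvd q - 1"
    using prime_power_dvd_prime_minus_one by blast
  from bchoice[OF this] obtain f where f: "\<forall>r\<in>?P. prime (f r) \<and> r ^ multiplicity r D dvd f r - 1" ..
  show thesis
  proof (rule that[of "f ` ?P"])
    show "finite (f ` ?P)" using fin by simp
    show "\<forall>q\<in>f ` ?P. prime q" using f by auto
  next
    show "\<forall>w\<in>carrier (free_group n). (\<forall>q\<in>f ` ?P. w \<in> esum_kernel n (q - 1)) \<longrightarrow> w \<in> esum_kernel n D"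
    proof (intro ballI impI)
    fix w assume w: "w \<in> carrier (free_group n)" "\<forall>q\<in>f ` ?P. w \<in> esum_kernel n (q - 1)"
    have "int D dvd esum i w" if i: "i < n" for i
    proof (rule prime_powers_dvd_imp_dvd[OF D])
      fix r :: nat assume r: "prime r" "r dvd D"
      then have "int (f r - 1) dvd esum i w"
        using w(2) i by (auto simp: esum_kernel_def)
      moreover have "int (r ^ multiplicity r D) dvd int (f r - 1)"
        using f r by (simp only: int_dvd_int_iff) simp
      ultimately show "int (r ^ multiplicity r D) dvd esum i w"
        by (rule dvd_trans[rotated])
    qed
    then show "w \<in> esum_kernel n D" using w(1) by (simp add: esum_kernel_def)
    qed
  qed
qed

section \<open>Normal subgroups that satisfy the laws\<close>

locale lawful_normal =
  fixes n B :: nat and C :: "letter list set"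
  assumes C_normal: "C \<lhd> free_group n" and B: "2 \<le> B"
    and laws: "\<And>p x. prime p \<Longrightarrow> p \<le> B \<Longrightarrow> x \<in> law_set (free_group n) p \<Longrightarrow>
      x [^]\<^bsub>free_group n\<^esub> law_exponent B p \<in> C"
begin

abbreviation "F \<equiv> free_group n"
abbreviation "F' \<equiv> esum_kernel n 0"

sublocale C: normal C F by (rule C_normal)

text \<open>The elements \<open>[a, b] c^D\<close> form a set \<open>S\<close>, invariant under conjugation, that contains the commutators and the
  \<open>D\<close>-th powers. If they commute modulo \<open>J\<close>, so do the elements of the kernel: the centralizer of \<open>S\<close> contains the
  kernel, and then the centralizer of the kernel contains \<open>S\<close> and with it the kernel.\<close>

lemma commute_by_generators:
  assumes J: "J \<lhd> F" and gen: "\<And>a b c a' b' c'. {a, b, c, a', b', c'} \<subseteq> carrier F \<Longrightarrow>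
      group_comm F (group_comm F a b \<otimes>\<^bsub>F\<^esub> c [^]\<^bsub>F\<^esub> D) (group_comm F a' b' \<otimes>\<^bsub>F\<^esub> c' [^]\<^bsub>F\<^esub> D) \<in> J"
    and yz: "y \<in> esum_kernel n D" "z \<in> esum_kernel n (D::nat)"
  shows "group_comm F y z \<in> J"
proof -
  interpret N: normal "esum_kernel n D" F by (rule esum_kernel_normal)
  obtain Q :: "letter list set monoid" and h where hom: "group_hom F Q h"
    and ker: "\<And>x. x \<in> carrier F \<Longrightarrow> h x = \<one>\<^bsub>Q\<^esub> \<longleftrightarrow> x \<in> J"
    using normal.quotient_hom[OF J] by blast
  interpret h: group_hom F Q h by (rule hom)
  define S where "S = {group_comm F a b \<otimes>\<^bsub>F\<^esub> c [^]\<^bsub>F\<^esub> D | a b c. {a, b, c} \<subseteq> carrier F}"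
  have S: "S \<subseteq> carrier F" by (auto simp: S_def)
  have S_conj: "g \<otimes>\<^bsub>F\<^esub> s \<otimes>\<^bsub>F\<^esub> inv\<^bsub>F\<^esub> g \<in> S" if g: "g \<in> carrier F" and s: "s \<in> S" for g s
  proof -
    obtain a b c where abc: "s = group_comm F a b \<otimes>\<^bsub>F\<^esub> c [^]\<^bsub>F\<^esub> D" "{a, b, c} \<subseteq> carrier F"
      using s by (auto simp: S_def)
    interpret c: group_hom F F "\<lambda>x. g \<otimes>\<^bsub>F\<^esub> x \<otimes>\<^bsub>F\<^esub> inv\<^bsub>F\<^esub> g" by (rule C.conj_hom[OF g])
    let ?c = "\<lambda>x. g \<otimes>\<^bsub>F\<^esub> x \<otimes>\<^bsub>F\<^esub> inv\<^bsub>F\<^esub> g"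
    have "?c s = group_comm F (?c a) (?c b) \<otimes>\<^bsub>F\<^esub> ?c c [^]\<^bsub>F\<^esub> D"
      using abc c.hom_nat_pow[of c D] c.hom_group_comm[of a b] c.hom_mult[of "group_comm F a b" "c [^]\<^bsub>F\<^esub> D"] by simp
    then show ?thesis
      using abc(2) g unfolding S_def by blast
  qed
  have comm_S: "group_comm F a b \<in> S" if "a \<in> carrier F" "b \<in> carrier F" for a b
  proof -
    have "group_comm F a b = group_comm F a b \<otimes>\<^bsub>F\<^esub> \<one>\<^bsub>F\<^esub> [^]\<^bsub>F\<^esub> D" using that by simp
    then show ?thesis using that C.one_closed unfolding S_def by blast
  qed
  have pow_S: "c [^]\<^bsub>F\<^esub> D \<in> S" if "c \<in> carrier F" for c
  proof -
    have "c [^]\<^bsub>F\<^esub> D = group_comm F \<one>\<^bsub>F\<^esub> \<one>\<^bsub>F\<^esub> \<otimes>\<^bsub>F\<^esub> c [^]\<^bsub>F\<^esub> D" using that by (simp add: group_comm_def)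
    then show ?thesis using that C.one_closed unfolding S_def by blast
  qed
  have SS: "h s \<otimes>\<^bsub>Q\<^esub> h t = h t \<otimes>\<^bsub>Q\<^esub> h s" if st: "s \<in> S" "t \<in> S" for s t
  proof -
    obtain a b c where s: "s = group_comm F a b \<otimes>\<^bsub>F\<^esub> c [^]\<^bsub>F\<^esub> D" "{a, b, c} \<subseteq> carrier F"
      using st(1) unfolding S_def mem_Collect_eq by (elim exE conjE)
    obtain a' b' c' where t: "t = group_comm F a' b' \<otimes>\<^bsub>F\<^esub> c' [^]\<^bsub>F\<^esub> D" "{a', b', c'} \<subseteq> carrier F"
      using st(2) unfolding S_def mem_Collect_eq by (elim exE conjE)
    have "group_comm F s t \<in> J"
      unfolding s(1) t(1) using s(2) t(2) by (intro gen) simp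
    moreover have "s \<in> carrier F" "t \<in> carrier F" using that S by blast+
    ultimately show ?thesis using h.commute_iff[of s t] ker[of "group_comm F s t"] by simp
  qed
  have 1: "esum_kernel n D \<subseteq> {g \<in> carrier F. \<forall>s\<in>S. h g \<otimes>\<^bsub>Q\<^esub> h s = h s \<otimes>\<^bsub>Q\<^esub> h g}"
    by (rule esum_kernel_subset[OF h.centralizer_normal[OF S S_conj]]) (use comm_S pow_S SS in auto)
  have 2: "esum_kernel n D \<subseteq> {g \<in> carrier F. \<forall>s\<in>esum_kernel n D. h g \<otimes>\<^bsub>Q\<^esub> h s = h s \<otimes>\<^bsub>Q\<^esub> h g}"
    by (rule esum_kernel_subset[OF h.centralizer_normal[OF N.subset N.inv_op_closed2]])
      (use 1 comm_S pow_S in \<open>auto simp: subset_iff\<close>)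
  have "h y \<otimes>\<^bsub>Q\<^esub> h z = h z \<otimes>\<^bsub>Q\<^esub> h y" using 2 yz by blast
  then show ?thesis
    using h.commute_iff[of y z] ker[of "group_comm F y z"] yz[THEN N.mem_carrier] by simp
qed

text \<open>The case \<open>D = 0\<close> of the preceding lemma, in which \<open>S\<close> is the set of commutators.\<close>

lemma derived_commute:
  assumes "f \<in> F'" "g \<in> F'" shows "group_comm F f g \<in> C"
proof (rule commute_by_generators[OF C_normal _ assms])
  fix a b c a' b' c' assume abc: "{a, b, c, a', b', c'} \<subseteq> carrier F"
  have "group_comm F (group_comm F a b) (group_comm F a' b') \<in> C"
  proof (rule C.law_exponent_pow_mem[OF C.is_subgroup _ B, rotated])
    fix p :: nat assume p: "prime p" "p \<le> B"
    show "group_comm F (group_comm F a b) (group_comm F a' b') [^]\<^bsub>F\<^esub> law_exponent B p \<in> C"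
      by (rule laws[OF p C.double_comm_in_law_set]) (use abc in simp_all)
  qed (use abc in simp)
  then show "group_comm F (group_comm F a b \<otimes>\<^bsub>F\<^esub> c [^]\<^bsub>F\<^esub> (0::nat)) (group_comm F a' b' \<otimes>\<^bsub>F\<^esub> c' [^]\<^bsub>F\<^esub> (0::nat)) \<in> C"
    using abc by simp
qed

text \<open>Modulo \<open>C\<close> the derived subgroup is commutative, and these are its elements of order dividing a number prime to
  \<open>p\<close>.\<close>

definition J :: "nat \<Rightarrow> letter list set" where
  "J p = {f \<in> F'. f [^]\<^bsub>F\<^esub> law_exponent B p \<in> C}"

lemma power_normal:
  assumes M: "M \<lhd> F" and N: "N \<lhd> F" and comm: "\<And>y z. y \<in> N \<Longrightarrow> z \<in> N \<Longrightarrow> group_comm F y z \<in> M"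
  shows "{y \<in> N. y [^]\<^bsub>F\<^esub> (k::nat) \<in> M} \<lhd> F"
proof -
  interpret N: normal N F by (rule N)
  obtain Q :: "letter list set monoid" and h where hom: "group_hom F Q h"
    and ker: "\<And>x. x \<in> carrier F \<Longrightarrow> h x = \<one>\<^bsub>Q\<^esub> \<longleftrightarrow> x \<in> M"
    using normal.quotient_hom[OF M] by blast
  interpret h: group_hom F Q h by (rule hom)
  have "h y \<otimes>\<^bsub>Q\<^esub> h z = h z \<otimes>\<^bsub>Q\<^esub> h y" if "y \<in> N" "z \<in> N" for y z
    using comm[OF that] that h.commute_iff[of y z] ker[of "group_comm F y z"] by simp
  from h.power_in_normal(1)[OF N C.one_is_normal this] have "{y \<in> N. h y [^]\<^bsub>Q\<^esub> k = \<one>\<^bsub>Q\<^esub>} \<lhd> F"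
    by simp
  moreover have "h y [^]\<^bsub>Q\<^esub> k = \<one>\<^bsub>Q\<^esub> \<longleftrightarrow> y [^]\<^bsub>F\<^esub> k \<in> M" if "y \<in> N" for y
    using that ker[of "y [^]\<^bsub>F\<^esub> k"] h.hom_nat_pow[of y k] by simp
  then have "{y \<in> N. h y [^]\<^bsub>Q\<^esub> k = \<one>\<^bsub>Q\<^esub>} = {y \<in> N. y [^]\<^bsub>F\<^esub> k \<in> M}"
    by (intro Collect_cong conj_cong HOL.refl)
  ultimately show ?thesis by simp
qed

lemma J_normal: "J p \<lhd> F"
  unfolding J_def by (rule power_normal[OF C_normal esum_kernel_normal derived_commute])

lemma law_in_J:
  assumes p: "prime p" "p \<le> B" and x: "x \<in> law_set F p" "x \<in> F'"
  shows "x \<in> J p"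
  using laws[OF p x(1)] x(2) by (simp add: J_def)

text \<open>The products from \<open>law_set F p\<close> with \<open>d = e = \<one>\<close> are the commutators of the elements \<open>[a, b] c^(p-1)\<close>.\<close>

lemma commute_mod_J:
  assumes p: "prime p" "p \<le> B" and yz: "y \<in> esum_kernel n (p - 1)" "z \<in> esum_kernel n (p - 1)"
  shows "group_comm F y z \<in> J p"
proof (rule commute_by_generators[OF J_normal _ yz])
  fix a b c a' b' c' assume abc: "{a, b, c, a', b', c'} \<subseteq> carrier F"
  let ?x = "group_comm F (group_comm F a b \<otimes>\<^bsub>F\<^esub> c [^]\<^bsub>F\<^esub> (p - 1)) (group_comm F a' b' \<otimes>\<^bsub>F\<^esub> c' [^]\<^bsub>F\<^esub> (p - 1))"
  have "law_value F p a b c a' b' c' \<one>\<^bsub>F\<^esub> \<one>\<^bsub>F\<^esub> = ?x"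
  proof -
    have "group_comm F \<one>\<^bsub>F\<^esub> \<one>\<^bsub>F\<^esub> = \<one>\<^bsub>F\<^esub>" by (simp add: group_comm_def)
    then show ?thesis using abc by (simp add: law_value_def)
  qed
  then have "?x \<in> law_set F p"
    using law_setI[of a b c a' b' c' "\<one>\<^bsub>F\<^esub>" "\<one>\<^bsub>F\<^esub>" F p] abc by simp
  moreover have "?x \<in> F'"
    using abc by (intro group_comm_in_esum_kernel) auto
  ultimately show "?x \<in> J p" by (rule law_in_J[OF p])
qed

text \<open>The \<open>p\<close>-th powers of commutators are in \<open>law_set F p\<close>. As the derived subgroup is commutative modulo \<open>J p\<close>, this extends to products of commutators.\<close>

lemma derived_pow_in_J:
  assumes p: "prime p" "p \<le> B" and f: "f \<in> F'"
  shows "f [^]\<^bsub>F\<^esub> p \<in> J p"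
proof -
  interpret J: normal "J p" F by (rule J_normal)
  interpret D: normal F' F by (rule esum_kernel_normal)
  have "F' \<subseteq> {y \<in> F'. y [^]\<^bsub>F\<^esub> p \<in> J p}"
  proof (rule esum_kernel_subset[OF power_normal[OF J_normal esum_kernel_normal]])
    show "group_comm F y z \<in> J p" if "y \<in> F'" "z \<in> F'" for y z
      using that esum_kernel_mono[of "p - 1" 0 n] by (intro commute_mod_J[OF p]) auto
    fix a b assume ab: "a \<in> carrier F" "b \<in> carrier F"
    let ?x = "group_comm F a b"
    have x: "?x \<in> F'" by (rule group_comm_in_esum_kernel[OF ab])
    have "law_value F p \<one>\<^bsub>F\<^esub> \<one>\<^bsub>F\<^esub> \<one>\<^bsub>F\<^esub> \<one>\<^bsub>F\<^esub> \<one>\<^bsub>F\<^esub> \<one>\<^bsub>F\<^esub> a b = ?x [^]\<^bsub>F\<^esub> p"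
    proof -
      have "group_comm F \<one>\<^bsub>F\<^esub> \<one>\<^bsub>F\<^esub> = \<one>\<^bsub>F\<^esub>" by (simp add: group_comm_def)
      then show ?thesis using ab by (simp add: law_value_def)
    qed
    then have "?x [^]\<^bsub>F\<^esub> p \<in> law_set F p"
      using law_setI[of "\<one>\<^bsub>F\<^esub>" "\<one>\<^bsub>F\<^esub>" "\<one>\<^bsub>F\<^esub>" "\<one>\<^bsub>F\<^esub>" "\<one>\<^bsub>F\<^esub>" "\<one>\<^bsub>F\<^esub>" a b F p] ab by simp
    moreover have "?x [^]\<^bsub>F\<^esub> p \<in> F'"
      using ab by (intro esum_kernelI) simp_all
    ultimately have "?x [^]\<^bsub>F\<^esub> p \<in> J p" by (rule law_in_J[OF p])
    then show "?x \<in> {y \<in> F'. y [^]\<^bsub>F\<^esub> p \<in> J p}" using x by simp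
  qed (use D.one_closed J.one_closed in simp)
  then show ?thesis using f by blast
qed

text \<open>Modulo \<open>J p\<close>, the \<open>p\<close>-th powers of elements of the kernel of \<open>F \<rightarrow> (\<int>/(p-1))^n\<close>. This kernel is
  commutative modulo \<open>J p\<close>, so factoring out the \<open>p\<close>-th powers puts the quotient into
  \<open>Ab(p) * Ab(p - 1)\<close>.\<close>

definition X :: "nat \<Rightarrow> letter list set" where
  "X p = {x \<in> carrier F. \<exists>w\<in>esum_kernel n (p - 1). x \<otimes>\<^bsub>F\<^esub> inv\<^bsub>F\<^esub> (w [^]\<^bsub>F\<^esub> p) \<in> J p}"

lemma X_normal:
  assumes p: "prime p" "p \<le> B" shows "X p \<lhd> F"
proof -
  interpret N: normal "esum_kernel n (p - 1)" F by (rule esum_kernel_normal)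
  obtain Q :: "letter list set monoid" and h where hom: "group_hom F Q h"
    and ker: "\<And>x. x \<in> carrier F \<Longrightarrow> h x = \<one>\<^bsub>Q\<^esub> \<longleftrightarrow> x \<in> J p"
    using normal.quotient_hom[OF J_normal] by blast
  interpret h: group_hom F Q h by (rule hom)
  have "h y \<otimes>\<^bsub>Q\<^esub> h z = h z \<otimes>\<^bsub>Q\<^esub> h y" if "y \<in> esum_kernel n (p - 1)" "z \<in> esum_kernel n (p - 1)" for y z
    using commute_mod_J[OF p that] that h.commute_iff[of y z] ker[of "group_comm F y z"] by simp
  from h.power_in_normal(2)[OF N.normal_axioms C.one_is_normal this]
  have "{x \<in> carrier F. \<exists>w\<in>esum_kernel n (p - 1). h x = h w [^]\<^bsub>Q\<^esub> p} \<lhd> F" by simp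
  moreover have "h x = h w [^]\<^bsub>Q\<^esub> p \<longleftrightarrow> x \<otimes>\<^bsub>F\<^esub> inv\<^bsub>F\<^esub> (w [^]\<^bsub>F\<^esub> p) \<in> J p"
    if "x \<in> carrier F" "w \<in> esum_kernel n (p - 1)" for x w
    using that h.eq_iff[of x "w [^]\<^bsub>F\<^esub> p"] ker[of "x \<otimes>\<^bsub>F\<^esub> inv\<^bsub>F\<^esub> (w [^]\<^bsub>F\<^esub> p)"]
      h.hom_nat_pow[of w p] by simp
  then have "{x \<in> carrier F. \<exists>w\<in>esum_kernel n (p - 1). h x = h w [^]\<^bsub>Q\<^esub> p} = X p"
    unfolding X_def by blast
  ultimately show ?thesis by simp
qed

text \<open>On the kernel of \<open>F \<rightarrow> (\<int>/(p-1))^n\<close> the map \<open>y \<mapsto> y^p\<close> is a homomorphism modulo \<open>J p\<close>. It sends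
  commutators into \<open>J p\<close> and \<open>E\<close>-th powers into \<open>C\<close>, hence the kernel of \<open>F \<rightarrow> (\<int>/E)^n\<close> into \<open>C J p\<close>.\<close>

lemma pow_mod_C:
  assumes p: "prime p" "p \<le> B" and E: "p - 1 dvd E" and D: "\<And>a. a \<in> carrier F \<Longrightarrow> a [^]\<^bsub>F\<^esub> (E * p) \<in> C"
    and y: "y \<in> esum_kernel n E"
  obtains c where "c \<in> C" "y [^]\<^bsub>F\<^esub> p \<otimes>\<^bsub>F\<^esub> inv\<^bsub>F\<^esub> c \<in> J p"
proof -
  interpret N: normal "esum_kernel n (p - 1)" F by (rule esum_kernel_normal)
  obtain Q :: "letter list set monoid" and h where hom: "group_hom F Q h"
    and ker: "\<And>x. x \<in> carrier F \<Longrightarrow> h x = \<one>\<^bsub>Q\<^esub> \<longleftrightarrow> x \<in> J p"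
    using normal.quotient_hom[OF J_normal] by blast
  interpret h: group_hom F Q h by (rule hom)
  have comm: "h y \<otimes>\<^bsub>Q\<^esub> h z = h z \<otimes>\<^bsub>Q\<^esub> h y" if "y \<in> esum_kernel n (p - 1)" "z \<in> esum_kernel n (p - 1)" for y z
    using commute_mod_J[OF p that] that h.commute_iff[of y z] ker[of "group_comm F y z"] by simp
  have "esum_kernel n E \<subseteq> {y \<in> esum_kernel n (p - 1). \<exists>c\<in>C. h y [^]\<^bsub>Q\<^esub> p = h c}"
  proof (rule esum_kernel_subset[OF h.power_in_normal(1)[OF N.normal_axioms C_normal comm]])
    fix a b assume ab: "a \<in> carrier F" "b \<in> carrier F"
    have "group_comm F a b [^]\<^bsub>F\<^esub> p \<in> J p"
      by (rule derived_pow_in_J[OF p group_comm_in_esum_kernel[OF ab]])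
    then have "h (group_comm F a b) [^]\<^bsub>Q\<^esub> p = h \<one>\<^bsub>F\<^esub>"
      using ab ker[of "group_comm F a b [^]\<^bsub>F\<^esub> p"] h.hom_nat_pow[of "group_comm F a b" p] by simp
    then show "group_comm F a b \<in> {y \<in> esum_kernel n (p - 1). \<exists>c\<in>C. h y [^]\<^bsub>Q\<^esub> p = h c}"
      by (intro CollectI conjI bexI[of _ "\<one>\<^bsub>F\<^esub>"] group_comm_in_esum_kernel[OF ab]
          subgroup.one_closed[OF C.is_subgroup])
  next
    fix a assume a: "a \<in> carrier F"
    have "h (a [^]\<^bsub>F\<^esub> E) [^]\<^bsub>Q\<^esub> p = h (a [^]\<^bsub>F\<^esub> (E * p))"
      using a h.hom_nat_pow[of "a [^]\<^bsub>F\<^esub> E" p] by (simp add: C.nat_pow_pow)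
    then show "a [^]\<^bsub>F\<^esub> E \<in> {y \<in> esum_kernel n (p - 1). \<exists>c\<in>C. h y [^]\<^bsub>Q\<^esub> p = h c}"
      by (intro CollectI conjI bexI[of _ "a [^]\<^bsub>F\<^esub> (E * p)"] pow_in_esum_kernel[OF a E] D[OF a])
  qed
  then obtain c where c: "c \<in> C" "h y [^]\<^bsub>Q\<^esub> p = h c" and yN: "y \<in> esum_kernel n (p - 1)"
    using y by blast
  have "h (y [^]\<^bsub>F\<^esub> p) = h c" using c yN h.hom_nat_pow[of y p] by simp
  then have "y [^]\<^bsub>F\<^esub> p \<otimes>\<^bsub>F\<^esub> inv\<^bsub>F\<^esub> c \<in> J p"
    using c(1) yN h.eq_iff[of "y [^]\<^bsub>F\<^esub> p" c] ker[of "y [^]\<^bsub>F\<^esub> p \<otimes>\<^bsub>F\<^esub> inv\<^bsub>F\<^esub> c"] by simp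
  then show thesis using that c(1) by blast
qed

lemma pow_mem_if_mod_J:
  assumes x: "x \<in> carrier F" and j: "j \<in> J p" and c: "c \<in> C" "x \<otimes>\<^bsub>F\<^esub> inv\<^bsub>F\<^esub> c = j"
  shows "x [^]\<^bsub>F\<^esub> law_exponent B p \<in> C"
proof -
  interpret J: normal "J p" F by (rule J_normal)
  obtain Q :: "letter list set monoid" and h where hom: "group_hom F Q h"
    and ker: "\<And>x. x \<in> carrier F \<Longrightarrow> h x = \<one>\<^bsub>Q\<^esub> \<longleftrightarrow> x \<in> C"
    using C.quotient_hom by blast
  interpret h: group_hom F Q h by (rule hom)
  have "h c = \<one>\<^bsub>Q\<^esub>" using ker c(1) by simp
  moreover have "x = j \<otimes>\<^bsub>F\<^esub> c"
    using x c j by (simp add: C.m_assoc flip: c(2))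
  moreover have "j \<in> carrier F" "c \<in> carrier F" using j c(1) by simp_all
  ultimately have "h x = h j" by (simp only: h.hom_mult h.H.r_one h.hom_closed)
  moreover have "h (j [^]\<^bsub>F\<^esub> law_exponent B p) = \<one>\<^bsub>Q\<^esub>"
    using ker[of "j [^]\<^bsub>F\<^esub> law_exponent B p"] j J.mem_carrier[OF j] unfolding J_def by simp
  ultimately have "h (x [^]\<^bsub>F\<^esub> law_exponent B p) = \<one>\<^bsub>Q\<^esub>"
    using x j by (simp add: h.hom_nat_pow)
  then show ?thesis using ker x by simp
qed

text \<open>This bounds the index of \<open>X p\<close>. The exponent sums of \<open>e\<close> are \<open>p\<close> times those of some \<open>y\<close> in the kernel
  of \<open>F \<rightarrow> (\<int>/E)^n\<close>, so \<open>f = e y^(-p)\<close> is in the derived subgroup. As \<open>e\<close> is in \<open>C\<close> and \<open>y^p\<close> in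
  \<open>C J p\<close>, also \<open>f\<close> is in \<open>C J p\<close>, and thus in \<open>J p\<close>.\<close>

lemma kernel_subset_X:
  assumes p: "prime p" "p \<le> B" and E: "p - 1 dvd E" and D: "\<And>a. a \<in> carrier F \<Longrightarrow> a [^]\<^bsub>F\<^esub> (E * p) \<in> C"
    and e: "e \<in> C" "e \<in> esum_kernel n (E * p)"
  shows "e \<in> X p"
proof -
  interpret J: normal "J p" F by (rule J_normal)
  let ?N = "{e \<in> carrier F. \<exists>y\<in>esum_kernel n E. \<forall>i<n. esum i e = int p * esum i y}"
  interpret E: normal "esum_kernel n E" F by (rule esum_kernel_normal)
  have one0: "esum i \<one>\<^bsub>F\<^esub> = 0" for i by (simp add: free_group_one)
  have "?N \<lhd> F"
  proof (rule C.normal_invI[OF C.subgroupI])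
    show "?N \<subseteq> carrier F" by blast
    have "\<one>\<^bsub>F\<^esub> \<in> ?N" by (intro CollectI conjI bexI[of _ "\<one>\<^bsub>F\<^esub>"]) (simp_all add: one0)
    then show "?N \<noteq> {}" by blast
    fix a assume "a \<in> ?N"
    then obtain y where y: "a \<in> carrier F" "y \<in> esum_kernel n E" "\<forall>i<n. esum i a = int p * esum i y" by blast
    then show "inv\<^bsub>F\<^esub> a \<in> ?N"
      by (intro CollectI conjI bexI[of _ "inv\<^bsub>F\<^esub> y"]) auto
    fix b assume "b \<in> ?N"
    then obtain z where z: "b \<in> carrier F" "z \<in> esum_kernel n E" "\<forall>i<n. esum i b = int p * esum i z" by blast
    show "a \<otimes>\<^bsub>F\<^esub> b \<in> ?N"
      using y z by (intro CollectI conjI bexI[of _ "y \<otimes>\<^bsub>F\<^esub> z"]) (auto simp: algebra_simps)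
  next
    fix g a assume g: "g \<in> carrier F" and "a \<in> ?N"
    then obtain y where y: "a \<in> carrier F" "y \<in> esum_kernel n E" "\<forall>i<n. esum i a = int p * esum i y" by blast
    then show "g \<otimes>\<^bsub>F\<^esub> a \<otimes>\<^bsub>F\<^esub> inv\<^bsub>F\<^esub> g \<in> ?N"
      using g by (intro CollectI conjI bexI[of _ y]) auto
  qed
  then have "esum_kernel n (E * p) \<subseteq> ?N"
  proof (rule esum_kernel_subset)
    show "group_comm F a b \<in> ?N" if "a \<in> carrier F" "b \<in> carrier F" for a b
      using that by (intro CollectI conjI bexI[of _ "\<one>\<^bsub>F\<^esub>"]) (simp_all add: one0)
    show "a [^]\<^bsub>F\<^esub> (E * p) \<in> ?N" if "a \<in> carrier F" for a
      using that by (intro CollectI conjI bexI[of _ "a [^]\<^bsub>F\<^esub> E"] pow_in_esum_kernel) auto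
  qed
  then obtain y where y: "y \<in> esum_kernel n E" "\<forall>i<n. esum i e = int p * esum i y"
    using e(2) by blast
  have yc: "y \<in> carrier F" and ec: "e \<in> carrier F" using y(1) e(1) by auto
  obtain c where c: "c \<in> C" "y [^]\<^bsub>F\<^esub> p \<otimes>\<^bsub>F\<^esub> inv\<^bsub>F\<^esub> c \<in> J p"
    by (rule pow_mod_C[OF p E D y(1)])
  let ?f = "e \<otimes>\<^bsub>F\<^esub> inv\<^bsub>F\<^esub> (y [^]\<^bsub>F\<^esub> p)"
  have fc: "?f \<in> carrier F" using yc ec by (intro C.m_closed C.inv_closed C.nat_pow_closed)
  have "esum i ?f = esum i e - int p * esum i y" for i
    using yc by (simp only: esum_mult esum_inv[OF C.nat_pow_closed] esum_pow)
  then have "esum i ?f = 0" if "i < n" for i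
    using y(2) that by (simp only:)
  then have "?f \<in> F'"
    unfolding esum_kernel_def using fc by (intro CollectI conjI allI impI) (simp_all only: dvd_0_right)
  moreover have "?f [^]\<^bsub>F\<^esub> law_exponent B p \<in> C"
  proof -
    let ?z = "y [^]\<^bsub>F\<^esub> p"
    have "?z [^]\<^bsub>F\<^esub> law_exponent B p \<in> C"
      by (rule pow_mem_if_mod_J[OF _ c(2) c(1)]) (use yc in auto)
    obtain Q :: "letter list set monoid" and h where hom: "group_hom F Q h"
      and ker: "\<And>x. x \<in> carrier F \<Longrightarrow> h x = \<one>\<^bsub>Q\<^esub> \<longleftrightarrow> x \<in> C"
      using C.quotient_hom by blast
    interpret h: group_hom F Q h by (rule hom)
    have "h (?f [^]\<^bsub>F\<^esub> law_exponent B p) = inv\<^bsub>Q\<^esub> (h (?z [^]\<^bsub>F\<^esub> law_exponent B p))"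
      using yc ec ker[OF ec] e(1) by (simp add: h.hom_nat_pow h.H.nat_pow_inv)
    also have "\<dots> = \<one>\<^bsub>Q\<^esub>"
      using \<open>?z [^]\<^bsub>F\<^esub> law_exponent B p \<in> C\<close> ker[of "?z [^]\<^bsub>F\<^esub> law_exponent B p"] yc by simp
    finally show ?thesis
      using ker[of "?f [^]\<^bsub>F\<^esub> law_exponent B p"] yc ec by simp
  qed
  ultimately have "?f \<in> J p" by (simp add: J_def)
  moreover have "y \<in> esum_kernel n (p - 1)" using y(1) esum_kernel_mono[OF E] by blast
  ultimately show ?thesis using ec by (auto simp: X_def)
qed

text \<open>Fix \<open>p\<close> and write \<open>x = w^p\<close> modulo \<open>J p\<close>. Then the exponent sums of \<open>w\<close> are multiples of \<open>E = D / p\<close>, so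
  \<open>w^p\<close> is in \<open>C J p\<close>, and so is \<open>x\<close>; that is, \<open>x ^ law_exponent B p\<close> is in \<open>C\<close>. The exponents for the various
  \<open>p\<close> have no common divisor, hence \<open>x\<close> itself is in \<open>C\<close>.\<close>

lemma X_inter_subset:
  assumes D: "\<And>a. a \<in> carrier F \<Longrightarrow> a [^]\<^bsub>F\<^esub> D \<in> C"
    and dvd: "\<And>p. prime p \<Longrightarrow> p \<le> B \<Longrightarrow> (p - 1) * p dvd D"
    and x: "x \<in> esum_kernel n D" "\<And>p. prime p \<Longrightarrow> p \<le> B \<Longrightarrow> x \<in> X p"
  shows "x \<in> C"
proof (rule C.law_exponent_pow_mem[OF C.is_subgroup _ B])
  show xc: "x \<in> carrier F" using x(1) by (simp add: esum_kernel_def)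
  fix p assume p: "prime p" "p \<le> B"
  interpret J: normal "J p" F by (rule J_normal)
  obtain k where "D = (p - 1) * p * k" using dvd[OF p] by blast
  then obtain E where E: "D = E * p" "p - 1 dvd E" by (intro that[of "(p - 1) * k"]) auto
  obtain w where w: "w \<in> esum_kernel n (p - 1)" "x \<otimes>\<^bsub>F\<^esub> inv\<^bsub>F\<^esub> (w [^]\<^bsub>F\<^esub> p) \<in> J p"
    using x(2)[OF p] by (auto simp: X_def)
  have wc: "w \<in> carrier F" using w(1) by (simp add: esum_kernel_def)
  have "esum i x = int p * esum i w" if "i < n" for i
  proof -
    have "x \<otimes>\<^bsub>F\<^esub> inv\<^bsub>F\<^esub> (w [^]\<^bsub>F\<^esub> p) \<in> F'" using w(2) by (simp add: J_def)
    then have "int 0 dvd esum i (x \<otimes>\<^bsub>F\<^esub> inv\<^bsub>F\<^esub> (w [^]\<^bsub>F\<^esub> p))"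
      using that unfolding esum_kernel_def by blast
    then show ?thesis using wc by simp
  qed
  then have "int E dvd esum i w" if "i < n" for i
    using x(1) that prime_gt_0_nat[OF p(1)] by (auto simp: esum_kernel_def E(1) mult.commute)
  then have wE: "w \<in> esum_kernel n E" using wc by (simp add: esum_kernel_def)
  obtain c where c: "c \<in> C" "w [^]\<^bsub>F\<^esub> p \<otimes>\<^bsub>F\<^esub> inv\<^bsub>F\<^esub> c \<in> J p"
    by (rule pow_mod_C[OF p E(2) _ wE]) (use D E(1) in auto)
  have "x \<otimes>\<^bsub>F\<^esub> inv\<^bsub>F\<^esub> c = (x \<otimes>\<^bsub>F\<^esub> inv\<^bsub>F\<^esub> (w [^]\<^bsub>F\<^esub> p)) \<otimes>\<^bsub>F\<^esub> (w [^]\<^bsub>F\<^esub> p \<otimes>\<^bsub>F\<^esub> inv\<^bsub>F\<^esub> c)"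
    using xc wc c(1) by (simp add: C.m_assoc) (simp flip: C.m_assoc)
  also have "\<dots> \<in> J p" using w(2) c(2) by (rule J.m_closed)
  finally show "x [^]\<^bsub>F\<^esub> law_exponent B p \<in> C"
    using pow_mem_if_mod_J[OF xc _ c(1) HOL.refl] by blast
qed

lemma X_separable:
  assumes p: "prime p" "p \<le> B" and V: "pv_prod (Ab p) (Ab (p - 1)) \<subseteq> V"
    and fin: "finite (rcosets\<^bsub>F\<^esub> (X p))"
  shows "separable V F (X p)"
proof -
  interpret J: normal "J p" F by (rule J_normal)
  interpret N: normal "esum_kernel n (p - 1)" F by (rule esum_kernel_normal)
  obtain K h where "K \<in> pv_prod (Ab p) (Ab (p - 1))" "h \<in> hom F K"
    "\<And>x y. x \<in> carrier F \<Longrightarrow> y \<in> carrier F \<Longrightarrow> h x = h y \<longleftrightarrow> x \<otimes>\<^bsub>F\<^esub> inv\<^bsub>F\<^esub> y \<in> X p"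
  proof (rule C.quotient_in_pv_prod[OF X_normal[OF p] fin N.normal_axioms])
    show "group_comm F y z \<in> X p" if "y \<in> esum_kernel n (p - 1)" "z \<in> esum_kernel n (p - 1)" for y z
      using commute_mod_J[OF p that] that N.one_closed by (auto simp: X_def intro!: bexI[of _ "\<one>\<^bsub>F\<^esub>"])
    show "y [^]\<^bsub>F\<^esub> p \<in> X p" if "y \<in> esum_kernel n (p - 1)" for y
      using that J.one_closed by (auto simp: X_def intro!: bexI[of _ y])
    show "x [^]\<^bsub>F\<^esub> (p - 1) \<in> esum_kernel n (p - 1)" if "x \<in> carrier F" for x
      using that by (intro pow_in_esum_kernel) auto
  qed (auto intro: group_comm_in_esum_kernel)
  then show ?thesis
    using V unfolding separable_def by blast
qed

end

section \<open>Subgroups satisfying the laws are closed\<close>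

lemma subgroup_pow_closed:
  assumes "group G" "subgroup H G" "x \<in> H" shows "x [^]\<^bsub>G\<^esub> (k::nat) \<in> H"
proof -
  interpret G: group G by fact
  interpret H: subgroup H G by fact
  show ?thesis using assms(3) by (induction k) (simp_all add: H.m_closed)
qed

lemma (in group) rcos_eq_imp:
  assumes H: "subgroup H G" and xy: "x \<in> carrier G" "y \<in> carrier G" "H #> x = H #> y"
  shows "x \<otimes> inv y \<in> H"
proof -
  have "x \<in> H #> y"
    using rcos_self[OF xy(1) H] unfolding xy(3) .
  then show ?thesis
    by (rule subgroup.rcos_module_imp[OF H is_group xy(2)])
qed

lemma (in group) core_normal:
  assumes H: "subgroup H G"
  shows "{w \<in> carrier G. \<forall>g\<in>carrier G. g \<otimes> w \<otimes> inv g \<in> H} \<lhd> G" (is "?C \<lhd> G")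
proof (rule normal_invI[OF subgroupI])
  interpret H: subgroup H G by (rule H)
  show "?C \<subseteq> carrier G" by blast
  have "\<one> \<in> ?C" by simp
  then show "?C \<noteq> {}" by blast
  fix a assume a: "a \<in> ?C"
  show "inv a \<in> ?C"
  proof (intro CollectI conjI ballI)
    fix g assume g: "g \<in> carrier G"
    interpret c: group_hom G G "\<lambda>x. g \<otimes> x \<otimes> inv g" by (rule conj_hom[OF g])
    show "g \<otimes> inv a \<otimes> inv g \<in> H" using c.hom_inv[of a] a g by simp
  qed (use a in simp)
  fix b assume b: "b \<in> ?C"
  show "a \<otimes> b \<in> ?C"
  proof (intro CollectI conjI ballI)
    fix g assume g: "g \<in> carrier G"
    interpret c: group_hom G G "\<lambda>x. g \<otimes> x \<otimes> inv g" by (rule conj_hom[OF g])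
    show "g \<otimes> (a \<otimes> b) \<otimes> inv g \<in> H" using c.hom_mult[of a b] a b g H.m_closed by simp
  qed (use a b in simp)
next
  fix x a assume x: "x \<in> carrier G" and a: "a \<in> ?C"
  show "x \<otimes> a \<otimes> inv x \<in> ?C"
  proof (intro CollectI conjI ballI)
    fix g assume g: "g \<in> carrier G"
    have "g \<otimes> (x \<otimes> a \<otimes> inv x) \<otimes> inv g = (g \<otimes> x) \<otimes> a \<otimes> inv (g \<otimes> x)"
      using g x a by (simp add: m_assoc inv_mult_group)
    also have "\<dots> \<in> H" using a g x by blast
    finally show "g \<otimes> (x \<otimes> a \<otimes> inv x) \<otimes> inv g \<in> H" .
  qed (use x a in simp)
qed

lemma esum_int_pow:
  assumes "w \<in> carrier (free_group n)"
  shows "esum i (w [^]\<^bsub>free_group n\<^esub> (z::int)) = z * esum i w"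
proof (cases "z < 0")
  case True
  have "w [^]\<^bsub>free_group n\<^esub> nat (- z) \<in> carrier (free_group n)"
    using monoid.nat_pow_closed[OF group.is_monoid[OF group_free_group] assms] .
  then have "esum i (inv\<^bsub>free_group n\<^esub> (w [^]\<^bsub>free_group n\<^esub> nat (- z))) = - (int (nat (- z)) * esum i w)"
    by (simp only: esum_inv esum_pow)
  moreover have "w [^]\<^bsub>free_group n\<^esub> z = inv\<^bsub>free_group n\<^esub> (w [^]\<^bsub>free_group n\<^esub> nat (- z))"
    using True by (simp only: int_pow_def2 if_True)
  ultimately show ?thesis
    using True by simp
next
  case False
  have "w [^]\<^bsub>free_group n\<^esub> z = w [^]\<^bsub>free_group n\<^esub> nat z"
    using False by (simp only: int_pow_def2 if_False)
  then have "esum i (w [^]\<^bsub>free_group n\<^esub> z) = int (nat z) * esum i w"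
    by (simp only: esum_pow)
  then show ?thesis
    using False by simp
qed

text \<open>The separating normal subgroups are the \<open>X p\<close>, for \<open>C\<close> the normal core of \<open>H\<close>, together with kernels of
  \<open>F \<rightarrow> (\<int>/(q-1))^n\<close> for finitely many primes \<open>q\<close>; their intersection is inside \<open>C\<close>.\<close>

lemma laws_imp_closed_finite_index:
  assumes V: "\<And>q. prime q \<Longrightarrow> pv_prod (Ab q) (Ab (q - 1)) \<subseteq> V"
    and ws: "set ws \<subseteq> carrier (free_group n)"
    and bound: "Suc (\<Sum>w\<leftarrow>ws. Suc (length w)) \<le> B" "2 \<le> B"
    and laws: "\<And>p x. prime p \<Longrightarrow> p \<le> B \<Longrightarrow> x \<in> law_set (free_group n) p \<Longrightarrow>
      x [^]\<^bsub>free_group n\<^esub> law_exponent B p \<in> generate (free_group n) (set ws)"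
    and fin: "finite (rcosets\<^bsub>free_group n\<^esub> (generate (free_group n) (set ws)))"
    and g: "g \<in> carrier (free_group n)" "g \<notin> generate (free_group n) (set ws)"
  shows "\<exists>\<X>. finite \<X> \<and> (\<forall>X\<in>\<X>. separable V (free_group n) X) \<and>
    (\<forall>h\<in>generate (free_group n) (set ws). \<exists>X\<in>\<X>. h \<otimes>\<^bsub>free_group n\<^esub> inv\<^bsub>free_group n\<^esub> g \<notin> X)"
proof -
  let ?F = "free_group n" and ?H = "generate (free_group n) (set ws)"
  interpret F: group ?F by (rule group_free_group)
  have sub: "subgroup ?H ?F" by (rule F.generate_is_subgroup[OF ws])
  interpret H: subgroup ?H ?F by (rule sub)
  define C where "C = {w \<in> carrier ?F. \<forall>g\<in>carrier ?F. g \<otimes>\<^bsub>?F\<^esub> w \<otimes>\<^bsub>?F\<^esub> inv\<^bsub>?F\<^esub> g \<in> ?H}"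
  have C_normal: "C \<lhd> ?F" unfolding C_def by (rule F.core_normal[OF sub])
  have CI: "w \<in> C" if "w \<in> carrier ?F" "\<And>g. g \<in> carrier ?F \<Longrightarrow> g \<otimes>\<^bsub>?F\<^esub> w \<otimes>\<^bsub>?F\<^esub> inv\<^bsub>?F\<^esub> g \<in> ?H" for w
    using that by (simp add: C_def)
  have CH: "w \<in> ?H" if "w \<in> C" for w
  proof -
    have "w \<in> carrier ?F" "\<one>\<^bsub>?F\<^esub> \<otimes>\<^bsub>?F\<^esub> w \<otimes>\<^bsub>?F\<^esub> inv\<^bsub>?F\<^esub> \<one>\<^bsub>?F\<^esub> \<in> ?H"
      using that F.one_closed unfolding C_def by blast+
    then show ?thesis by simp
  qed
  have lawsC: "x [^]\<^bsub>?F\<^esub> law_exponent B p \<in> C"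
    if p: "prime p" "p \<le> B" and x: "x \<in> law_set ?F p" for p x
  proof (rule CI)
    have xc: "x \<in> carrier ?F" by (rule F.law_set_closed[OF x])
    then show "x [^]\<^bsub>?F\<^esub> law_exponent B p \<in> carrier ?F" by simp
    fix g assume g: "g \<in> carrier ?F"
    interpret c: group_hom ?F ?F "\<lambda>x. g \<otimes>\<^bsub>?F\<^esub> x \<otimes>\<^bsub>?F\<^esub> inv\<^bsub>?F\<^esub> g" by (rule F.conj_hom[OF g])
    show "g \<otimes>\<^bsub>?F\<^esub> x [^]\<^bsub>?F\<^esub> law_exponent B p \<otimes>\<^bsub>?F\<^esub> inv\<^bsub>?F\<^esub> g \<in> ?H"
      using laws[OF p c.hom_law_set[OF x]] c.hom_nat_pow[OF xc] by simp
  qed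
  interpret lawful_normal n B C
    by (rule lawful_normal.intro[OF C_normal bound(2) lawsC])
  \<comment> \<open>a multiple of \<open>p (p - 1)\<close> for \<open>p \<le> B\<close>, and of some exponent that takes a given element into \<open>H\<close>\<close>
  define D where "D = (fact B * fact B :: nat)"
  have D0: "0 < D" by (simp add: D_def)
  have powC: "a [^]\<^bsub>?F\<^esub> D \<in> C" if a: "a \<in> carrier ?F" for a
  proof (rule CI)
    fix g assume g: "g \<in> carrier ?F"
    interpret c: group_hom ?F ?F "\<lambda>x. g \<otimes>\<^bsub>?F\<^esub> x \<otimes>\<^bsub>?F\<^esub> inv\<^bsub>?F\<^esub> g" by (rule F.conj_hom[OF g])
    let ?b = "g \<otimes>\<^bsub>?F\<^esub> a \<otimes>\<^bsub>?F\<^esub> inv\<^bsub>?F\<^esub> g"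
    have b: "?b \<in> carrier ?F" using a g by simp
    obtain i where i: "1 \<le> i" "i \<le> card (rcosets\<^bsub>?F\<^esub> ?H)" "?b [^]\<^bsub>?F\<^esub> i \<in> ?H"
      by (rule F.finite_index_pow_mem[OF sub fin b])
    then have "i \<le> B" using finite_index_bound[OF ws fin] bound(1) by simp
    then have "i dvd D" using i(1) unfolding D_def by (intro dvd_mult dvd_fact) auto
    then obtain k where "D = i * k" ..
    then have "?b [^]\<^bsub>?F\<^esub> D = (?b [^]\<^bsub>?F\<^esub> i) [^]\<^bsub>?F\<^esub> k"
      using b by (simp only: F.nat_pow_pow)
    also have "\<dots> \<in> ?H" by (rule subgroup_pow_closed[OF F.group_axioms sub i(3)])
    finally show "g \<otimes>\<^bsub>?F\<^esub> a [^]\<^bsub>?F\<^esub> D \<otimes>\<^bsub>?F\<^esub> inv\<^bsub>?F\<^esub> g \<in> ?H"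
      using c.hom_nat_pow[OF a] by simp
  qed (use a in simp)
  have Dp: "\<exists>E. p - 1 dvd E \<and> D = E * p" if p: "prime p" "p \<le> B" for p
  proof -
    have "p dvd fact B" using p prime_ge_1_nat[OF p(1)] by (intro dvd_fact) auto
    then obtain u where u: "fact B = p * u" ..
    have "p - 1 dvd fact B" using p prime_gt_1_nat[OF p(1)] by (intro dvd_fact) auto
    then have "p - 1 dvd u * fact B" by (rule dvd_mult)
    moreover have "D = u * fact B * p" by (simp only: D_def u ac_simps)
    ultimately show ?thesis by blast
  qed
  have finX: "finite (rcosets\<^bsub>?F\<^esub> (X p))" if p: "prime p" "p \<le> B" for p
  proof -
    \<comment> \<open>words with equal values of \<open>?f\<close> differ by an element of \<open>C\<close> in the kernel of \<open>F \<rightarrow> (\<int>/D)^n\<close>\<close>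
    let ?f = "\<lambda>w. (restrict (\<lambda>t. t #>\<^bsub>?F\<^esub> w) (rcosets\<^bsub>?F\<^esub> ?H), restrict (\<lambda>i. esum i w mod int D) {..<n})"
    show ?thesis
    proof (rule F.finite_rcosets)
      show "subgroup (X p) ?F" using X_normal[OF p] by (rule normal_imp_subgroup)
      show "finite ((rcosets\<^bsub>?F\<^esub> ?H \<rightarrow>\<^sub>E rcosets\<^bsub>?F\<^esub> ?H) \<times> ({..<n} \<rightarrow>\<^sub>E {0..<int D}))"
        by (intro finite_cartesian_product finite_PiE fin) auto
      show "?f w \<in> (rcosets\<^bsub>?F\<^esub> ?H \<rightarrow>\<^sub>E rcosets\<^bsub>?F\<^esub> ?H) \<times> ({..<n} \<rightarrow>\<^sub>E {0..<int D})"
        if w: "w \<in> carrier ?F" for w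
      proof -
        have "t #>\<^bsub>?F\<^esub> w \<in> rcosets\<^bsub>?F\<^esub> ?H" if t: "t \<in> rcosets\<^bsub>?F\<^esub> ?H" for t
        proof -
          obtain g where g: "g \<in> carrier ?F" "t = ?H #>\<^bsub>?F\<^esub> g"
            using t by (auto simp: RCOSETS_def)
          then show ?thesis
            using F.coset_mult_assoc[OF H.subset g(1) w] F.rcosetsI[OF H.subset] w by simp
        qed
        then show ?thesis using D0 by (simp add: restrict_PiE_iff)
      qed
      fix x y assume xy: "x \<in> carrier ?F" "y \<in> carrier ?F" "?f x = ?f y"
      let ?z = "x \<otimes>\<^bsub>?F\<^esub> inv\<^bsub>?F\<^esub> y"
      have r: "restrict (\<lambda>t. t #>\<^bsub>?F\<^esub> x) (rcosets\<^bsub>?F\<^esub> ?H) = restrict (\<lambda>t. t #>\<^bsub>?F\<^esub> y) (rcosets\<^bsub>?F\<^esub> ?H)"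
          "restrict (\<lambda>i. esum i x mod int D) {..<n} = restrict (\<lambda>i. esum i y mod int D) {..<n}"
        using xy(3) by (simp_all only: prod.inject)
      have zC: "?z \<in> C"
      proof (rule CI)
        fix g assume g: "g \<in> carrier ?F"
        have "?H #>\<^bsub>?F\<^esub> g #>\<^bsub>?F\<^esub> x = ?H #>\<^bsub>?F\<^esub> g #>\<^bsub>?F\<^esub> y"
          using fun_cong[OF r(1), of "?H #>\<^bsub>?F\<^esub> g"] F.rcosetsI[OF H.subset g] by simp
        then have "?H #>\<^bsub>?F\<^esub> (g \<otimes>\<^bsub>?F\<^esub> x) = ?H #>\<^bsub>?F\<^esub> (g \<otimes>\<^bsub>?F\<^esub> y)"
          using F.coset_mult_assoc[OF H.subset g] xy(1,2) by simp
        then have "(g \<otimes>\<^bsub>?F\<^esub> x) \<otimes>\<^bsub>?F\<^esub> inv\<^bsub>?F\<^esub> (g \<otimes>\<^bsub>?F\<^esub> y) \<in> ?H"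
          using F.rcos_eq_imp[OF sub] g xy(1,2) by simp
        then show "g \<otimes>\<^bsub>?F\<^esub> ?z \<otimes>\<^bsub>?F\<^esub> inv\<^bsub>?F\<^esub> g \<in> ?H"
          using g xy(1,2) by (simp add: F.inv_mult_group F.m_assoc)
      qed (use xy in simp)
      have zD: "?z \<in> esum_kernel n D"
      proof (rule esum_kernelI)
        fix i assume "i < n"
        then have "esum i x mod int D = esum i y mod int D"
          using fun_cong[OF r(2), of i] by simp
        then have "int D dvd esum i x - esum i y" by (simp add: mod_eq_dvd_iff)
        then show "int D dvd esum i ?z" using xy(2) by simp
      qed (use xy in simp)
      obtain E where E: "p - 1 dvd E" "D = E * p" using Dp[OF p] by blast
      show "?z \<in> X p"
        by (rule kernel_subset_X[OF p E(1) _ zC]) (use powC zD E(2) in \<open>simp_all only:\<close>)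
    qed
  qed
  obtain Q where Q: "finite Q" "\<forall>q\<in>Q. prime q"
    "\<forall>w\<in>carrier ?F. (\<forall>q\<in>Q. w \<in> esum_kernel n (q - 1)) \<longrightarrow> w \<in> esum_kernel n D"
    by (rule esum_kernel_from_primes[where n = n, OF D0])
  let ?X = "X ` {p. prime p \<and> p \<le> B} \<union> (\<lambda>q. esum_kernel n (q - 1)) ` Q"
  show ?thesis
  proof (intro exI[of _ ?X] conjI ballI)
    have "{p. prime p \<and> p \<le> B} \<subseteq> {..B}" by auto
    then have "finite {p. prime p \<and> p \<le> B}" by (rule finite_subset) simp
    then show "finite ?X" using Q(1) by simp
    show "separable V ?F Y" if "Y \<in> ?X" for Y
    proof -
      from that consider p where "prime p" "p \<le> B" "Y = X p" | q where "q \<in> Q" "Y = esum_kernel n (q - 1)"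
        by blast
      then show ?thesis
      proof cases
        case 1
        then show ?thesis using X_separable[OF 1(1,2) V[OF 1(1)] finX[OF 1(1,2)]] by simp
      next
        case 2
        then have q: "prime q" using Q(2) by blast
        show ?thesis unfolding 2(2) by (rule esum_kernel_separable[OF V[OF q] q])
      qed
    qed
    fix h assume h: "h \<in> ?H"
    let ?z = "h \<otimes>\<^bsub>?F\<^esub> inv\<^bsub>?F\<^esub> g"
    have hc: "h \<in> carrier ?F" using h by simp
    show "\<exists>Y\<in>?X. ?z \<notin> Y"
    proof (rule ccontr)
      assume neg: "\<not> (\<exists>Y\<in>?X. ?z \<notin> Y)"
      have zD: "?z \<in> esum_kernel n D"
        using Q(3) neg hc g(1) by auto
      have "?z \<in> C"
      proof (rule X_inter_subset[OF powC _ zD])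
        show "(p - 1) * p dvd D" if pB: "prime p" "p \<le> B" for p
        proof -
          obtain E where "p - 1 dvd E" "D = E * p" using Dp[OF pB] by blast
          then show ?thesis by (simp add: mult_dvd_mono)
        qed
        show "?z \<in> X p" if "prime p" "p \<le> B" for p using neg that by blast
      qed
      then have "?z \<in> ?H" by (rule CH)
      then have "inv\<^bsub>?F\<^esub> ?z \<otimes>\<^bsub>?F\<^esub> h \<in> ?H"
        using h by (rule H.m_closed[OF H.m_inv_closed])
      then show False using g hc by (simp add: F.inv_mult_group F.m_assoc)
    qed
  qed
qed

text \<open>The exponent sum embeds \<open>F\<close> into the integers. If \<open>H\<close> has an element \<open>h\<close> of exponent sum \<open>k \<noteq> 0\<close>, then an
  element congruent to \<open>g\<close> modulo \<open>k\<close> differs from \<open>g\<close> by a power of \<open>h\<close> and is not in \<open>H\<close>; otherwise \<open>H\<close> is trivial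
  and any modulus larger than the exponent sum of \<open>g\<close> will do.\<close>

lemma rank_one_closed:
  assumes V: "\<And>q. prime q \<Longrightarrow> pv_prod (Ab q) (Ab (q - 1)) \<subseteq> V"
    and n: "n \<le> 1" and H: "subgroup H (free_group n)"
    and g: "g \<in> carrier (free_group n)" "g \<notin> H"
  shows "\<exists>\<X>. finite \<X> \<and> (\<forall>X\<in>\<X>. separable V (free_group n) X) \<and>
    (\<forall>h\<in>H. \<exists>X\<in>\<X>. h \<otimes>\<^bsub>free_group n\<^esub> inv\<^bsub>free_group n\<^esub> g \<notin> X)"
proof -
  let ?F = "free_group n"
  interpret F: group ?F by (rule group_free_group)
  interpret H: subgroup H ?F by (rule H)
  have inj: "u = v" if "u \<in> carrier ?F" "v \<in> carrier ?F" "esum 0 u = esum 0 v" for u v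
  proof -
    have "u \<otimes>\<^bsub>?F\<^esub> inv\<^bsub>?F\<^esub> v = \<one>\<^bsub>?F\<^esub>"
      using rank_one_esum_zero[OF n, of "u \<otimes>\<^bsub>?F\<^esub> inv\<^bsub>?F\<^esub> v"] that by (simp add: free_group_one)
    then show ?thesis using that F.inv_solve_right'[of "\<one>\<^bsub>?F\<^esub>" u v] by simp
  qed
  have g0: "esum 0 g \<noteq> 0"
  proof
    assume "esum 0 g = 0"
    then have "g = \<one>\<^bsub>?F\<^esub>" by (intro inj[OF g(1) F.one_closed]) (simp add: free_group_one)
    then show False using g(2) H.one_closed by simp
  qed
  have "n \<noteq> 0"
  proof
    assume "n = 0"
    then have "g = []" using g(1) by (cases g) (auto simp: free_group_carrier)
    then show False using g0 by simp
  qed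
  then have n1: "0 < n" by simp
  obtain D :: nat where D: "0 < D" "\<And>h. h \<in> H \<Longrightarrow> \<not> int D dvd esum 0 h - esum 0 g"
  proof (cases "\<exists>h\<in>H. esum 0 h \<noteq> 0")
    case True
    then obtain h where h: "h \<in> H" "esum 0 h \<noteq> 0" by blast
    have "\<not> int (nat \<bar>esum 0 h\<bar>) dvd esum 0 h' - esum 0 g" if h': "h' \<in> H" for h'
    proof
      assume "int (nat \<bar>esum 0 h\<bar>) dvd esum 0 h' - esum 0 g"
      then have "esum 0 h dvd esum 0 h' - esum 0 g" by simp
      then obtain j where j: "esum 0 h' - esum 0 g = esum 0 h * j" ..
      let ?v = "inv\<^bsub>?F\<^esub> (h [^]\<^bsub>?F\<^esub> j) \<otimes>\<^bsub>?F\<^esub> h'"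
      have hj: "h [^]\<^bsub>?F\<^esub> j \<in> H" by (rule F.subgroup_int_pow_closed[OF H h(1)])
      then have v: "?v \<in> H" using h' by (intro H.m_closed H.m_inv_closed)
      have "esum 0 ?v = esum 0 g"
        using hj h(1) j by (simp add: esum_int_pow algebra_simps)
      then have "g = ?v" using inj[of g ?v] g(1) v by simp
      then show False using g(2) v by simp
    qed
    then show thesis using that[of "nat \<bar>esum 0 h\<bar>"] h(2) by simp
  next
    case False
    have "\<not> int (nat \<bar>esum 0 g\<bar> + 1) dvd - esum 0 g"
      using g0 zdvd_not_zless[of "\<bar>esum 0 g\<bar>" "\<bar>esum 0 g\<bar> + 1"] by (simp add: add.commute)
    then show thesis using that[of "nat \<bar>esum 0 g\<bar> + 1"] False by auto
  qed
  obtain Q where Q: "finite Q" "\<forall>q\<in>Q. prime q"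
    "\<forall>w\<in>carrier ?F. (\<forall>q\<in>Q. w \<in> esum_kernel n (q - 1)) \<longrightarrow> w \<in> esum_kernel n D"
    by (rule esum_kernel_from_primes[where n = n, OF D(1)])
  show ?thesis
  proof (intro exI[of _ "(\<lambda>q. esum_kernel n (q - 1)) ` Q"] conjI ballI)
    show "separable V ?F Y" if Y: "Y \<in> (\<lambda>q. esum_kernel n (q - 1)) ` Q" for Y
    proof -
      obtain q where q: "q \<in> Q" "Y = esum_kernel n (q - 1)" using Y by blast
      have "prime q" using Q(2) q(1) by blast
      then show ?thesis unfolding q(2) by (intro esum_kernel_separable V)
    qed
    fix h assume h: "h \<in> H"
    let ?z = "h \<otimes>\<^bsub>?F\<^esub> inv\<^bsub>?F\<^esub> g"
    have z: "?z \<in> carrier ?F" using h g(1) by simp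
    show "\<exists>Y\<in>(\<lambda>q. esum_kernel n (q - 1)) ` Q. ?z \<notin> Y"
    proof (rule ccontr)
      assume neg: "\<not> (\<exists>Y\<in>(\<lambda>q. esum_kernel n (q - 1)) ` Q. ?z \<notin> Y)"
      have "?z \<in> esum_kernel n D" using Q(3) z neg by auto
      from esum_kernelD(2)[OF this n1] show False using D(2)[OF h] g(1) by simp
    qed
  qed (use Q(1) in simp)
qed

theorem laws_imp_closed:
  assumes V: "\<And>q. prime q \<Longrightarrow> pv_prod (Ab q) (Ab (q - 1)) \<subseteq> V" "\<And>K. K \<in> V \<Longrightarrow> group K"
    and ws: "set ws \<subseteq> carrier (free_group n)"
    and B: "Suc (\<Sum>w\<leftarrow>ws. Suc (length w)) \<le> B" "2 \<le> B"
    and laws: "\<And>p x. prime p \<Longrightarrow> p \<le> B \<Longrightarrow> x \<in> law_set (free_group n) p \<Longrightarrow>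
      x [^]\<^bsub>free_group n\<^esub> law_exponent B p \<in> generate (free_group n) (set ws)"
  shows "closedin (pro_topology V (free_group n)) (generate (free_group n) (set ws))"
proof -
  let ?F = "free_group n" and ?H = "generate (free_group n) (set ws)"
  interpret F: group ?F by (rule group_free_group)
  have sub: "subgroup ?H ?F" by (rule F.generate_is_subgroup[OF ws])
  have "separable V ?F (esum_kernel n (2 - 1))"
    by (rule esum_kernel_separable[OF V(1)]) auto
  then have ne: "V \<noteq> {}" unfolding separable_def by blast
  show ?thesis
  proof (rule closedin_if_separable[OF F.group_axioms ne V(2) subgroup.subset[OF sub]])
    fix g assume g: "g \<in> carrier ?F" "g \<notin> ?H"
    show "\<exists>\<X>. finite \<X> \<and> (\<forall>X\<in>\<X>. separable V ?F X) \<and> (\<forall>h\<in>?H. \<exists>X\<in>\<X>. h \<otimes>\<^bsub>?F\<^esub> inv\<^bsub>?F\<^esub> g \<notin> X)"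
    proof (cases "n \<le> 1")
      case True
      show ?thesis by (rule rank_one_closed[OF V(1) True sub g])
    next
      case False
      then have n: "2 \<le> n" by simp
      have fin: "finite (rcosets\<^bsub>?F\<^esub> ?H)"
      proof (rule ccontr)
        assume inf: "infinite (rcosets\<^bsub>?F\<^esub> ?H)"
        obtain a b c d where abcd: "{a, b, c, d} \<subseteq> carrier ?F"
          "group_comm ?F (group_comm ?F a b) (group_comm ?F c d) \<notin> ?H"
          by (rule infinite_index_double_comm[OF ws n inf])
        have "group_comm ?F (group_comm ?F a b) (group_comm ?F c d) \<in> ?H"
        proof (rule F.law_exponent_pow_mem[OF sub _ B(2)])
          fix p :: nat assume p: "prime p" "p \<le> B"
          show "group_comm ?F (group_comm ?F a b) (group_comm ?F c d) [^]\<^bsub>?F\<^esub> law_exponent B p \<in> ?H"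
            by (rule laws[OF p F.double_comm_in_law_set]) (use abcd(1) in simp_all)
        qed (use abcd(1) in simp)
        then show False using abcd(2) by simp
      qed
      show ?thesis by (rule laws_imp_closed_finite_index[OF V(1) ws B laws fin g])
    qed
  qed
qed

section \<open>Computable functions\<close>

text \<open>The values on lists of length other than \<open>k\<close> are disregarded, so that functions may be described with
  \<open>hd\<close> and \<open>tl\<close> instead of by their arguments.\<close>

definition computable :: "nat \<Rightarrow> (nat list \<Rightarrow> nat) \<Rightarrow> bool" where
  "computable k f \<longleftrightarrow> (\<exists>g. total_recursive k g \<and> (\<forall>xs. length xs = k \<longrightarrow> g xs = f xs))"

definition computable_pred :: "nat \<Rightarrow> (nat list \<Rightarrow> bool) \<Rightarrow> bool" where
  "computable_pred k P \<longleftrightarrow> computable k (\<lambda>xs. of_bool (P xs))"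

named_theorems computable_intros

lemma computable_cong:
  assumes "computable k f" "\<And>xs. length xs = k \<Longrightarrow> f xs = g xs"
  shows "computable k g"
  using assms unfolding computable_def by metis

lemma computable_comp:
  assumes f: "computable (length gs) f" and gs: "\<And>g. g \<in> set gs \<Longrightarrow> computable k g"
  shows "computable k (\<lambda>xs. f (map (\<lambda>g. g xs) gs))"
proof -
  obtain f' where f': "total_recursive (length gs) f'" "\<And>xs. length xs = length gs \<Longrightarrow> f' xs = f xs"
    using f unfolding computable_def by blast
  obtain r where r: "\<And>g. g \<in> set gs \<Longrightarrow> total_recursive k (r g)"
      "\<And>g xs. g \<in> set gs \<Longrightarrow> length xs = k \<Longrightarrow> r g xs = g xs"
    using gs unfolding computable_def by metis
  have "total_recursive k (\<lambda>xs. f' (map (\<lambda>g. g xs) (map r gs)))"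
    by (rule total_recursive.comp) (use f'(1) r(1) in auto)
  moreover have "f' (map (\<lambda>g. g xs) (map r gs)) = f (map (\<lambda>g. g xs) gs)" if "length xs = k" for xs
  proof -
    have "map (\<lambda>g. g xs) (map r gs) = map (\<lambda>g. g xs) gs"
      using r(2) that by simp
    then show ?thesis
      using f'(2)[of "map (\<lambda>g. g xs) gs"] by (simp del: map_map)
  qed
  ultimately show ?thesis
    unfolding computable_def by blast
qed

lemma computable_nth [computable_intros]: "i < k \<Longrightarrow> computable k (\<lambda>xs. xs ! i)"
  unfolding computable_def using total_recursive.proj by blast

lemma computable_hd [computable_intros]: "computable (Suc k) hd"
  by (rule computable_cong[OF computable_nth[of 0 "Suc k"]]) (simp_all add: hd_conv_nth flip: length_greater_0_conv)

text \<open>A bound variable is added at the head of the argument list, and a function under \<open>j\<close> binders has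
  its parameters behind \<open>j\<close> applications of \<open>tl\<close>. This lemma and the next one insert a variable that is
  ignored, at the first and at the second place.\<close>

lemma computable_weaken:
  assumes "computable k f"
  shows "computable (Suc k) (\<lambda>ys. f (tl ys))"
proof -
  have "computable (Suc k) (\<lambda>xs. f (map (\<lambda>g. g xs) (map (\<lambda>i ys. ys ! Suc i) [0..<k])))"
    by (rule computable_comp) (use assms in \<open>auto intro: computable_intros\<close>)
  moreover have "map (\<lambda>g. g xs) (map (\<lambda>i ys. ys ! Suc i) [0..<k]) = tl xs"
    if "length xs = Suc k" for xs :: "nat list"
    using that by (simp add: list_eq_iff_nth_eq nth_tl)
  ultimately show ?thesis
    by (elim computable_cong) simp
qed

lemma computable_weaken2:
  assumes "computable (Suc k) (\<lambda>ys. F (hd ys) (tl ys))"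
  shows "computable (Suc (Suc k)) (\<lambda>ys. F (hd ys) (tl (tl ys)))"
proof -
  let ?gs = "hd # map (\<lambda>i ys. ys ! (i + 2)) [0..<k]"
  have "computable (Suc (Suc k)) (\<lambda>xs. (\<lambda>ys. F (hd ys) (tl ys)) (map (\<lambda>g. g xs) ?gs))"
    by (rule computable_comp) (use assms in \<open>auto intro: computable_intros\<close>)
  moreover have "map (\<lambda>g. g xs) (map (\<lambda>i ys. ys ! (i + 2)) [0..<k]) = tl (tl xs)"
    if "length xs = Suc (Suc k)" for xs :: "nat list"
    using that by (simp add: list_eq_iff_nth_eq nth_tl)
  ultimately show ?thesis
    by (elim computable_cong) simp
qed

lemma computable_subst:
  assumes "computable (Suc k) (\<lambda>ys. F (hd ys) (tl ys))" "computable k G"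
  shows "computable k (\<lambda>xs. F (G xs) xs)"
proof -
  let ?gs = "G # map (\<lambda>i ys. ys ! i) [0..<k]"
  have "computable k (\<lambda>xs. (\<lambda>ys. F (hd ys) (tl ys)) (map (\<lambda>g. g xs) ?gs))"
    by (rule computable_comp) (use assms in \<open>auto intro: computable_intros\<close>)
  moreover have "map (\<lambda>g. g xs) (map (\<lambda>i ys. ys ! i) [0..<k]) = xs"
    if "length xs = k" for xs :: "nat list"
    using that by (simp add: list_eq_iff_nth_eq)
  ultimately show ?thesis
    by (elim computable_cong) simp
qed

lemma computable_Suc [computable_intros]:
  assumes "computable k f" shows "computable k (\<lambda>xs. Suc (f xs))"
proof -
  have "computable 1 (\<lambda>xs. Suc (xs ! 0))"
    unfolding computable_def using total_recursive.succ by blast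
  then have "computable (length [f]) (\<lambda>xs. Suc (xs ! 0))" by simp
  from computable_comp[OF this, of k] assms show ?thesis by simp
qed

lemma computable_const [computable_intros]: "computable k (\<lambda>xs. c)"
proof (induction c)
  case 0
  then show ?case unfolding computable_def using total_recursive.zero by blast
qed (rule computable_Suc)

lemma computable_rec:
  assumes N: "computable k N" and A: "computable k A"
    and G: "computable (Suc (Suc k)) (\<lambda>ys. G (hd ys) (hd (tl ys)) (tl (tl ys)))"
  shows "computable k (\<lambda>xs. rec_nat (A xs) (\<lambda>m r. G m r xs) (N xs))"
proof -
  obtain a where a: "total_recursive k a" "\<And>xs. length xs = k \<Longrightarrow> a xs = A xs"
    using A unfolding computable_def by blast
  obtain g where g: "total_recursive (Suc (Suc k)) g"
      "\<And>ys. length ys = Suc (Suc k) \<Longrightarrow> g ys = G (hd ys) (hd (tl ys)) (tl (tl ys))"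
    using G unfolding computable_def by blast
  have "computable (Suc k) (\<lambda>ys. rec_nat (A (tl ys)) (\<lambda>m r. G m r (tl ys)) (hd ys))"
  proof -
    have "rec_nat (a (tl ys)) (\<lambda>m r. g (m # r # tl ys)) c =
        rec_nat (A (tl ys)) (\<lambda>m r. G m r (tl ys)) c" if "length ys = Suc k" for ys c
      using that by (induction c) (auto simp: a(2) g(2))
    then have "rec_nat (a (tl ys)) (\<lambda>m r. g (m # r # tl ys)) (hd ys) =
        rec_nat (A (tl ys)) (\<lambda>m r. G m r (tl ys)) (hd ys)" if "length ys = Suc k" for ys
      using that by simp
    then show ?thesis
      unfolding computable_def
      by (intro exI[of _ "\<lambda>ys. rec_nat (a (tl ys)) (\<lambda>m r. g (m # r # tl ys)) (hd ys)"] conjI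
          total_recursive.prim_rec[OF a(1) g(1)]) simp
  qed
  from computable_subst[OF this N] show ?thesis .
qed

lemma computable_add [computable_intros]:
  assumes "computable k f" "computable k g" shows "computable k (\<lambda>xs. f xs + g xs)"
proof -
  have "rec_nat a (\<lambda>m r. Suc r) b = b + a" for a b by (induction b) auto
  moreover have "computable k (\<lambda>xs. rec_nat (g xs) (\<lambda>m r. Suc r) (f xs))"
    by (rule computable_rec; intro assms computable_intros computable_weaken)
  ultimately show ?thesis by simp
qed

lemma computable_mult [computable_intros]:
  assumes "computable k f" "computable k g" shows "computable k (\<lambda>xs. f xs * g xs)"
proof -
  have "rec_nat 0 (\<lambda>m r. a + r) b = b * a" for a b :: nat by (induction b) auto
  moreover have "computable k (\<lambda>xs. rec_nat 0 (\<lambda>m r. g xs + r) (f xs))"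
    by (rule computable_rec; intro assms computable_intros computable_weaken)
  ultimately show ?thesis by simp
qed

lemma computable_power [computable_intros]:
  assumes "computable k f" "computable k g" shows "computable k (\<lambda>xs. f xs ^ g xs)"
proof -
  have "rec_nat (Suc 0) (\<lambda>m r. a * r) b = a ^ b" for a b :: nat by (induction b) auto
  moreover have "computable k (\<lambda>xs. rec_nat (Suc 0) (\<lambda>m r. f xs * r) (g xs))"
    by (rule computable_rec; intro assms computable_intros computable_weaken)
  ultimately show ?thesis by simp
qed

lemma computable_diff [computable_intros]:
  assumes "computable k f" "computable k g" shows "computable k (\<lambda>xs. f xs - g xs)"
proof -
  have pred: "rec_nat 0 (\<lambda>m r. m) b = b - 1" for b :: nat by (cases b) auto
  have "computable k (\<lambda>xs. rec_nat 0 (\<lambda>m r. m) (h xs))" if "computable k h" for h k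
    by (rule computable_rec; intro that computable_intros computable_weaken)
  note P = this[unfolded pred]
  have "rec_nat a (\<lambda>m r. r - 1) b = a - b" for a b :: nat by (induction b) auto
  moreover have "computable k (\<lambda>xs. rec_nat (f xs) (\<lambda>m r. r - 1) (g xs))"
    by (rule computable_rec; intro assms computable_intros computable_weaken P)
  ultimately show ?thesis by simp
qed

lemma computable_pred_le [computable_intros]:
  assumes "computable k f" "computable k g" shows "computable_pred k (\<lambda>xs. f xs \<le> g xs)"
  unfolding computable_pred_def
  by (rule computable_cong[of k "\<lambda>xs. 1 - (f xs - g xs)"]) (auto intro!: computable_intros assms)

lemma computable_pred_not [computable_intros]:
  assumes "computable_pred k P" shows "computable_pred k (\<lambda>xs. \<not> P xs)"
  unfolding computable_pred_def
  by (rule computable_cong[of k "\<lambda>xs. 1 - of_bool (P xs)"])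
    (auto intro!: computable_intros assms[unfolded computable_pred_def])

lemma computable_pred_conj [computable_intros]:
  assumes "computable_pred k P" "computable_pred k Q" shows "computable_pred k (\<lambda>xs. P xs \<and> Q xs)"
  unfolding computable_pred_def
  by (rule computable_cong[of k "\<lambda>xs. of_bool (P xs) * of_bool (Q xs)"])
    (auto intro!: computable_intros assms[unfolded computable_pred_def])

lemma computable_pred_disj [computable_intros]:
  assumes "computable_pred k P" "computable_pred k Q" shows "computable_pred k (\<lambda>xs. P xs \<or> Q xs)"
  using computable_pred_not[OF computable_pred_conj[OF assms[THEN computable_pred_not]]] by simp

lemma computable_pred_imp [computable_intros]:
  assumes "computable_pred k P" "computable_pred k Q" shows "computable_pred k (\<lambda>xs. P xs \<longrightarrow> Q xs)"
  using computable_pred_disj[OF assms(1)[THEN computable_pred_not] assms(2)] by simp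

lemma computable_pred_less [computable_intros]:
  assumes "computable k f" "computable k g" shows "computable_pred k (\<lambda>xs. f xs < g xs)"
  using computable_pred_le[OF computable_Suc[OF assms(1)] assms(2)] by (simp add: Suc_le_eq)

lemma computable_pred_eq [computable_intros]:
  assumes "computable k f" "computable k g" shows "computable_pred k (\<lambda>xs. f xs = g xs)"
  using computable_pred_conj[OF computable_pred_le[OF assms] computable_pred_le[OF assms(2,1)]]
  by (simp add: order_eq_iff)

lemma computable_if [computable_intros]:
  assumes "computable_pred k P" "computable k f" "computable k g"
  shows "computable k (\<lambda>xs. if P xs then f xs else g xs)"
  by (rule computable_cong[of k "\<lambda>xs. of_bool (P xs) * f xs + (1 - of_bool (P xs)) * g xs"])
    (auto intro!: computable_intros assms assms[unfolded computable_pred_def])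

lemma computable_pred_all [computable_intros]:
  assumes N: "computable k N" and P: "computable_pred (Suc k) (\<lambda>ys. P (hd ys) (tl ys))"
  shows "computable_pred k (\<lambda>xs. \<forall>i<N xs. P i xs)"
proof -
  have "rec_nat (1::nat) (\<lambda>m r. of_bool (Q m) * r) b = of_bool (\<forall>i<b. Q i)" for b and Q :: "nat \<Rightarrow> bool"
    by (induction b) (auto simp: less_Suc_eq)
  moreover have "computable k (\<lambda>xs. rec_nat 1 (\<lambda>m r. of_bool (P m xs) * r) (N xs))"
    by (rule computable_rec; intro N computable_intros computable_weaken
        computable_weaken2[OF P[unfolded computable_pred_def]])
  ultimately show ?thesis unfolding computable_pred_def by simp
qed

lemma computable_pred_ex [computable_intros]:
  assumes N: "computable k N" and P: "computable_pred (Suc k) (\<lambda>ys. P (hd ys) (tl ys))"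
  shows "computable_pred k (\<lambda>xs. \<exists>i<N xs. P i xs)"
  using computable_pred_not[OF computable_pred_all[OF N computable_pred_not[OF P]]] by simp

text \<open>Bounded search; the bound itself is the value if the search fails.\<close>

definition bounded_least :: "nat \<Rightarrow> (nat \<Rightarrow> bool) \<Rightarrow> nat" where
  "bounded_least b P = (LEAST i. b \<le> i \<or> P i)"

lemma bounded_least_eqI:
  assumes "P i" "i < b" "\<And>j. j < b \<Longrightarrow> P j \<Longrightarrow> j = i"
  shows "bounded_least b P = i"
  unfolding bounded_least_def
proof (rule Least_equality)
  fix y assume "b \<le> y \<or> P y"
  then show "i \<le> y"
    using assms(2) assms(3)[of y] by (cases "y < b") auto
qed (use assms(1) in simp)

lemma computable_bounded_least [computable_intros]:
  assumes N: "computable k N" and P: "computable_pred (Suc k) (\<lambda>ys. P (hd ys) (tl ys))"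
  shows "computable k (\<lambda>xs. bounded_least (N xs) (\<lambda>i. P i xs))"
proof -
  have "computable_pred (Suc k) (\<lambda>ys. \<not> (N (tl ys) \<le> hd ys \<or> P (hd ys) (tl ys)))"
    by (intro computable_intros computable_weaken N P)
  then obtain f where f: "total_recursive (Suc k) f"
     "\<And>ys. length ys = Suc k \<Longrightarrow> f ys = of_bool (\<not> (N (tl ys) \<le> hd ys \<or> P (hd ys) (tl ys)))"
    unfolding computable_pred_def computable_def by blast
  have "\<exists>m. f (m # xs) = 0" if "length xs = k" for xs
    using f(2)[of "N xs # xs"] that by (intro exI[of _ "N xs"]) auto
  then have "total_recursive k (\<lambda>xs. LEAST m. f (m # xs) = 0)"
    by (intro total_recursive.minimise f) auto
  moreover have "(LEAST m. f (m # xs) = 0) = bounded_least (N xs) (\<lambda>i. P i xs)"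
    if "length xs = k" for xs
    unfolding bounded_least_def using f(2) that
    by (intro arg_cong[of _ _ Least] ext) auto
  ultimately show ?thesis
    unfolding computable_def by blast
qed

lemma computable_funpow [computable_intros]:
  assumes "computable k N" "computable k A" "computable (Suc k) (\<lambda>ys. F (hd ys) (tl ys))"
  shows "computable k (\<lambda>xs. ((\<lambda>i. F i xs) ^^ N xs) (A xs))"
proof -
  have "rec_nat a (\<lambda>m r. G r) n = (G ^^ n) a" for a n and G :: "nat \<Rightarrow> nat"
    by (induction n) auto
  moreover have "computable k (\<lambda>xs. rec_nat (A xs) (\<lambda>m r. F r xs) (N xs))"
    by (rule computable_rec; intro assms(1,2) computable_weaken[OF assms(3)])
  ultimately show ?thesis by simp
qed

section \<open>Codes of pairs and lists\<close>

lemma computable_triangle [computable_intros]: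
  assumes "computable k f" shows "computable k (\<lambda>xs. triangle (f xs))"
proof -
  have "rec_nat 0 (\<lambda>m r. r + Suc m) n = triangle n" for n by (induction n) auto
  moreover have "computable k (\<lambda>xs. rec_nat 0 (\<lambda>m r. r + Suc m) (f xs))"
    by (rule computable_rec; intro assms computable_intros computable_weaken)
  ultimately show ?thesis by simp
qed

lemma computable_prod_encode [computable_intros]:
  assumes "computable k f" "computable k g" shows "computable k (\<lambda>xs. prod_encode (f xs, g xs))"
  unfolding prod_encode_def prod.case by (intro computable_intros assms)

lemma fst_prod_decode:
  "fst (prod_decode z) = bounded_least (Suc z) (\<lambda>a. \<exists>b<Suc z. prod_encode (a, b) = z)"
proof -
  obtain a b where z: "z = prod_encode (a, b)"
    by (metis prod_decode_inverse surj_pair)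
  have "bounded_least (Suc z) (\<lambda>a. \<exists>b<Suc z. prod_encode (a, b) = z) = a"
    by (rule bounded_least_eqI)
      (use le_prod_encode_1[of a b] le_prod_encode_2[of b a] in \<open>auto simp: z prod_encode_eq less_Suc_eq_le\<close>)
  then show ?thesis by (simp add: z)
qed

lemma snd_prod_decode:
  "snd (prod_decode z) = bounded_least (Suc z) (\<lambda>b. \<exists>a<Suc z. prod_encode (a, b) = z)"
proof -
  obtain a b where z: "z = prod_encode (a, b)"
    by (metis prod_decode_inverse surj_pair)
  have "bounded_least (Suc z) (\<lambda>b. \<exists>a<Suc z. prod_encode (a, b) = z) = b"
    by (rule bounded_least_eqI)
      (use le_prod_encode_1[of a b] le_prod_encode_2[of b a] in \<open>auto simp: z prod_encode_eq less_Suc_eq_le\<close>)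
  then show ?thesis by (simp add: z)
qed

lemma computable_prod_decode [computable_intros]:
  assumes "computable k f"
  shows "computable k (\<lambda>xs. fst (prod_decode (f xs)))" "computable k (\<lambda>xs. snd (prod_decode (f xs)))"
  unfolding fst_prod_decode snd_prod_decode by (intro computable_intros computable_weaken assms)+

text \<open>The code of a nonempty list is the successor of the code of the pair of its head and the code of its tail. On the
  code \<open>0\<close> of the empty list both functions return \<open>0\<close>, as \<open>0 - 1 = 0\<close>.\<close>

definition code_hd :: "nat \<Rightarrow> nat" where "code_hd c = fst (prod_decode (c - 1))"
definition code_tl :: "nat \<Rightarrow> nat" where "code_tl c = snd (prod_decode (c - 1))"
definition code_drop :: "nat \<Rightarrow> nat \<Rightarrow> nat" where "code_drop k c = (code_tl ^^ k) c"
definition code_nth :: "nat \<Rightarrow> nat \<Rightarrow> nat" where "code_nth c k = code_hd (code_drop k c)"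

lemma prod_decode_0: "prod_decode 0 = (0, 0)"
  using prod_encode_inverse[of "(0, 0)"] by (simp add: prod_encode_def)

lemma code_tl_encode: "code_tl (list_encode xs) = list_encode (tl xs)"
  by (cases xs) (auto simp: code_tl_def prod_decode_0)

lemma code_drop_encode: "code_drop k (list_encode xs) = list_encode (drop k xs)"
  unfolding code_drop_def by (induction k) (auto simp: code_tl_encode drop_Suc tl_drop)

lemma code_nth_encode: "k < length xs \<Longrightarrow> code_nth (list_encode xs) k = xs ! k"
  unfolding code_nth_def code_drop_encode code_hd_def by (simp add: Cons_nth_drop_Suc[symmetric])

lemma code_nth_beyond: "length xs \<le> k \<Longrightarrow> code_nth (list_encode xs) k = 0"
  unfolding code_nth_def code_drop_encode code_hd_def by (simp add: prod_decode_0)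

lemma list_encode_eq_0: "list_encode xs = 0 \<longleftrightarrow> xs = []"
  by (cases xs) auto

lemma sum_list_le_list_encode: "(\<Sum>x\<leftarrow>xs. Suc x) \<le> list_encode xs"
proof (induction xs)
  case (Cons x xs)
  have "x + list_encode xs \<le> prod_encode (x, list_encode xs)"
  proof -
    have "s \<le> triangle s" for s by (induction s) auto
    from this[of "x + list_encode xs"] show ?thesis by (simp add: prod_encode_def)
  qed
  then show ?case using Cons by simp
qed simp

lemma length_le_list_encode: "length xs \<le> list_encode xs"
  using sum_list_le_list_encode[of xs] sum_list_mono[of xs "\<lambda>_. 1" Suc] by (simp add: sum_list_triv)

text \<open>The recursion follows \<open>prod_encode (a, b) < (a + b + 1)\<^sup>2\<close>.\<close>

fun code_bound :: "nat \<Rightarrow> nat \<Rightarrow> nat" where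
  "code_bound e 0 = 1"
| "code_bound e (Suc l) = Suc ((e + code_bound e l + 1)\<^sup>2)"

lemma list_encode_less_code_bound:
  assumes "length xs \<le> l" "\<And>x. x \<in> set xs \<Longrightarrow> x \<le> e"
  shows "list_encode xs < code_bound e l"
  using assms
proof (induction l arbitrary: xs)
  case (Suc l)
  show ?case
  proof (cases xs)
    case (Cons x ys)
    have tri: "prod_encode (a, b) < (a + b + 1)\<^sup>2" for a b
    proof -
      have "triangle s \<le> s * s" for s
        by (induction s) auto
      from this[of "a + b"] show ?thesis
        by (simp add: prod_encode_def power2_eq_square)
    qed
    have "list_encode ys < code_bound e l" "x \<le> e"
      using Suc Cons by auto
    then have "(x + list_encode ys + 1)\<^sup>2 \<le> (e + code_bound e l + 1)\<^sup>2"
      by (intro power_mono) auto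
    then have "prod_encode (x, list_encode ys) < (e + code_bound e l + 1)\<^sup>2"
      using tri less_le_trans by blast
    then show ?thesis
      using Cons by simp
  qed simp
qed simp

lemma computable_code_bound [computable_intros]:
  assumes "computable k f" "computable k g" shows "computable k (\<lambda>xs. code_bound (f xs) (g xs))"
proof -
  have "rec_nat 1 (\<lambda>m r. Suc ((e + r + 1)\<^sup>2)) n = code_bound e n" for e n by (induction n) auto
  moreover have "computable k (\<lambda>xs. rec_nat 1 (\<lambda>m r. Suc ((f xs + r + 1)\<^sup>2)) (g xs))"
    by (rule computable_rec; intro assms computable_intros computable_weaken)
  ultimately show ?thesis by simp
qed

lemma computable_code [computable_intros]:
  assumes "computable k f"
  shows "computable k (\<lambda>xs. code_hd (f xs))" "computable k (\<lambda>xs. code_tl (f xs))"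
  unfolding code_hd_def code_tl_def by (intro computable_intros computable_weaken assms)+

lemma computable_code_drop [computable_intros]:
  assumes "computable k f" "computable k g"
  shows "computable k (\<lambda>xs. code_drop (f xs) (g xs))"
  unfolding code_drop_def by (intro computable_intros computable_weaken assms)

lemma computable_code_nth [computable_intros]:
  assumes "computable k f" "computable k g"
  shows "computable k (\<lambda>xs. code_nth (f xs) (g xs))"
  unfolding code_nth_def by (intro computable_intros computable_weaken assms)

lemma computable_pred_dvd [computable_intros]:
  assumes "computable k f" "computable k g" shows "computable_pred k (\<lambda>xs. f xs dvd g xs)"
proof -
  have "a dvd b \<longleftrightarrow> (\<exists>c<Suc b. b = a * c)" for a b :: nat
    by (cases "a = 0"; cases "b = 0") (auto simp: dvd_def less_Suc_eq_le)
  then show ?thesis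
    by (simp only:) (intro computable_intros computable_weaken assms)
qed

lemma computable_pred_prime [computable_intros]:
  assumes "computable k f" shows "computable_pred k (\<lambda>xs. prime (f xs))"
proof -
  have "prime p \<longleftrightarrow> 1 < p \<and> (\<forall>d<p. d dvd p \<longrightarrow> d = 1)" for p :: nat
  proof (cases "1 < p")
    case True
    then have "m < p \<longleftrightarrow> m \<noteq> p" if "m dvd p" for m
      using dvd_imp_le[OF that] by linarith
    then show ?thesis
      using True unfolding prime_nat_iff by blast
  qed (simp add: prime_nat_iff)
  then show ?thesis
    by (simp only:) (intro computable_intros computable_weaken assms)
qed

section \<open>The decision procedure\<close>

text \<open>The code \<open>s\<close> of a list of length \<open>2 * n * m\<close> serves as a table with one row of length \<open>m\<close> for each letter, given by
  its code \<open>l\<close>. Everything outside the table is fixed.\<close>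

definition table_act :: "nat \<Rightarrow> nat \<Rightarrow> nat \<Rightarrow> nat \<Rightarrow> nat \<Rightarrow> nat" where
  "table_act n m s l i = (if l < 2 * n \<and> i < m then code_nth s (l * m + i) else i)"

text \<open>The action of the word with code \<open>c\<close>. A list is not longer than its code, so \<open>c\<close> steps suffice, and those after the end of
  the list do nothing.\<close>

definition table_run :: "nat \<Rightarrow> nat \<Rightarrow> nat \<Rightarrow> nat \<Rightarrow> nat \<Rightarrow> nat" where
  "table_run n m s c i =
     rec_nat i (\<lambda>j r. if code_drop j c = 0 then r else table_act n m s (code_nth c j) r) c"

text \<open>From the code of a letter to the code of its inverse.\<close>

definition flip :: "nat \<Rightarrow> nat" where
  "flip l = (if 2 dvd l then Suc l else l - 1)"

definition table_valid :: "nat \<Rightarrow> nat \<Rightarrow> nat \<Rightarrow> bool" where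
  "table_valid n m s \<longleftrightarrow> (\<forall>l<2 * n. \<forall>i<m.
     table_act n m s l i < m \<and> table_act n m s (flip l) (table_act n m s l i) = i)"

text \<open>For permutations of \<open>{..<m}\<close>, written as a right action: the first factor of a product acts first.\<close>

definition perm_inv :: "nat \<Rightarrow> (nat \<Rightarrow> nat) \<Rightarrow> nat \<Rightarrow> nat" where
  "perm_inv m f i = bounded_least m (\<lambda>j. f j = i)"

definition perm_comm :: "nat \<Rightarrow> (nat \<Rightarrow> nat) \<Rightarrow> (nat \<Rightarrow> nat) \<Rightarrow> nat \<Rightarrow> nat" where
  "perm_comm m f g i = perm_inv m g (perm_inv m f (g (f i)))"

definition perm_law where
  "perm_law m p k a b c a' b' c' d e =
     (\<lambda>i. perm_comm m (\<lambda>i. (c ^^ (p - 1)) (perm_comm m a b i))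
                       (\<lambda>i. (c' ^^ (p - 1)) (perm_comm m a' b' i))
            ((perm_comm m d e ^^ p) i)) ^^ k"

definition table_law :: "nat \<Rightarrow> nat \<Rightarrow> nat \<Rightarrow> nat \<Rightarrow> nat \<Rightarrow> nat \<Rightarrow> bool" where
  "table_law n m s w p k \<longleftrightarrow>
     (\<forall>a<w. \<forall>b<w. \<forall>c<w. \<forall>a'<w. \<forall>b'<w. \<forall>c'<w. \<forall>d<w. \<forall>e<w.
        perm_law m p k (table_run n m s a) (table_run n m s b) (table_run n m s c)
          (table_run n m s a') (table_run n m s b') (table_run n m s c')
          (table_run n m s d) (table_run n m s e) 0 = 0)"

text \<open>The sum of the numbers \<open>length w + 1\<close> over the generators is at most \<open>z\<close>. So \<open>z + 2\<close> is an admissible bound \<open>B\<close>, and \<open>m\<close> points suffice: the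
  core has at most \<open>z + 1\<close> of them, and the path of the word from \<open>infinite_index_double_comm\<close> at most
  \<open>2 * z + 17\<close>. The bound \<open>m ^ m\<close> is for the lengths of words in the laws.\<close>

definition decide :: "nat \<Rightarrow> bool" where
  "decide z \<longleftrightarrow> (let n = fst (prod_decode z); L = snd (prod_decode z); m = 3 * z + 20 in
     \<forall>s<code_bound m (2 * n * m).
       table_valid n m s \<and> (\<forall>k<L. table_run n m s (code_nth L k) 0 = 0) \<longrightarrow>
       (\<forall>p<z + 3. prime p \<longrightarrow> table_law n m s (code_bound (2 * n) (m ^ m)) p (law_exponent (z + 2) p)))"

text \<open>Unary functions that depend on parameters, to be used as arguments of \<open>perm_inv\<close> and of iteration.\<close>

definition computable_map :: "nat \<Rightarrow> (nat list \<Rightarrow> nat \<Rightarrow> nat) \<Rightarrow> bool" where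
  "computable_map k F \<longleftrightarrow> computable (Suc k) (\<lambda>ys. F (tl ys) (hd ys))"

lemma computable_map_weaken2:
  assumes "computable_map k F"
  shows "computable (Suc (Suc k)) (\<lambda>ys. F (tl (tl ys)) (hd ys))"
  using computable_weaken2[of k "\<lambda>i xs. F xs i"] assms unfolding computable_map_def .

lemma computable_map_apply:
  assumes "computable_map k F" "computable k A"
  shows "computable k (\<lambda>xs. F xs (A xs))"
  using computable_subst[of k "\<lambda>i xs. F xs i"] assms unfolding computable_map_def .

lemma computable_map_comp:
  assumes "computable_map k G" "computable_map k F"
  shows "computable_map k (\<lambda>xs i. G xs (F xs i))"
  unfolding computable_map_def
  by (rule computable_subst[of "Suc k" "\<lambda>i ys. G (tl ys) i" "\<lambda>ys. F (tl ys) (hd ys)"])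
    (use computable_map_weaken2[OF assms(1)] assms(2) in \<open>simp_all add: computable_map_def\<close>)

lemma computable_map_funpow:
  assumes "computable_map k F" "computable k N"
  shows "computable_map k (\<lambda>xs. F xs ^^ N xs)"
  unfolding computable_map_def
  by (intro computable_intros computable_weaken assms computable_map_weaken2[OF assms(1)])

lemma computable_map_perm_inv:
  assumes "computable_map k F" "computable k M"
  shows "computable_map k (\<lambda>xs. perm_inv (M xs) (F xs))"
  unfolding computable_map_def perm_inv_def
  by (intro computable_intros computable_weaken assms computable_map_weaken2[OF assms(1)])

lemma computable_map_perm_comm:
  assumes "computable_map k F" "computable_map k G" "computable k M"
  shows "computable_map k (\<lambda>xs. perm_comm (M xs) (F xs) (G xs))"
proof -
  have *: "perm_comm m f g = (\<lambda>i. perm_inv m g (perm_inv m f (g (f i))))" for m f g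
    by (rule ext) (simp add: perm_comm_def)
  show ?thesis
    unfolding *
    by (rule computable_map_comp[OF computable_map_perm_inv[OF assms(2,3)]
          computable_map_comp[OF computable_map_perm_inv[OF assms(1,3)] computable_map_comp[OF assms(2,1)]]])
qed

lemma computable_perm_law:
  assumes "computable k M" "computable k P" "computable k K"
    and "computable_map k A" "computable_map k B" "computable_map k C"
    and "computable_map k A'" "computable_map k B'" "computable_map k C'"
    and "computable_map k D" "computable_map k E" "computable k I"
  shows "computable k (\<lambda>xs. perm_law (M xs) (P xs) (K xs)
      (A xs) (B xs) (C xs) (A' xs) (B' xs) (C' xs) (D xs) (E xs) (I xs))"
proof -
  have P: "computable k (\<lambda>xs. P xs - 1)"
    by (intro computable_intros assms)
  have Y: "computable_map k (\<lambda>xs i. (C xs ^^ (P xs - 1)) (perm_comm (M xs) (A xs) (B xs) i))"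
    if "computable_map k A" "computable_map k B" "computable_map k C" for A B C
    by (rule computable_map_comp[OF computable_map_funpow[OF that(3) P] computable_map_perm_comm[OF that(1,2) assms(1)]])
  show ?thesis
    unfolding perm_law_def
    by (rule computable_map_apply[OF _ assms(12)], rule computable_map_funpow[OF computable_map_comp[OF
            computable_map_perm_comm[OF Y[OF assms(4-6)] Y[OF assms(7-9)] assms(1)]
            computable_map_funpow[OF computable_map_perm_comm[OF assms(10,11,1)] assms(2)]] assms(3)])
qed

lemma computable_table_act [computable_intros]:
  assumes "computable k N" "computable k M" "computable k S" "computable k L" "computable k I"
  shows "computable k (\<lambda>xs. table_act (N xs) (M xs) (S xs) (L xs) (I xs))"
  unfolding table_act_def by (intro computable_intros computable_weaken assms)

lemma computable_table_run [computable_intros]: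
  assumes "computable k N" "computable k M" "computable k S" "computable k C" "computable k I"
  shows "computable k (\<lambda>xs. table_run (N xs) (M xs) (S xs) (C xs) (I xs))"
  unfolding table_run_def
  by (rule computable_rec; intro computable_intros computable_weaken assms)

lemma computable_map_table_run:
  assumes "computable k N" "computable k M" "computable k S" "computable k C"
  shows "computable_map k (\<lambda>xs. table_run (N xs) (M xs) (S xs) (C xs))"
  unfolding computable_map_def by (intro computable_intros computable_weaken assms)

lemma computable_flip [computable_intros]:
  assumes "computable k f" shows "computable k (\<lambda>xs. flip (f xs))"
  unfolding flip_def by (intro computable_intros computable_weaken assms)

lemma computable_table_valid [computable_intros]:
  assumes "computable k N" "computable k M" "computable k S"
  shows "computable_pred k (\<lambda>xs. table_valid (N xs) (M xs) (S xs))"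
  unfolding table_valid_def by (intro computable_intros computable_weaken assms)

lemma computable_table_law [computable_intros]:
  assumes "computable k N" "computable k M" "computable k S" "computable k W" "computable k P" "computable k K"
  shows "computable_pred k (\<lambda>xs. table_law (N xs) (M xs) (S xs) (W xs) (P xs) (K xs))"
  unfolding table_law_def
  by (intro computable_pred_all computable_pred_eq computable_const computable_perm_law
      computable_map_table_run computable_hd computable_weaken assms)

lemma computable_law_exponent [computable_intros]:
  assumes "computable k f" "computable k g" shows "computable k (\<lambda>xs. law_exponent (f xs) (g xs))"
proof -
  have "rec_nat 1 (\<lambda>m r. r * (if p dvd Suc m then 1 else Suc m)) n = law_exponent n p" for n p
    by (induction n) auto
  moreover have "computable k (\<lambda>xs. rec_nat 1 (\<lambda>m r. r * (if g xs dvd Suc m then 1 else Suc m)) (f xs))"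
    by (rule computable_rec; intro assms computable_intros computable_weaken)
  ultimately show ?thesis by simp
qed

lemma computable_decide: "computable_pred 1 (\<lambda>xs. decide (xs ! 0))"
  unfolding decide_def Let_def
  by (intro computable_intros computable_weaken) simp_all

section \<open>Finite actions given by tables\<close>

text \<open>The complements of \<open>D\<close> and \<open>f ` D\<close> in \<open>M\<close> have the same size.\<close>

lemma extend_injection:
  assumes "finite M" "inj_on f D" "D \<subseteq> M" "f ` D \<subseteq> M"
  obtains g where "bij_betw g M M" "\<forall>x\<in>D. g x = f x"
proof -
  have fD: "finite D" using assms finite_subset by blast
  have "card (M - D) = card (M - f ` D)"
    using assms fD by (simp add: card_Diff_subset card_image)
  then obtain b where b: "bij_betw b (M - D) (M - f ` D)"
    using assms(1) finite_same_card_bij[of "M - D" "M - f ` D"] by auto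
  define g where "g x = (if x \<in> D then f x else b x)" for x
  have "bij_betw g D (f ` D)"
    using assms(2) by (auto simp: bij_betw_def g_def inj_on_def)
  moreover have "bij_betw g (M - D) (M - f ` D)"
    using b by (rule bij_betw_cong[THEN iffD1, rotated]) (simp add: g_def)
  ultimately have "bij_betw g (D \<union> (M - D)) (f ` D \<union> (M - f ` D))"
    by (rule bij_betw_combine) auto
  moreover have "D \<union> (M - D) = M" "f ` D \<union> (M - f ` D) = M" using assms by auto
  ultimately show thesis using that[of g] by (simp add: g_def)
qed

lemma letter_code_less: "fst x < n \<Longrightarrow> letter_code x < 2 * n"
  by (cases x) auto

lemma letter_code_inv: "letter_code (inv_letter x) = flip (letter_code x)"
  by (cases x) (simp add: inv_letter_def flip_def)

lemma table_exists:
  assumes \<tau>: "\<And>l j. l < 2 * n \<Longrightarrow> j < m \<Longrightarrow> \<tau> l j < m"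
  obtains s where "s < code_bound m (2 * n * m)"
    "\<forall>l<2 * n. \<forall>j<m. table_act n m s l j = \<tau> l j"
proof -
  let ?xs = "map (\<lambda>k. \<tau> (k div m) (k mod m)) [0..<2 * n * m]"
  have pos: "l * m + j < 2 * n * m" if "l < 2 * n" "j < m" for l j
  proof -
    have "l * m + j < Suc l * m" using that by simp
    also have "\<dots> \<le> 2 * n * m" using that by (intro mult_le_mono1) simp
    finally show ?thesis .
  qed
  show thesis
  proof (rule that[of "list_encode ?xs"])
    show "list_encode ?xs < code_bound m (2 * n * m)"
    proof (rule list_encode_less_code_bound)
      fix x assume "x \<in> set ?xs"
      then obtain k where k: "k < 2 * n * m" "x = \<tau> (k div m) (k mod m)" by auto
      then have "m \<noteq> 0" by (cases m) auto
      then have "k div m < 2 * n" "k mod m < m"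
        using k(1) by (simp_all add: less_mult_imp_div_less)
      then show "x \<le> m" using \<tau> k(2) by (simp add: less_imp_le)
    qed simp
    show "\<forall>l<2 * n. \<forall>j<m. table_act n m (list_encode ?xs) l j = \<tau> l j"
    proof (intro allI impI)
      fix l j assume "l < 2 * n" "j < m"
      then show "table_act n m (list_encode ?xs) l j = \<tau> l j"
        using pos[of l j] by (simp add: table_act_def code_nth_encode)
    qed
  qed
qed

text \<open>Each generator acts on \<open>T\<close> as a partial injection. Once \<open>T\<close> is numbered by \<open>e\<close>, this extends to a permutation of
  \<open>m\<close> points, and inverse letters act by the inverse permutation.\<close>

lemma (in letter_action) partial_table:
  assumes T: "T \<subseteq> A" "finite T" "card T \<le> m" and base: "base \<in> T"
  obtains s e where "s < code_bound m (2 * n * m)" "table_valid n m s"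
    "inj_on e T" "e base = 0" "e ` T \<subseteq> {..<m}"
    "\<forall>x t. fst x < n \<longrightarrow> t \<in> T \<longrightarrow> act x t \<in> T \<longrightarrow> table_act n m s (letter_code x) (e t) = e (act x t)"
proof -
  obtain h where h: "bij_betw h T {..<card T}"
    using ex_bij_betw_finite_nat[OF T(2)] by (auto simp: atLeast0LessThan)
  have hb: "h base < card T" using bij_betwE[OF h] base by auto
  \<comment> \<open>a numbering of \<open>T\<close> composed with a transposition that sends the base point to \<open>0\<close>\<close>
  define e where "e t = (if h t = h base then 0 else if h t = 0 then h base else h t)" for t
  have inj: "inj_on e T"
    using h unfolding bij_betw_def inj_on_def e_def by (auto split: if_splits)
  have em: "e t < m" if "t \<in> T" for t
    using bij_betwE[OF h] that hb T(3) by (auto simp: e_def)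
  have e0: "e base = 0" by (simp add: e_def)
  have "\<exists>g. bij_betw g {..<m} {..<m} \<and>
      (\<forall>t\<in>T. act (i, True) t \<in> T \<longrightarrow> g (e t) = e (act (i, True) t))" if i: "i < n" for i
  proof -
    let ?D = "{t \<in> T. act (i, True) t \<in> T}" and ?f = "\<lambda>j. e (act (i, True) (inv_into T e j))"
    have f: "?f (e t) = e (act (i, True) t)" if "t \<in> T" for t
      using inv_into_f_f[OF inj that] by simp
    have actinj: "t = t'" if tt: "t \<in> A" "t' \<in> A" "act (i, True) t = act (i, True) t'" for t t'
    proof -
      have x: "fst (i, True) < n" using i by simp
      have "t = act (inv_letter (i, True)) (act (i, True) t)" by (rule act_inv[OF x tt(1), symmetric])
      also have "\<dots> = act (inv_letter (i, True)) (act (i, True) t')" by (simp only: tt(3))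
      also have "\<dots> = t'" by (rule act_inv[OF x tt(2)])
      finally show ?thesis .
    qed
    have "inj_on ?f (e ` ?D)"
    proof (rule inj_onI)
      fix j k assume "j \<in> e ` ?D" "k \<in> e ` ?D" and eq: "?f j = ?f k"
      then obtain t u where tu: "t \<in> ?D" "u \<in> ?D" "j = e t" "k = e u" by blast
      then have "e (act (i, True) t) = e (act (i, True) u)" using eq f by simp
      then have "act (i, True) t = act (i, True) u" using inj_onD[OF inj] tu by simp
      then have "t = u" using actinj tu T(1) by blast
      then show "j = k" using tu by simp
    qed
    moreover have "e ` ?D \<subseteq> {..<m}" using em by auto
    moreover have "?f ` (e ` ?D) \<subseteq> {..<m}" using em f by auto
    ultimately obtain g where g: "bij_betw g {..<m} {..<m}" "\<forall>j\<in>e ` ?D. g j = ?f j"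
      by (rule extend_injection[of "{..<m}" ?f "e ` ?D", OF finite_lessThan])
    have "g (e t) = e (act (i, True) t)" if "t \<in> T" "act (i, True) t \<in> T" for t
    proof -
      have "e t \<in> e ` ?D" using that by blast
      from bspec[OF g(2) this] show ?thesis using f[OF that(1)] by (simp only:)
    qed
    then show ?thesis using g(1) by blast
  qed
  then have "\<forall>i\<in>{..<n}. \<exists>g. bij_betw g {..<m} {..<m} \<and>
      (\<forall>t\<in>T. act (i, True) t \<in> T \<longrightarrow> g (e t) = e (act (i, True) t))" by simp
  from bchoice[OF this] obtain g where g: "\<forall>i\<in>{..<n}. bij_betw (g i) {..<m} {..<m} \<and>
      (\<forall>t\<in>T. act (i, True) t \<in> T \<longrightarrow> g i (e t) = e (act (i, True) t))" ..
  have gm: "g i j < m" "inv_into {..<m} (g i) j < m" "inv_into {..<m} (g i) (g i j) = j"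
    "g i (inv_into {..<m} (g i) j) = j" if "i < n" "j < m" for i j
  proof -
    have b: "bij_betw (g i) {..<m} {..<m}" using g that(1) by simp
    show "g i j < m" using bij_betwE[OF b] that(2) by simp
    show "inv_into {..<m} (g i) j < m" using bij_betwE[OF bij_betw_inv_into[OF b]] that(2) by simp
    show "inv_into {..<m} (g i) (g i j) = j" using bij_betw_inv_into_left[OF b] that(2) by simp
    show "g i (inv_into {..<m} (g i) j) = j" using bij_betw_inv_into_right[OF b] that(2) by simp
  qed
  define \<tau> where "\<tau> l = (if 2 dvd l then inv_into {..<m} (g (l div 2)) else g (l div 2))" for l :: nat
  have \<tau>m: "\<tau> l j < m" if "l < 2 * n" "j < m" for l j
    using gm[of "l div 2" j] that by (simp add: \<tau>_def less_mult_imp_div_less mult.commute)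
  obtain s where s: "s < code_bound m (2 * n * m)"
    "\<forall>l<2 * n. \<forall>j<m. table_act n m s l j = \<tau> l j"
    by (rule table_exists[of n m \<tau>, OF \<tau>m])
  have flip: "flip l < 2 * n \<and> \<tau> (flip l) (\<tau> l j) = j" if "l < 2 * n" "j < m" for l j
  proof (cases "2 dvd l")
    case True
    then obtain i where i: "l = 2 * i" ..
    then show ?thesis using gm[of i j] that by (simp add: \<tau>_def flip_def)
  next
    case False
    then have "odd l" by simp
    then obtain i where i: "l = 2 * i + 1" by (rule oddE)
    then show ?thesis using gm[of i j] that by (simp add: \<tau>_def flip_def)
  qed
  show thesis
  proof (rule that[OF s(1) _ inj e0])
    show "table_valid n m s"
      using s(2) \<tau>m flip by (simp add: table_valid_def)
    show "e ` T \<subseteq> {..<m}" using em by auto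
    show "\<forall>x t. fst x < n \<longrightarrow> t \<in> T \<longrightarrow> act x t \<in> T \<longrightarrow> table_act n m s (letter_code x) (e t) = e (act x t)"
    proof (intro allI impI)
    fix x t assume x: "fst x < n" and t: "t \<in> T" "act x t \<in> T"
    obtain i b where ib: "x = (i, b)" by (cases x)
    have i: "i < n" using x ib by simp
    have "\<tau> (letter_code x) (e t) = e (act x t)"
    proof (cases b)
      case True
      then show ?thesis using ib g i t by (simp add: \<tau>_def)
    next
      case False
      have "act (i, True) (act x t) = t"
        using act_inv[OF x, of t] t(1) T(1) ib False by (auto simp: inv_letter_def)
      then have "g i (e (act x t)) = e t" using g i t by auto
      then have "inv_into {..<m} (g i) (e t) = e (act x t)"
        using gm(3)[OF i em[OF t(2)]] by simp
      then show ?thesis using ib False by (simp add: \<tau>_def)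
    qed
    then show "table_act n m s (letter_code x) (e t) = e (act x t)"
      using s(2) letter_code_less[OF x] em[OF t(1)] by simp
    qed
  qed
qed

abbreviation table_letter :: "nat \<Rightarrow> nat \<Rightarrow> nat \<Rightarrow> letter \<Rightarrow> nat \<Rightarrow> nat" where
  "table_letter n m s x \<equiv> table_act n m s (letter_code x)"

lemma table_letter_action:
  assumes "table_valid n m s" shows "letter_action n (table_letter n m s) UNIV"
proof
  fix x :: letter and t :: nat assume x: "fst x < n"
  show "table_letter n m s (inv_letter x) (table_letter n m s x t) = t"
  proof (cases "t < m")
    case True
    then show ?thesis
      using assms letter_code_less[OF x] by (simp add: table_valid_def letter_code_inv)
  qed (simp add: table_act_def)
qed simp

lemma table_run_encode: "table_run n m s (list_encode ls) i = fold (table_act n m s) ls i"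
proof -
  let ?G = "\<lambda>j r. if code_drop j (list_encode ls) = 0 then r else table_act n m s (code_nth (list_encode ls) j) r"
  have "rec_nat i ?G j = fold (table_act n m s) (take j ls) i" for j
  proof (induction j)
    case (Suc j)
    show ?case
    proof (cases "j < length ls")
      case True
      then have "code_drop j (list_encode ls) \<noteq> 0"
        by (simp add: code_drop_encode list_encode_eq_0)
      then show ?thesis
        using Suc True by (simp add: code_nth_encode take_Suc_conv_app_nth)
    next
      case False
      then have "code_drop j (list_encode ls) = 0"
        by (simp add: code_drop_encode)
      then show ?thesis
        using Suc False by simp
    qed
  qed simp
  then show ?thesis
    using length_le_list_encode[of ls] by (simp add: table_run_def)
qed

lemma table_run_word_code: "table_run n m s (word_code w) i = fold (table_letter n m s) w i"
  unfolding word_code_def table_run_encode by (simp add: fold_map comp_def)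

text \<open>Numbers from \<open>2 * n\<close> on are not codes of letters, but act as the identity and may be left out.\<close>

lemma table_run_is_word:
  obtains w where "\<forall>x\<in>set w. fst x < n" "table_run n m s c = fold (table_letter n m s) w"
proof -
  define dec where "dec l = (l div 2, odd l)" for l :: nat
  have dec: "letter_code (dec l) = l" for l
    unfolding dec_def by (cases "odd l") (auto elim: oddE evenE)
  let ?w = "map dec (filter (\<lambda>l. l < 2 * n) (list_decode c))"
  have "fold (table_act n m s) ls i = fold (table_letter n m s) (map dec (filter (\<lambda>l. l < 2 * n) ls)) i" for ls i
    by (induction ls arbitrary: i) (auto simp: dec table_act_def)
  then have "table_run n m s c = fold (table_letter n m s) ?w"
    using table_run_encode[of n m s "list_decode c"] by (intro ext) simp
  moreover have "\<forall>x\<in>set ?w. fst x < n" by (auto simp: dec_def)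
  ultimately show thesis using that[of ?w] by simp
qed

section \<open>Correctness of the decision procedure\<close>

lemma table_word_less:
  assumes "table_valid n m s" "\<forall>x\<in>set w. fst x < n" "i < m"
  shows "fold (table_letter n m s) w i < m"
  using assms(2,3)
proof (induction w arbitrary: i)
  case (Cons x w)
  then have "table_letter n m s x i < m"
    using assms(1) letter_code_less[of x n] by (simp add: table_valid_def)
  then show ?case using Cons by simp
qed simp

text \<open>Restricted to \<open>i < m\<close>, because \<open>perm_inv m f\<close> is an inverse of \<open>f\<close> only there.\<close>

definition agrees :: "nat \<Rightarrow> nat \<Rightarrow> nat \<Rightarrow> (nat \<Rightarrow> nat) \<Rightarrow> letter list \<Rightarrow> bool" where
  "agrees n m s f w \<longleftrightarrow> (\<forall>i<m. f i = fold (table_letter n m s) w i)"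

context
  fixes n m s :: nat
  assumes valid: "table_valid n m s"
begin

interpretation letter_action n "table_letter n m s" UNIV
  by (rule table_letter_action[OF valid])

interpretation F: group "free_group n"
  by (rule group_free_group)

abbreviation (input) "\<rho> \<equiv> fold (table_letter n m s)"

lemma rho_less: "w \<in> carrier (free_group n) \<Longrightarrow> i < m \<Longrightarrow> \<rho> w i < m"
  using table_word_less[OF valid, of w i] by (simp add: free_group_carrier)

lemma rho_mult:
  "a \<in> carrier (free_group n) \<Longrightarrow> b \<in> carrier (free_group n) \<Longrightarrow>
    \<rho> (a \<otimes>\<^bsub>free_group n\<^esub> b) i = \<rho> b (\<rho> a i)"
  by (rule fold_mult) simp_all

lemma rho_one: "\<rho> \<one>\<^bsub>free_group n\<^esub> i = i"
  by (simp add: free_group_one)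

lemma rho_inv:
  assumes "a \<in> carrier (free_group n)"
  shows "\<rho> a (\<rho> (inv\<^bsub>free_group n\<^esub> a) i) = i" "\<rho> (inv\<^bsub>free_group n\<^esub> a) (\<rho> a i) = i"
  using rho_mult[of "inv\<^bsub>free_group n\<^esub> a" a i] rho_mult[of a "inv\<^bsub>free_group n\<^esub> a" i] assms
  by (simp_all add: rho_one)

lemma agrees_mult:
  assumes "a \<in> carrier (free_group n)" "b \<in> carrier (free_group n)" "agrees n m s f a" "agrees n m s g b"
  shows "agrees n m s (\<lambda>i. g (f i)) (a \<otimes>\<^bsub>free_group n\<^esub> b)"
  unfolding agrees_def
proof (intro allI impI)
  fix i assume i: "i < m"
  have "f i = \<rho> a i" using assms(3) i by (simp add: agrees_def)
  moreover have "g (\<rho> a i) = \<rho> b (\<rho> a i)" using assms(4) rho_less[OF assms(1) i] by (simp add: agrees_def)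
  ultimately show "g (f i) = \<rho> (a \<otimes>\<^bsub>free_group n\<^esub> b) i"
    using rho_mult[OF assms(1,2)] by simp
qed

lemma agrees_pow:
  assumes "a \<in> carrier (free_group n)" "agrees n m s f a"
  shows "agrees n m s (f ^^ k) (a [^]\<^bsub>free_group n\<^esub> k)"
proof (induction k)
  case 0
  then show ?case by (simp add: agrees_def free_group_one)
next
  case (Suc k)
  have "agrees n m s (\<lambda>i. f ((f ^^ k) i)) (a [^]\<^bsub>free_group n\<^esub> k \<otimes>\<^bsub>free_group n\<^esub> a)"
    by (rule agrees_mult) (use assms Suc in auto)
  then show ?case by (simp add: comp_def)
qed

lemma agrees_inv:
  assumes "a \<in> carrier (free_group n)" "agrees n m s f a"
  shows "agrees n m s (perm_inv m f) (inv\<^bsub>free_group n\<^esub> a)"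
  unfolding agrees_def perm_inv_def
proof (intro allI impI bounded_least_eqI)
  fix i assume i: "i < m"
  show j: "\<rho> (inv\<^bsub>free_group n\<^esub> a) i < m" using rho_less i assms(1) by simp
  then show "f (\<rho> (inv\<^bsub>free_group n\<^esub> a) i) = i"
    using assms(2) rho_inv(1)[OF assms(1)] by (simp add: agrees_def)
  fix k assume "k < m" "f k = i"
  then have "\<rho> a k = i" using assms(2) by (simp add: agrees_def)
  then show "k = \<rho> (inv\<^bsub>free_group n\<^esub> a) i" using rho_inv(2)[OF assms(1), of k] by simp
qed

lemma agrees_comm:
  assumes "a \<in> carrier (free_group n)" "b \<in> carrier (free_group n)" "agrees n m s f a" "agrees n m s g b"
  shows "agrees n m s (perm_comm m f g) (group_comm (free_group n) a b)"
proof -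
  have "agrees n m s (\<lambda>i. perm_inv m g (perm_inv m f (g (f i)))) (group_comm (free_group n) a b)"
    unfolding group_comm_def
    by (intro agrees_mult[of _ _ _ "perm_inv m g"] agrees_mult[of _ _ _ "perm_inv m f"] agrees_mult[of a b f g]
        agrees_inv assms F.m_closed F.inv_closed)
  moreover have "perm_comm m f g = (\<lambda>i. perm_inv m g (perm_inv m f (g (f i))))"
    by (rule ext) (simp add: perm_comm_def)
  ultimately show ?thesis by simp
qed

lemma agrees_law:
  assumes "{a, b, c, a', b', c', d, e} \<subseteq> carrier (free_group n)"
    and "agrees n m s fa a" "agrees n m s fb b" "agrees n m s fc c" "agrees n m s fa' a'" "agrees n m s fb' b'"
    "agrees n m s fc' c'" "agrees n m s fd d" "agrees n m s fe e"
  shows "agrees n m s (perm_law m p k fa fb fc fa' fb' fc' fd fe)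
    (law_value (free_group n) p a b c a' b' c' d e [^]\<^bsub>free_group n\<^esub> k)"
proof -
  have c: "a \<in> carrier (free_group n)" "b \<in> carrier (free_group n)" "c \<in> carrier (free_group n)"
    "a' \<in> carrier (free_group n)" "b' \<in> carrier (free_group n)" "c' \<in> carrier (free_group n)"
    "d \<in> carrier (free_group n)" "e \<in> carrier (free_group n)"
    using assms(1) by auto
  note closed = F.m_closed F.nat_pow_closed F.group_comm_closed c
  have Y: "agrees n m s (\<lambda>i. (fc ^^ (p - 1)) (perm_comm m fa fb i))
      (group_comm (free_group n) a b \<otimes>\<^bsub>free_group n\<^esub> c [^]\<^bsub>free_group n\<^esub> (p - 1))"
    by (rule agrees_mult[OF _ _ agrees_comm[OF c(1,2) assms(2,3)] agrees_pow[OF c(3) assms(4)]]) (intro closed)+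
  have Y': "agrees n m s (\<lambda>i. (fc' ^^ (p - 1)) (perm_comm m fa' fb' i))
      (group_comm (free_group n) a' b' \<otimes>\<^bsub>free_group n\<^esub> c' [^]\<^bsub>free_group n\<^esub> (p - 1))"
    by (rule agrees_mult[OF _ _ agrees_comm[OF c(4,5) assms(5,6)] agrees_pow[OF c(6) assms(7)]]) (intro closed)+
  have L: "law_value (free_group n) p a b c a' b' c' d e \<in> carrier (free_group n)"
    unfolding law_value_def by (intro closed)
  show ?thesis
    unfolding perm_law_def
  proof (rule agrees_pow[OF L])
    show "agrees n m s (\<lambda>i. perm_comm m (\<lambda>i. (fc ^^ (p - 1)) (perm_comm m fa fb i))
        (\<lambda>i. (fc' ^^ (p - 1)) (perm_comm m fa' fb' i)) ((perm_comm m fd fe ^^ p) i))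
        (law_value (free_group n) p a b c a' b' c' d e)"
      unfolding law_value_def
      by (rule agrees_mult[OF _ _ agrees_pow[OF _ agrees_comm[OF c(7,8) assms(8,9)]] agrees_comm[OF _ _ Y Y']])
        (intro closed)+
  qed
qed

text \<open>In a shortest word with the given action no two prefixes act alike, since the factor between them
  could be left out; and there are only \<open>m ^ m\<close> maps on \<open>{..<m}\<close>.\<close>

lemma short_word:
  assumes "w \<in> carrier (free_group n)"
  obtains c where "c < code_bound (2 * n) (m ^ m)" "agrees n m s (table_run n m s c) w"
proof -
  define P where "P v \<longleftrightarrow> (\<forall>x\<in>set v. fst x < n) \<and> (\<forall>i<m. \<rho> v i = \<rho> w i)" for v
  have "P w" using assms by (simp add: P_def free_group_carrier)
  then obtain v where v: "P v" and min: "\<And>u. P u \<Longrightarrow> length v \<le> length u"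
    using ex_has_least_nat[of P w length] by blast
  have "length v < m ^ m"
  proof (rule ccontr)
    assume "\<not> length v < m ^ m"
    let ?r = "\<lambda>k. restrict (\<rho> (take k v)) {..<m}"
    have letters: "\<forall>x\<in>set (take k v). fst x < n" for k
      using v set_take_subset[of k v] by (auto simp: P_def)
    have "?r ` {..length v} \<subseteq> {..<m} \<rightarrow>\<^sub>E {..<m}"
      by (rule image_subsetI) (simp add: restrict_PiE_iff table_word_less[OF valid letters])
    then have "card (?r ` {..length v}) \<le> card ({..<m} \<rightarrow>\<^sub>E {..<m})"
      by (intro card_mono finite_PiE) auto
    also have "\<dots> = m ^ m" by (simp add: card_PiE)
    also have "\<dots> < card {..length v}" using \<open>\<not> length v < m ^ m\<close> by simp
    finally have "\<not> inj_on ?r {..length v}" using pigeonhole by blast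
    then obtain k l where kl: "k < l" "l \<le> length v" "?r k = ?r l"
      unfolding inj_on_def by (metis atMost_iff linorder_neqE_nat)
    let ?u = "take k v @ drop l v"
    have "\<rho> ?u i = \<rho> v i" if "i < m" for i
    proof -
      have "\<rho> (take k v) i = \<rho> (take l v) i"
        using fun_cong[OF kl(3), of i] that by simp
      then have "\<rho> ?u i = \<rho> (take l v @ drop l v) i" by (simp only: fold_append comp_apply)
      then show ?thesis by (simp only: append_take_drop_id)
    qed
    then have "P ?u"
      using v by (auto simp: P_def dest: in_set_takeD in_set_dropD)
    from min[OF this] show False using kl(1,2) by simp
  qed
  show thesis
  proof (rule that[of "word_code v"])
    show "word_code v < code_bound (2 * n) (m ^ m)"
      unfolding word_code_def
    proof (rule list_encode_less_code_bound)
      show "length (map letter_code v) \<le> m ^ m" using \<open>length v < m ^ m\<close> by simp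
      fix l assume "l \<in> set (map letter_code v)"
      then obtain x where "x \<in> set v" "l = letter_code x" by auto
      then show "l \<le> 2 * n" using v letter_code_less[of x n] by (auto simp: P_def)
    qed
    show "agrees n m s (table_run n m s (word_code v)) w"
      using v by (simp add: agrees_def P_def table_run_word_code)
  qed
qed

text \<open>Bounded codes cover all group elements by \<open>short_word\<close>; conversely every code acts as some group element.\<close>

lemma table_law_iff:
  assumes "0 < m"
  shows "table_law n m s (code_bound (2 * n) (m ^ m)) p k \<longleftrightarrow>
    (\<forall>x\<in>law_set (free_group n) p. \<rho> (x [^]\<^bsub>free_group n\<^esub> k) 0 = 0)"
proof
  assume law: "table_law n m s (code_bound (2 * n) (m ^ m)) p k"
  show "\<forall>x\<in>law_set (free_group n) p. \<rho> (x [^]\<^bsub>free_group n\<^esub> k) 0 = 0"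
  proof
    fix x assume "x \<in> law_set (free_group n) p"
    then obtain a b c a' b' c' d e where x: "x = law_value (free_group n) p a b c a' b' c' d e"
      "{a, b, c, a', b', c', d, e} \<subseteq> carrier (free_group n)"
      unfolding law_set_def mem_Collect_eq by (elim exE conjE)
    then have car: "a \<in> carrier (free_group n)" "b \<in> carrier (free_group n)" "c \<in> carrier (free_group n)"
      "a' \<in> carrier (free_group n)" "b' \<in> carrier (free_group n)" "c' \<in> carrier (free_group n)"
      "d \<in> carrier (free_group n)" "e \<in> carrier (free_group n)"
      by auto
    obtain ca where a: "ca < code_bound (2 * n) (m ^ m)" "agrees n m s (table_run n m s ca) a" by (rule short_word[OF car(1)])
    obtain cb where b: "cb < code_bound (2 * n) (m ^ m)" "agrees n m s (table_run n m s cb) b" by (rule short_word[OF car(2)])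
    obtain cc where c: "cc < code_bound (2 * n) (m ^ m)" "agrees n m s (table_run n m s cc) c" by (rule short_word[OF car(3)])
    obtain ca' where a': "ca' < code_bound (2 * n) (m ^ m)" "agrees n m s (table_run n m s ca') a'" by (rule short_word[OF car(4)])
    obtain cb' where b': "cb' < code_bound (2 * n) (m ^ m)" "agrees n m s (table_run n m s cb') b'" by (rule short_word[OF car(5)])
    obtain cc' where c': "cc' < code_bound (2 * n) (m ^ m)" "agrees n m s (table_run n m s cc') c'" by (rule short_word[OF car(6)])
    obtain cd where d: "cd < code_bound (2 * n) (m ^ m)" "agrees n m s (table_run n m s cd) d" by (rule short_word[OF car(7)])
    obtain ce where e: "ce < code_bound (2 * n) (m ^ m)" "agrees n m s (table_run n m s ce) e" by (rule short_word[OF car(8)])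
    have "perm_law m p k (table_run n m s ca) (table_run n m s cb) (table_run n m s cc) (table_run n m s ca')
        (table_run n m s cb') (table_run n m s cc') (table_run n m s cd) (table_run n m s ce) 0 = 0"
      using law[unfolded table_law_def, rule_format, OF a(1) b(1) c(1) a'(1) b'(1) c'(1) d(1) e(1)] .
    moreover have "agrees n m s (perm_law m p k (table_run n m s ca) (table_run n m s cb) (table_run n m s cc)
        (table_run n m s ca') (table_run n m s cb') (table_run n m s cc') (table_run n m s cd) (table_run n m s ce))
        (x [^]\<^bsub>free_group n\<^esub> k)"
      unfolding x(1) by (rule agrees_law[OF x(2) a(2) b(2) c(2) a'(2) b'(2) c'(2) d(2) e(2)])
    ultimately show "\<rho> (x [^]\<^bsub>free_group n\<^esub> k) 0 = 0"
      using assms by (simp only: agrees_def)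
  qed
next
  assume law: "\<forall>x\<in>law_set (free_group n) p. \<rho> (x [^]\<^bsub>free_group n\<^esub> k) 0 = 0"
  have "\<exists>a\<in>carrier (free_group n). agrees n m s (table_run n m s c) a" for c
  proof -
    obtain w where w: "\<forall>x\<in>set w. fst x < n" "table_run n m s c = \<rho> w"
      by (rule table_run_is_word)
    have "agrees n m s (table_run n m s c) (reduce w)"
      using fold_reduce[OF w(1)] by (simp add: agrees_def w(2))
    then show ?thesis using reduce_in_free_group[OF w(1)] by blast
  qed
  then obtain el where el: "\<And>c. el c \<in> carrier (free_group n)" "\<And>c. agrees n m s (table_run n m s c) (el c)"
    by metis
  show "table_law n m s (code_bound (2 * n) (m ^ m)) p k"
    unfolding table_law_def
  proof (intro allI impI)
    fix a b c a' b' c' d e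
    let ?x = "law_value (free_group n) p (el a) (el b) (el c) (el a') (el b') (el c') (el d) (el e)"
    have sub: "{el a, el b, el c, el a', el b', el c', el d, el e} \<subseteq> carrier (free_group n)"
      by (simp add: el(1))
    have "agrees n m s (perm_law m p k (table_run n m s a) (table_run n m s b) (table_run n m s c) (table_run n m s a')
        (table_run n m s b') (table_run n m s c') (table_run n m s d) (table_run n m s e)) (?x [^]\<^bsub>free_group n\<^esub> k)"
      by (rule agrees_law[OF sub el(2) el(2) el(2) el(2) el(2) el(2) el(2) el(2)])
    moreover have "\<rho> (?x [^]\<^bsub>free_group n\<^esub> k) 0 = 0"
      using bspec[OF law law_setI[OF sub]] .
    ultimately show "perm_law m p k (table_run n m s a) (table_run n m s b) (table_run n m s c) (table_run n m s a')
        (table_run n m s b') (table_run n m s c') (table_run n m s d) (table_run n m s e) 0 = 0"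
      using assms by (simp only: agrees_def)
  qed
qed

lemma point_stabilizer: "subgroup {w \<in> carrier (free_group n). \<rho> w 0 = 0} (free_group n)"
proof (rule F.subgroupI)
  have "\<one>\<^bsub>free_group n\<^esub> \<in> {w \<in> carrier (free_group n). \<rho> w 0 = 0}"
    using rho_one F.one_closed by simp
  then show "{w \<in> carrier (free_group n). \<rho> w 0 = 0} \<noteq> {}" by blast
  fix a assume a: "a \<in> {w \<in> carrier (free_group n). \<rho> w 0 = 0}"
  then show "inv\<^bsub>free_group n\<^esub> a \<in> {w \<in> carrier (free_group n). \<rho> w 0 = 0}"
    using rho_inv(2)[of a 0] by simp
  fix b assume b: "b \<in> {w \<in> carrier (free_group n). \<rho> w 0 = 0}"
  show "a \<otimes>\<^bsub>free_group n\<^esub> b \<in> {w \<in> carrier (free_group n). \<rho> w 0 = 0}"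
    using a b rho_mult[of a b 0] by simp
qed blast

end

lemma decide_iff:
  fixes ws :: "letter list list"
  assumes "z = instance_code (n, ws)" and ws: "set ws \<subseteq> carrier (free_group n)"
  shows "decide z \<longleftrightarrow> (\<forall>s<code_bound (3 * z + 20) (2 * n * (3 * z + 20)).
      table_valid n (3 * z + 20) s \<and> (\<forall>w\<in>set ws. fold (table_letter n (3 * z + 20) s) w 0 = 0) \<longrightarrow>
      (\<forall>p\<le>z + 2. prime p \<longrightarrow> (\<forall>x\<in>law_set (free_group n) p.
        fold (table_letter n (3 * z + 20) s) (x [^]\<^bsub>free_group n\<^esub> law_exponent (z + 2) p) 0 = 0)))"
proof -
  let ?m = "3 * z + 20" and ?L = "list_encode (map word_code ws)"
  have dec: "fst (prod_decode z) = n" "snd (prod_decode z) = ?L"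
    using assms(1) by simp_all
  have fix_iff: "(\<forall>k<?L. table_run n ?m s (code_nth ?L k) 0 = 0) \<longleftrightarrow>
      (\<forall>w\<in>set ws. fold (table_letter n ?m s) w 0 = 0)" for s
  proof
    assume l: "\<forall>k<?L. table_run n ?m s (code_nth ?L k) 0 = 0"
    show "\<forall>w\<in>set ws. fold (table_letter n ?m s) w 0 = 0"
    proof
      fix w assume "w \<in> set ws"
      then obtain k where k: "k < length ws" "ws ! k = w" by (auto simp: in_set_conv_nth)
      have "length ws \<le> ?L" using length_le_list_encode[of "map word_code ws"] by simp
      then have "k < ?L" using k(1) by (rule less_le_trans[rotated])
      moreover have "code_nth ?L k = word_code w" using k by (simp add: code_nth_encode)
      ultimately show "fold (table_letter n ?m s) w 0 = 0"
        using l table_run_word_code[of n ?m s w 0] by (metis (no_types))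
    qed
  next
    assume r: "\<forall>w\<in>set ws. fold (table_letter n ?m s) w 0 = 0"
    show "\<forall>k<?L. table_run n ?m s (code_nth ?L k) 0 = 0"
    proof (intro allI impI)
      fix k
      show "table_run n ?m s (code_nth ?L k) 0 = 0"
      proof (cases "k < length ws")
        case True
        then have "code_nth ?L k = word_code (ws ! k)" by (simp add: code_nth_encode)
        then show ?thesis using r True by (simp only: table_run_word_code) simp
      next
        case False
        then have "code_nth ?L k = 0" by (intro code_nth_beyond) simp
        then show ?thesis by (simp add: table_run_def)
      qed
    qed
  qed
  have tl: "table_law n ?m s (code_bound (2 * n) (?m ^ ?m)) p k \<longleftrightarrow>
     (\<forall>x\<in>law_set (free_group n) p. fold (table_letter n ?m s) (x [^]\<^bsub>free_group n\<^esub> k) 0 = 0)"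
    if "table_valid n ?m s" for s p k
    by (rule table_law_iff[OF that]) simp
  moreover have "p < z + 3 \<longleftrightarrow> p \<le> z + 2" for p by auto
  ultimately show ?thesis
    unfolding decide_def Let_def dec fix_iff
    by (intro all_cong1 imp_cong HOL.refl) (auto simp only: tl)
qed

text \<open>The laws of a closed subgroup pass to the larger stabilizer of \<open>0\<close> in any action in which the generators fix \<open>0\<close>.
  Conversely, let \<open>y\<close> be an element outside \<open>H\<close> that must be in \<open>H\<close> according to the laws: the violating
  product if the index is finite, a short double commutator if it is infinite. The part \<open>T\<close> of the coset graph
  formed by the core and the path of \<open>y\<close> extends to an action on \<open>m\<close> points. There the generators fix \<open>0\<close>, but \<open>y\<close>
  does not, against the laws in that action.\<close>

theorem decide_correct:
  assumes U: "U = pv_join {pv_prod (Ab p) (Ab (p - 1)) | p. prime p}"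
    and z: "z = instance_code (n, ws)" and ws: "set ws \<subseteq> carrier (free_group n)"
  shows "decide z \<longleftrightarrow> closedin (pro_topology U (free_group n)) (generate (free_group n) (set ws))"
proof -
  let ?F = "free_group n" and ?H = "generate (free_group n) (set ws)" and ?m = "3 * z + 20"
  interpret F: group ?F by (rule group_free_group)
  have sub: "subgroup ?H ?F" by (rule F.generate_is_subgroup[OF ws])
  have H: "?H \<subseteq> carrier ?F" by (rule subgroup.subset[OF sub])
  have UV: "pv_prod (Ab q) (Ab (q - 1)) \<subseteq> U" if "prime q" for q
    using that unfolding U pv_join_def by blast
  have Ugrp: "group K \<and> finite (carrier K) \<and> torsion_law K" if "K \<in> U" for K
    using torsion_law_join that unfolding U by blast
  have "separable U ?F (esum_kernel n (2 - 1))"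
    by (rule esum_kernel_separable[OF UV]) auto
  then have ne: "U \<noteq> {}" unfolding separable_def by blast
  have len: "(\<Sum>w\<leftarrow>ws. Suc (length w)) \<le> z"
  proof -
    have "length w \<le> word_code w" for w
      using length_le_list_encode[of "map letter_code w"] by (simp add: word_code_def)
    then have "(\<Sum>w\<leftarrow>ws. Suc (length w)) \<le> (\<Sum>w\<leftarrow>ws. Suc (word_code w))"
      by (intro sum_list_mono) simp
    also have "\<dots> \<le> list_encode (map word_code ws)"
      using sum_list_le_list_encode[of "map word_code ws"] by (simp add: comp_def)
    also have "\<dots> \<le> z" using z by (simp add: le_prod_encode_2)
    finally show ?thesis .
  qed
  have bound: "Suc (\<Sum>w\<leftarrow>ws. Suc (length w)) \<le> z + 2" "2 \<le> z + 2" using len by simp_all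
  note decide = decide_iff[OF z ws]
  show ?thesis
  proof
    assume closed: "closedin (pro_topology U ?F) ?H"
    show "decide z"
      unfolding decide
    proof (intro allI impI ballI)
      fix s p x
      assume s: "table_valid n ?m s \<and> (\<forall>w\<in>set ws. fold (table_letter n ?m s) w 0 = 0)"
        and p: "p \<le> z + 2" "prime p" and x: "x \<in> law_set ?F p"
      have "set ws \<subseteq> {w \<in> carrier ?F. fold (table_letter n ?m s) w 0 = 0}"
        using s ws by blast
      then have "?H \<subseteq> {w \<in> carrier ?F. fold (table_letter n ?m s) w 0 = 0}"
        by (rule F.generate_subgroup_incl) (rule point_stabilizer[OF conjunct1[OF s]])
      moreover have "x [^]\<^bsub>?F\<^esub> law_exponent (z + 2) p \<in> ?H"
        by (rule closed_imp_laws[OF ne Ugrp ws closed bound(1) p(2,1) x])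
      ultimately show "fold (table_letter n ?m s) (x [^]\<^bsub>?F\<^esub> law_exponent (z + 2) p) 0 = 0"
        by blast
    qed
  next
    assume dec: "decide z"
    interpret stabilizer_core n "coset_act n" "rcosets\<^bsub>?F\<^esub> ?H" ?H ws
      by (rule coset_core[OF ws])
    \<comment> \<open>no word outside \<open>H\<close> with its path in a small \<open>T\<close> can be forced to fix \<open>0\<close> by the laws\<close>
    have embed: False
      if T: "T \<subseteq> rcosets\<^bsub>?F\<^esub> ?H" "finite T" "card T \<le> ?m" "core \<subseteq> T"
        and y: "y \<in> carrier ?F" "y \<notin> ?H" "visits (coset_act n) ?H y \<subseteq> T"
        and fixed: "\<And>s. table_valid n ?m s \<Longrightarrow>
          (\<forall>p\<le>z + 2. prime p \<longrightarrow> (\<forall>x\<in>law_set ?F p. fold (table_letter n ?m s) (x [^]\<^bsub>?F\<^esub> law_exponent (z + 2) p) 0 = 0)) \<Longrightarrow>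
          fold (table_letter n ?m s) y 0 = 0" for T y
    proof -
      have HT: "?H \<in> T" using T(4) by (auto simp: core_def)
      obtain s e where s: "s < code_bound ?m (2 * n * ?m)" "table_valid n ?m s"
        and e: "inj_on e T" "e ?H = 0" "e ` T \<subseteq> {..<?m}"
          "\<forall>x t. fst x < n \<longrightarrow> t \<in> T \<longrightarrow> coset_act n x t \<in> T \<longrightarrow> table_act n ?m s (letter_code x) (e t) = e (coset_act n x t)"
        by (rule partial_table[OF T(1-3) HT])
      have fold_e: "fold (table_letter n ?m s) w (e t) = e (fold (coset_act n) w t)"
        if "\<forall>x\<in>set w. fst x < n" "visits (coset_act n) t w \<subseteq> T" for w t
        using that
      proof (induction w arbitrary: t)
        case (Cons x w)
        have "coset_act n x t \<in> T" "t \<in> T"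
          using Cons.prems(2) start_in_visits[of "coset_act n x t" "coset_act n" w] by auto
        then have "table_act n ?m s (letter_code x) (e t) = e (coset_act n x t)"
          using e(4)[rule_format, of x t] Cons.prems(1) by simp
        moreover have "fold (table_letter n ?m s) w (e (coset_act n x t)) = e (fold (coset_act n) w (coset_act n x t))"
          by (rule Cons.IH) (use Cons.prems in auto)
        ultimately show ?case by simp
      qed simp
      have stab: "fold (table_letter n ?m s) w 0 = 0" if w: "w \<in> set ws" for w
      proof -
        have wc: "w \<in> carrier ?F" using ws w by blast
        have "visits (coset_act n) ?H w \<subseteq> T" using T(4) w by (auto simp: core_def)
        then have "fold (table_letter n ?m s) w 0 = e (fold (coset_act n) w ?H)"
          using fold_e[of w ?H] wc e(2) by (simp add: free_group_carrier)
        also have "\<dots> = 0"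
          using stabilizer[OF wc] generate.incl[OF w, of ?F] e(2) by simp
        finally show ?thesis .
      qed
      have "fold (table_letter n ?m s) y 0 = 0"
        by (rule fixed[OF s(2) dec[unfolded decide, THEN spec, THEN mp, OF s(1), THEN mp]])
          (use s(2) stab in blast)
      moreover have "fold (table_letter n ?m s) y 0 = e (fold (coset_act n) y ?H)"
        using fold_e[OF _ y(3)] y(1) e(2) by (simp add: free_group_carrier)
      moreover have "fold (coset_act n) y ?H \<noteq> ?H"
        using stabilizer[OF y(1)] y(2) by simp
      moreover have "fold (coset_act n) y ?H \<in> T"
      proof -
        have "fold (coset_act n) y ?H \<in> visits (coset_act n) ?H (y @ [])"
          unfolding visits_append using start_in_visits by simp
        then show ?thesis using y(3) by auto
      qed
      ultimately show False using inj_onD[OF e(1) _ _ HT, of "fold (coset_act n) y ?H"] e(2) by simp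
    qed
    show "closedin (pro_topology U ?F) ?H"
    proof (rule laws_imp_closed[OF UV _ ws bound])
      show "group K" if "K \<in> U" for K using Ugrp[OF that] by simp
      fix p x assume p: "prime p" "p \<le> z + 2" and x: "x \<in> law_set ?F p"
      let ?y = "x [^]\<^bsub>?F\<^esub> law_exponent (z + 2) p"
      have xc: "x \<in> carrier ?F" by (rule F.law_set_closed[OF x])
      then have yc: "?y \<in> carrier ?F" by simp
      show "?y \<in> ?H"
      proof (rule ccontr)
        assume ynot: "?y \<notin> ?H"
        show False
        proof (cases "finite (rcosets\<^bsub>?F\<^esub> ?H)")
          case True
          show False
          proof (rule embed[OF subset_refl True _ core_subset yc ynot])
            show "card (rcosets\<^bsub>?F\<^esub> ?H) \<le> ?m"
              using finite_index_bound[OF ws True] len by simp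
            show "visits (coset_act n) ?H ?y \<subseteq> rcosets\<^bsub>?F\<^esub> ?H"
              using visits_closed[OF _ base, of ?y] yc by (simp add: free_group_carrier)
          qed (use p x in blast)
        next
          case inf: False
          show False
          proof (cases "2 \<le> n")
            case False
            then have n: "n \<le> 1" by simp
            obtain a b c a' b' c' d e where x_eq: "x = law_value ?F p a b c a' b' c' d e"
              "{a, b, c, a', b', c', d, e} \<subseteq> carrier ?F"
              using x unfolding law_set_def mem_Collect_eq by (elim exE conjE)
            then have "x = \<one>\<^bsub>?F\<^esub>"
              by (simp add: law_value_def rank_one_commutative[OF n])
            then show False using ynot subgroup.one_closed[OF sub] by simp
          next
            case n: True
            obtain a b c d where abcd: "{a, b, c, d} \<subseteq> carrier ?F"
              "group_comm ?F (group_comm ?F a b) (group_comm ?F c d) \<notin> ?H"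
              "length (group_comm ?F (group_comm ?F a b) (group_comm ?F c d)) \<le> 2 * (\<Sum>w\<leftarrow>ws. Suc (length w)) + 16"
              by (rule infinite_index_double_comm[OF ws n inf])
            let ?c = "group_comm ?F (group_comm ?F a b) (group_comm ?F c d)"
            have cc: "?c \<in> carrier ?F" using abcd(1) by simp
            show False
            proof (rule embed[OF _ _ _ _ cc abcd(2)])
              let ?T = "core \<union> visits (coset_act n) ?H ?c"
              show "?T \<subseteq> rcosets\<^bsub>?F\<^esub> ?H"
                using core_subset visits_closed[OF _ base, of ?c] cc by (simp add: free_group_carrier)
              show "finite ?T" using finite_core finite_visits by simp
              have "card ?T \<le> card core + card (visits (coset_act n) ?H ?c)" by (rule card_Un_le)
              also have "\<dots> \<le> Suc (\<Sum>w\<leftarrow>ws. Suc (length w)) + Suc (length ?c)"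
                by (rule add_mono[OF card_core card_visits])
              also have "\<dots> \<le> ?m" using abcd(3) len by simp
              finally show "card ?T \<le> ?m" .
              fix s assume s: "table_valid n ?m s" and laws: "\<forall>p\<le>z + 2. prime p \<longrightarrow> (\<forall>x\<in>law_set ?F p.
                fold (table_letter n ?m s) (x [^]\<^bsub>?F\<^esub> law_exponent (z + 2) p) 0 = 0)"
              have "?c \<in> {w \<in> carrier ?F. fold (table_letter n ?m s) w 0 = 0}"
              proof (rule F.law_exponent_pow_mem[OF point_stabilizer[OF s] cc bound(2)])
                fix q :: nat assume q: "prime q" "q \<le> z + 2"
                have "?c \<in> law_set ?F q"
                  by (rule F.double_comm_in_law_set) (use abcd(1) in simp_all)
                then have "fold (table_letter n ?m s) (?c [^]\<^bsub>?F\<^esub> law_exponent (z + 2) q) 0 = 0"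
                  using laws q by blast
                then show "?c [^]\<^bsub>?F\<^esub> law_exponent (z + 2) q \<in> {w \<in> carrier ?F. fold (table_letter n ?m s) w 0 = 0}"
                  using cc by simp
              qed
              then show "fold (table_letter n ?m s) ?c 0 = 0" by simp
            qed auto
          qed
        qed
      qed
    qed
  qed
qed

theorem corollary7p5:
  fixes U :: group_class
  assumes "U = pv_join {pv_prod (Ab p) (Ab (p - 1)) | p. prime p}"
  shows "decidable_problem instance_code
           {(n, ws). set ws \<subseteq> carrier (free_group n)}
           (\<lambda>(n, ws). closedin (pro_topology U (free_group n)) (generate (free_group n) (set ws)))"
proof -
  obtain f where f: "total_recursive 1 f" "\<forall>xs. length xs = 1 \<longrightarrow> f xs = of_bool (decide (xs ! 0))"
    using computable_decide unfolding computable_pred_def computable_def by blast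
  show ?thesis
    unfolding decidable_problem_def
  proof (intro exI[of _ f] conjI f(1) ballI)
    fix x :: "nat \<times> letter list list" assume "x \<in> {(n, ws). set ws \<subseteq> carrier (free_group n)}"
    then obtain n ws where x: "x = (n, ws)" "set ws \<subseteq> carrier (free_group n)" by blast
    show "f [instance_code x] = (if (case x of (n, ws) \<Rightarrow> closedin (pro_topology U (free_group n)) (generate (free_group n) (set ws))) then 1 else 0)"
      using f(2) decide_correct[OF assms HOL.refl x(2)] by (simp add: x(1) of_bool_def del: instance_code.simps)
  qed
qed

end
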